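(* In the bond market described in the context, suppose that the support of the Lévy measure $\nu$ consists of infinitely many discrete points $\{x_i\}_{i=1}^\infty$ with $\lim_{i\to\infty}|x_i|=\infty$. If the set $$A=\Big\{(\omega,t)\in\Omega\times[0,T^\ast]:\ \exists\,\alpha=\alpha(\omega,t),\ 0<\alpha<\infty,\ \text{such that}\ \lim_{|x_i|\to\infty}\|G(t,x_i)\|_B=\alpha\Big\}$$ is of positive $P\otimes\lambda$ measure, then the market is not $L^2$-complete.
   Context: **Noise.** Fix $T^\ast>0$. Let $Z=(Z(t))_{t\in[0,T^\ast]}$ be a càdlàg Lévy process on a probability space $(\Omega,\mathcal{F},P)$, with jump measure $N(t,A)=\#\{s\in[0,t]:\Delta Z(s)\in A\}$, $\Delta Z(s)=Z(s)-Z(s-)$, Lévy measure $\nu$ ($\mathbf{E}N(t,A)=t\,\nu(A)$ when $0\notin\bar A$; $\nu(\{0\})=0$; $\int_{\mathbb{R}}(|x|^2\wedge 1)\,\nu(dx)<\infty$), compensated jump measure $\tilde N(t,A)=N(t,A)-t\,\nu(A)$, and Lévy–Itô decomposition $Z(t)=at+bW(t)+\int_0^t\int_{|x|<1}x\,\tilde N(ds,dx)+\int_0^t\int_{|x|\ge1}x\,N(ds,dx)$ with $a\in\mathbb{R}$, $b\ge0$ and $W$ a standard Wiener process adapted to $\mathcal{F}_t=\sigma\{Z(s):0\le s\le t\}$. $\lambda$ is Lebesgue measure on $[0,T^\ast]$. Dependence on $\omega$ is suppressed in the notation. In the situation of the claim, $\nu$ is given by the sequence of positive numbers $\nu(\{x_i\})$,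 and $\sum_i\nu(\{x_i\})<\infty$. **Integrands.** $\Phi$ is the class of predictable $\phi$ with $\int_0^{T^\ast}|\phi(s)|^2ds<\infty$ $P$-a.s. $\Psi_{1,2}$ is the class of predictable (i.e. $\mathcal{P}\otimes\mathcal{B}(\mathbb{R})$-measurable, $\mathcal{P}$ the predictable $\sigma$-field) $\psi(\omega,s,x)$ with $\int_0^{T^\ast}\int_{\mathbb{R}}(|\psi(s,x)|^2\wedge|\psi(s,x)|)\,\nu(dx)ds<\infty$ $P$-a.s. For such integrands $\int_0^\cdot\phi\,dW$ and $\int_0^\cdot\int_{\mathbb{R}}\psi\,d\tilde N$ are well-defined local martingales. **Bond market.** The forward rate satisfies $df(t,T)=\alpha(t,T)dt+\sigma(t,T)dW(t)+\int_{\mathbb{R}}\gamma(t,x,T)N(dt,dx)$, $t,T\in[0,T^\ast]$ (the drift $\alpha(t,T)$ is unrelated to the number $\alpha(\omega,t)$ in the claim), with predictable coefficients such that $P$-a.s. $\int_0^{T^\ast}\int_0^{T^\ast}|\alpha(t,T)|\,dTdt<\infty$, $\int_0^{T^\ast}\int_0^{T^\ast}|\sigma(t,T)|^2dTdt<\infty$, $\int_0^{T^\ast}\int_0^{T^\ast}\int_{\mathbb{R}}|\gamma(t,x,T)|\,\nu(dx)dTdt<\infty$, and $\alpha(t,T)=\sigma(t,T)=\gamma(t,x,T)=0$ for $t>T$ and all $x$. Bond prices are $P(t,T)=e^{-\int_t^Tf(t,s)ds}$; the bank account satisfies $dB(t)=f(t,t)B(t)dt$; discounted bond prices are $\hat P(t,T)=B(t)^{-1}P(t,T)$.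 Put $S(t,T)=-\int_t^T\sigma(t,s)ds$, $G(t,x,T)=-\int_t^T\gamma(t,x,s)ds$. Standing assumption: $P$ is a martingale measure, i.e. $\hat P(\cdot,T)$ is a $P$-local martingale for each $T\in[0,T^\ast]$; then $d\hat P(t,T)=\hat P(t-,T)\big(S(t,T)dW(t)+\int_{\mathbb{R}}(e^{G(t,x,T)}-1)\tilde N(dt,dx)\big)$. **Portfolios.** $J=\{T_i:i\in\mathbb{N}\}$ is a fixed countable dense subset of $[0,T^\ast]$; only bonds with maturities in $J$ are traded. $B$ also denotes the Banach space of bounded real sequences $z=(z_i)$ with $\|z\|_B=\sup_i|z_i|$. Restricting functions of $T$ to $J$, the objects $\hat P(t-)$, $S(t)=(S(t,T_i))_i$, $G(t,x)=(G(t,x,T_i))_i$, $e^{G(t,x)}-1=(e^{G(t,x,T_i)}-1)_i$ and their componentwise products are treated as elements of $B$; thus $\|G(t,x)\|_B=\sup_{T\in J}|G(t,x,T)|$. A trading strategy is a predictable $l^1$-valued process $\varphi(t)=(\varphi(t,T_j))_j$, and $\langle\varphi,z\rangle_{B^\ast,B}=\sum_j\varphi(T_j)z_j$ for $\varphi\in l^1$, $z\in B$. It is $\hat P$-integrable if $\langle\varphi(s),\hat P(s-)S(s)\rangle_{B^\ast,B}\in\Phi$ and $\langle\varphi(s),\hat P(s-)(e^{G(s,x)}-1)\rangle_{B^\ast,B}\in\Psi_{1,2}$, and then $$\int_0^t\langle\varphi(s),d\hat P(s)\rangle_{B^\ast,B}:=\int_0^t\langle\varphi(s),\hat P(s-)S(s)\rangle_{B^\ast,B}\,dW(s)+\int_0^t\int_{\mathbb{R}}\langle\varphi(s),\hat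 P(s-)(e^{G(s,x)}-1)\rangle_{B^\ast,B}\,\tilde N(ds,dx).$$ A $\hat P$-integrable $\varphi$ is admissible ($\varphi\in\mathcal{A}$) if $\int_0^\cdot\langle\varphi(s),d\hat P(s)\rangle_{B^\ast,B}$ is a martingale. **Completeness.** An $\mathcal{F}_{T^\ast}$-measurable random variable $X$ can be replicated if $X=x+\int_0^{T^\ast}\langle\varphi(t),d\hat P(t)\rangle_{B^\ast,B}$ for some $x\in\mathbb{R}$ and $\varphi\in\mathcal{A}$. The market is $L^2$-complete if every $X\in L^2(\Omega,\mathcal{F}_{T^\ast},P)$ can be replicated; it is not $L^2$-complete if some such $X$ cannot be replicated. *)

theory Defs
  imports "HOL-Probability.Probability"
begin

text \<open>
  Processes are functions \<open>real \<Rightarrow> 'w \<Rightarrow> real\<close> (time first), considered on the time interval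
  from \<open>0\<close> to a finite horizon. Their values outside the horizon play no role.
\<close>

section \<open>Paths, filtrations, martingales\<close>

definition cadlag_on :: "real \<Rightarrow> (real \<Rightarrow> real) \<Rightarrow> bool" where
  "cadlag_on Tst g \<longleftrightarrow>
     (\<forall>t\<in>{0..<Tst}. (g \<longlongrightarrow> g t) (at_right t)) \<and>
     (\<forall>t\<in>{0<..Tst}. \<exists>l. (g \<longlongrightarrow> l) (at_left t))"

text \<open>Left limit \<open>g(t-)\<close>, with the usual convention \<open>g(0-) = g(0)\<close>.\<close>

definition left_lim :: "(real \<Rightarrow> real) \<Rightarrow> real \<Rightarrow> real" where
  "left_lim g t = (if t \<le> 0 then g 0 else Lim (at_left t) g)"

text \<open>
  The filtration \<open>\<sigma>{Z(s) : 0 \<le> s \<le> t}\<close>, augmented by the events of probability zero.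
  Without the augmentation the continuous (cadlag) versions of stochastic integrals are in
  general not adapted.
\<close>

definition gen_filtration :: "'w measure \<Rightarrow> real \<Rightarrow> (real \<Rightarrow> 'w \<Rightarrow> real) \<Rightarrow> real \<Rightarrow> 'w measure" where
  "gen_filtration M Tst Z t = sigma (space M)
     ({Z s -` A \<inter> space M | s A. 0 \<le> s \<and> s \<le> t \<and> s \<le> Tst \<and> A \<in> sets borel} \<union> null_sets M)"

definition adapted :: "real \<Rightarrow> (real \<Rightarrow> 'w measure) \<Rightarrow> (real \<Rightarrow> 'w \<Rightarrow> real) \<Rightarrow> bool" where
  "adapted Tst F X \<longleftrightarrow> (\<forall>t\<in>{0..Tst}. X t \<in> borel_measurable (F t))"

definition martingale_on ::
  "'w measure \<Rightarrow> real \<Rightarrow> (real \<Rightarrow> 'w measure) \<Rightarrow> (real \<Rightarrow> 'w \<Rightarrow> real) \<Rightarrow> bool" where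
  "martingale_on M Tst F X \<longleftrightarrow>
     adapted Tst F X \<and>
     (\<forall>t\<in>{0..Tst}. integrable M (X t)) \<and>
     (\<forall>s t. 0 \<le> s \<and> s \<le> t \<and> t \<le> Tst \<longrightarrow>
        (AE \<omega> in M. real_cond_exp M (F s) (X t) \<omega> = X s \<omega>))"

text \<open>On a closed finite horizon a localizing sequence has to reach the horizon almost surely.\<close>

definition local_martingale_on ::
  "'w measure \<Rightarrow> real \<Rightarrow> (real \<Rightarrow> 'w measure) \<Rightarrow> (real \<Rightarrow> 'w \<Rightarrow> real) \<Rightarrow> bool" where
  "local_martingale_on M Tst F X \<longleftrightarrow>
     adapted Tst F X \<and>
     (AE \<omega> in M. cadlag_on Tst (\<lambda>t. X t \<omega>)) \<and>
     (\<exists>\<tau> :: nat \<Rightarrow> 'w \<Rightarrow> real.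
        (\<forall>n. stopping_time F (\<tau> n)) \<and>
        (\<forall>n. \<forall>\<omega>\<in>space M. 0 \<le> \<tau> n \<omega> \<and> \<tau> n \<omega> \<le> \<tau> (Suc n) \<omega> \<and> \<tau> n \<omega> \<le> Tst) \<and>
        (AE \<omega> in M. \<exists>n. \<tau> n \<omega> = Tst) \<and>
        (\<forall>n. martingale_on M Tst F (\<lambda>t \<omega>. X (min t (\<tau> n \<omega>)) \<omega>)))"

definition predictable_sigma :: "'w measure \<Rightarrow> real \<Rightarrow> (real \<Rightarrow> 'w measure) \<Rightarrow> ('w \<times> real) measure" where
  "predictable_sigma M Tst F = sigma (space M \<times> {0..Tst})
     ({A \<times> {0} | A. A \<in> sets (F 0)} \<union>
      {A \<times> {s<..t} | A s t. 0 \<le> s \<and> s < t \<and> t \<le> Tst \<and> A \<in> sets (F s)})"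

text \<open>
  \<open>Y\<^sub>n \<rightarrow> 0\<close> in probability. Outer probabilities are used because the events involve suprema
  over uncountably many times, which need not be measurable on an exceptional null event.
\<close>

definition tends_to_0_in_prob :: "'w measure \<Rightarrow> (nat \<Rightarrow> 'w \<Rightarrow> ennreal) \<Rightarrow> bool" where
  "tends_to_0_in_prob M Y \<longleftrightarrow>
     (\<forall>\<epsilon>::real. \<epsilon> > 0 \<longrightarrow>
       (\<exists>A. (\<forall>n. A n \<in> sets M \<and> {\<omega>\<in>space M. Y n \<omega> > ennreal \<epsilon>} \<subseteq> A n) \<and>
            (\<lambda>n. measure M (A n)) \<longlonglongrightarrow> 0))"


section \<open>Levy and Wiener processes\<close>

definition indep_of :: "'w measure \<Rightarrow> 'w measure \<Rightarrow> ('w \<Rightarrow> real) \<Rightarrow> bool" where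
  "indep_of M G D \<longleftrightarrow>
     prob_space.indep_set M (sets G) {D -` A \<inter> space M | A. A \<in> sets borel}"

definition levy_process :: "'w measure \<Rightarrow> real \<Rightarrow> (real \<Rightarrow> 'w \<Rightarrow> real) \<Rightarrow> bool" where
  "levy_process M Tst Z \<longleftrightarrow>
     (\<forall>t\<in>{0..Tst}. Z t \<in> borel_measurable M) \<and>
     (AE \<omega> in M. Z 0 \<omega> = 0) \<and>
     (\<forall>\<omega>\<in>space M. cadlag_on Tst (\<lambda>t. Z t \<omega>)) \<and>
     (\<forall>s t. 0 \<le> s \<and> s < t \<and> t \<le> Tst \<longrightarrow>
        indep_of M (gen_filtration M Tst Z s) (\<lambda>\<omega>. Z t \<omega> - Z s \<omega>) \<and>
        distr M borel (\<lambda>\<omega>. Z t \<omega> - Z s \<omega>) = distr M borel (Z (t - s)))"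

definition wiener_process ::
  "'w measure \<Rightarrow> real \<Rightarrow> (real \<Rightarrow> 'w measure) \<Rightarrow> (real \<Rightarrow> 'w \<Rightarrow> real) \<Rightarrow> bool" where
  "wiener_process M Tst F W \<longleftrightarrow>
     adapted Tst F W \<and>
     (AE \<omega> in M. W 0 \<omega> = 0) \<and>
     (AE \<omega> in M. continuous_on {0..Tst} (\<lambda>t. W t \<omega>)) \<and>
     (\<forall>s t. 0 \<le> s \<and> s < t \<and> t \<le> Tst \<longrightarrow>
        indep_of M (F s) (\<lambda>\<omega>. W t \<omega> - W s \<omega>) \<and>
        distributed M lborel (\<lambda>\<omega>. W t \<omega> - W s \<omega>)
          (\<lambda>x. ennreal (normal_density 0 (sqrt (t - s)) x)))"

definition jump :: "(real \<Rightarrow> 'w \<Rightarrow> real) \<Rightarrow> real \<Rightarrow> 'w \<Rightarrow> real" where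
  "jump Z s \<omega> = Z s \<omega> - left_lim (\<lambda>r. Z r \<omega>) s"

text \<open>The jump measure \<open>N(t,A)\<close>.\<close>

definition jump_count :: "(real \<Rightarrow> 'w \<Rightarrow> real) \<Rightarrow> real \<Rightarrow> real set \<Rightarrow> 'w \<Rightarrow> ennreal" where
  "jump_count Z t A \<omega> = emeasure (count_space UNIV) {s\<in>{0..t}. jump Z s \<omega> \<in> A}"

text \<open>
  The integral of \<open>\<psi>\<close> with respect to \<open>N\<close> over \<open>[0,t] \<times> \<real>\<close>, as a sum over the jumps of \<open>Z\<close>.
  Only genuine jumps are counted, i.e. \<open>N\<close> does not charge \<open>x = 0\<close>.
\<close>

definition jump_times :: "(real \<Rightarrow> 'w \<Rightarrow> real) \<Rightarrow> real \<Rightarrow> 'w \<Rightarrow> real set" where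
  "jump_times Z t \<omega> = {s\<in>{0..t}. jump Z s \<omega> \<noteq> 0}"

definition jump_integral ::
  "(real \<Rightarrow> 'w \<Rightarrow> real) \<Rightarrow> (real \<Rightarrow> real \<Rightarrow> 'w \<Rightarrow> real) \<Rightarrow> real \<Rightarrow> 'w \<Rightarrow> real" where
  "jump_integral Z \<psi> t \<omega> = (\<Sum>\<^sub>\<infinity>s\<in>jump_times Z t \<omega>. \<psi> s (jump Z s \<omega>) \<omega>)"


section \<open>Integrands and stochastic integrals\<close>

text \<open>
  The classes \<open>\<Phi>\<close> and \<open>\<Psi>\<^sub>1\<^sub>,\<^sub>2\<close>. As usual, a process that coincides with a predictable one outside
  an event of probability zero is admitted; this accommodates left limits of processes whose
  paths are cadlag only almost surely.
\<close>

definition Phi_class :: "'w measure \<Rightarrow> real \<Rightarrow> (real \<Rightarrow> 'w measure) \<Rightarrow> (real \<Rightarrow> 'w \<Rightarrow> real) set" where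
  "Phi_class M Tst F = {\<phi>.
     (\<exists>\<phi>'. (\<lambda>(\<omega>, s). \<phi>' s \<omega>) \<in> borel_measurable (predictable_sigma M Tst F) \<and>
           (AE \<omega> in M. \<forall>s\<in>{0..Tst}. \<phi> s \<omega> = \<phi>' s \<omega>)) \<and>
     (AE \<omega> in M. (\<integral>\<^sup>+ s\<in>{0..Tst}. ennreal (\<bar>\<phi> s \<omega>\<bar>\<^sup>2) \<partial>lborel) < \<infinity>)}"

definition Psi12_class ::
  "'w measure \<Rightarrow> real \<Rightarrow> (real \<Rightarrow> 'w measure) \<Rightarrow> real measure \<Rightarrow> (real \<Rightarrow> real \<Rightarrow> 'w \<Rightarrow> real) set" where
  "Psi12_class M Tst F \<nu> = {\<psi>.
     (\<exists>\<psi>'. (\<lambda>((\<omega>, s), x). \<psi>' s x \<omega>) \<in> borel_measurable (predictable_sigma M Tst F \<Otimes>\<^sub>M borel) \<and>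
           (AE \<omega> in M. \<forall>s\<in>{0..Tst}. \<forall>x. \<psi> s x \<omega> = \<psi>' s x \<omega>)) \<and>
     (AE \<omega> in M. (\<integral>\<^sup>+ s\<in>{0..Tst}.
         (\<integral>\<^sup>+ x. ennreal (min (\<bar>\<psi> s x \<omega>\<bar>\<^sup>2) \<bar>\<psi> s x \<omega>\<bar>) \<partial>\<nu>) \<partial>lborel) < \<infinity>)}"

text \<open>
  Simple integrands \<open>\<Sum>k<n. h\<^sub>k 1\<^bsub>(\<tau>\<^sub>k, \<tau>\<^sub>k\<^sub>+\<^sub>1]\<^esub>\<close> with bounded, \<open>F(\<tau>\<^sub>k)\<close>-measurable
  coefficients \<open>h\<^sub>k\<close> and deterministic times \<open>\<tau>\<^sub>k\<close>, and their integrals.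
\<close>

definition simple_integrand ::
  "'w measure \<Rightarrow> real \<Rightarrow> (real \<Rightarrow> 'w measure) \<Rightarrow> nat \<Rightarrow> (nat \<Rightarrow> real) \<Rightarrow> (nat \<Rightarrow> 'w \<Rightarrow> real) \<Rightarrow> bool" where
  "simple_integrand M Tst F n \<tau> h \<longleftrightarrow>
     0 \<le> \<tau> 0 \<and> \<tau> n \<le> Tst \<and> (\<forall>k<n. \<tau> k \<le> \<tau> (Suc k)) \<and>
     (\<forall>k<n. h k \<in> borel_measurable (F (\<tau> k)) \<and> (\<exists>C. \<forall>\<omega>\<in>space M. \<bar>h k \<omega>\<bar> \<le> C))"

definition simple_process ::
  "nat \<Rightarrow> (nat \<Rightarrow> real) \<Rightarrow> (nat \<Rightarrow> 'w \<Rightarrow> real) \<Rightarrow> real \<Rightarrow> 'w \<Rightarrow> real" where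
  "simple_process n \<tau> h t \<omega> = (\<Sum>k<n. h k \<omega> * indicator {\<tau> k<..\<tau> (Suc k)} t)"

definition simple_integral ::
  "(real \<Rightarrow> 'w \<Rightarrow> real) \<Rightarrow> nat \<Rightarrow> (nat \<Rightarrow> real) \<Rightarrow> (nat \<Rightarrow> 'w \<Rightarrow> real) \<Rightarrow> real \<Rightarrow> 'w \<Rightarrow> real" where
  "simple_integral W n \<tau> h t \<omega> =
     (\<Sum>k<n. h k \<omega> * (W (min (\<tau> (Suc k)) t) \<omega> - W (min (\<tau> k) t) \<omega>))"

text \<open>
  \<open>X\<close> is (a version of) the Ito integral process of \<open>\<phi>\<close> with respect to \<open>W\<close>: the continuous
  adapted process that is the limit, uniformly in time in probability, of the integrals of
  simple integrands \<open>H\<^sub>m\<close> such that the time integral of \<open>\<bar>\<phi> - H\<^sub>m\<bar>\<^sup>2\<close> tends to \<open>0\<close> in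
  probability. For \<open>\<phi> \<in> \<Phi>\<close> it exists and is unique up to indistinguishability.
\<close>

definition is_ito_integral ::
  "'w measure \<Rightarrow> real \<Rightarrow> (real \<Rightarrow> 'w measure) \<Rightarrow> (real \<Rightarrow> 'w \<Rightarrow> real) \<Rightarrow>
   (real \<Rightarrow> 'w \<Rightarrow> real) \<Rightarrow> (real \<Rightarrow> 'w \<Rightarrow> real) \<Rightarrow> bool" where
  "is_ito_integral M Tst F W \<phi> X \<longleftrightarrow>
     adapted Tst F X \<and>
     (AE \<omega> in M. continuous_on {0..Tst} (\<lambda>t. X t \<omega>)) \<and>
     (\<exists>n \<tau> h. (\<forall>m. simple_integrand M Tst F (n m) (\<tau> m) (h m)) \<and>
        tends_to_0_in_prob M (\<lambda>m \<omega>.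
          \<integral>\<^sup>+ s\<in>{0..Tst}. ennreal (\<bar>\<phi> s \<omega> - simple_process (n m) (\<tau> m) (h m) s \<omega>\<bar>\<^sup>2) \<partial>lborel) \<and>
        tends_to_0_in_prob M (\<lambda>m \<omega>.
          SUP t\<in>{0..Tst}. ennreal \<bar>X t \<omega> - simple_integral W (n m) (\<tau> m) (h m) t \<omega>\<bar>))"

text \<open>
  \<open>Y\<close> is (a version of) the integral process of \<open>\<psi>\<close> with respect to the compensated jump measure.
  If \<open>\<bar>\<psi>\<bar>\<close> is integrable for \<open>ds \<nu>(dx)\<close> almost surely, the integral is the difference of the
  integrals with respect to \<open>N\<close> and \<open>ds \<nu>(dx)\<close>. For \<open>\<psi> \<in> \<Psi>\<^sub>1\<^sub>,\<^sub>2\<close> this applies to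
  \<open>\<psi> 1\<^bsub>\<bar>\<psi>\<bar> > \<epsilon>\<^esub>\<close>, and the integral of \<open>\<psi>\<close> is the limit of these integrals as \<open>\<epsilon>\<close> tends to
  \<open>0\<close>, uniformly in time in probability.
\<close>

definition compensated_jump_integral ::
  "(real \<Rightarrow> 'w \<Rightarrow> real) \<Rightarrow> real measure \<Rightarrow> (real \<Rightarrow> real \<Rightarrow> 'w \<Rightarrow> real) \<Rightarrow> real \<Rightarrow> 'w \<Rightarrow> real" where
  "compensated_jump_integral Z \<nu> \<psi> t \<omega> =
     jump_integral Z \<psi> t \<omega> - (LINT s:{0..t}|lborel. (LINT x|\<nu>. \<psi> s x \<omega>))"

definition truncate :: "real \<Rightarrow> (real \<Rightarrow> real \<Rightarrow> 'w \<Rightarrow> real) \<Rightarrow> real \<Rightarrow> real \<Rightarrow> 'w \<Rightarrow> real" where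
  "truncate \<epsilon> \<psi> s x \<omega> = (if \<bar>\<psi> s x \<omega>\<bar> > \<epsilon> then \<psi> s x \<omega> else 0)"

definition is_compensated_integral ::
  "'w measure \<Rightarrow> real \<Rightarrow> (real \<Rightarrow> 'w measure) \<Rightarrow> (real \<Rightarrow> 'w \<Rightarrow> real) \<Rightarrow> real measure \<Rightarrow>
   (real \<Rightarrow> real \<Rightarrow> 'w \<Rightarrow> real) \<Rightarrow> (real \<Rightarrow> 'w \<Rightarrow> real) \<Rightarrow> bool" where
  "is_compensated_integral M Tst F Z \<nu> \<psi> Y \<longleftrightarrow>
     adapted Tst F Y \<and>
     (AE \<omega> in M. cadlag_on Tst (\<lambda>t. Y t \<omega>)) \<and>
     tends_to_0_in_prob M (\<lambda>n \<omega>. SUP t\<in>{0..Tst}.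
       ennreal \<bar>Y t \<omega> - compensated_jump_integral Z \<nu> (truncate (1 / real (Suc n)) \<psi>) t \<omega>\<bar>)"


section \<open>The noise\<close>

text \<open>
  If \<open>b = 0\<close>, then no Wiener process is adapted to the filtration of \<open>Z\<close>. This purely
  discontinuous case is covered by the convention \<open>W = 0\<close>, so that all \<open>dW\<close>-integrals vanish.
\<close>

locale levy_noise = prob_space M
  for M :: "'w measure" +
  fixes Tst :: real
    and Z :: "real \<Rightarrow> 'w \<Rightarrow> real"
    and a b :: real
    and W :: "real \<Rightarrow> 'w \<Rightarrow> real"
    and \<nu> :: "real measure"
  assumes horizon_pos: "Tst > 0"
    and levy: "levy_process M Tst Z"
    and sets_nu: "sets \<nu> = sets borel"
    and nu_zero: "emeasure \<nu> {0} = 0"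
    and nu_integrable: "(\<integral>\<^sup>+ x. ennreal (min (\<bar>x\<bar>\<^sup>2) 1) \<partial>\<nu>) < \<infinity>"
    and nu_intensity: "\<And>t A. t \<in> {0..Tst} \<Longrightarrow> A \<in> sets borel \<Longrightarrow> 0 \<notin> closure A \<Longrightarrow>
          (\<integral>\<^sup>+ \<omega>. jump_count Z t A \<omega> \<partial>M) = ennreal t * emeasure \<nu> A"
    and b_nonneg: "b \<ge> 0"
    and W_wiener: "b > 0 \<Longrightarrow> wiener_process M Tst (gen_filtration M Tst Z) W"
    and W_absent: "b = 0 \<Longrightarrow> (\<forall>t\<in>{0..Tst}. \<forall>\<omega>\<in>space M. W t \<omega> = 0)"
    and levy_ito: "\<exists>Y.
          is_compensated_integral M Tst (gen_filtration M Tst Z) Z \<nu>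
            (\<lambda>s x \<omega>. if \<bar>x\<bar> < 1 then x else 0) Y \<and>
          (AE \<omega> in M. \<forall>t\<in>{0..Tst}.
             Z t \<omega> = a * t + b * W t \<omega> + Y t \<omega>
               + jump_integral Z (\<lambda>s x \<omega>. if \<bar>x\<bar> \<ge> 1 then x else 0) t \<omega>)"
begin

abbreviation F :: "real \<Rightarrow> 'w measure" where
  "F \<equiv> gen_filtration M Tst Z"

abbreviation pred_alg :: "('w \<times> real) measure" where
  "pred_alg \<equiv> predictable_sigma M Tst F"

abbreviation maturities :: "real measure" where
  "maturities \<equiv> restrict_space borel {0..Tst}"

end


section \<open>The bond market\<close>

text \<open>
  All integrals in the maturity variable are oriented, since discounted bond prices are
  considered on the whole time interval, also after maturity.
\<close>

definition bond_price :: "(real \<Rightarrow> real \<Rightarrow> 'w \<Rightarrow> real) \<Rightarrow> real \<Rightarrow> real \<Rightarrow> 'w \<Rightarrow> real" where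
  "bond_price f t T \<omega> = exp (- (LBINT s=ereal t..ereal T. f t s \<omega>))"

definition disc_bond_price ::
  "(real \<Rightarrow> real \<Rightarrow> 'w \<Rightarrow> real) \<Rightarrow> (real \<Rightarrow> 'w \<Rightarrow> real) \<Rightarrow> real \<Rightarrow> real \<Rightarrow> 'w \<Rightarrow> real" where
  "disc_bond_price f B t T \<omega> = inverse (B t \<omega>) * bond_price f t T \<omega>"

definition disc_bond_price_left ::
  "(real \<Rightarrow> real \<Rightarrow> 'w \<Rightarrow> real) \<Rightarrow> (real \<Rightarrow> 'w \<Rightarrow> real) \<Rightarrow> real \<Rightarrow> real \<Rightarrow> 'w \<Rightarrow> real" where
  "disc_bond_price_left f B t T \<omega> = left_lim (\<lambda>r. disc_bond_price f B r T \<omega>) t"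

definition S_coeff :: "(real \<Rightarrow> real \<Rightarrow> 'w \<Rightarrow> real) \<Rightarrow> real \<Rightarrow> real \<Rightarrow> 'w \<Rightarrow> real" where
  "S_coeff \<sigma> t T \<omega> = - (LBINT s=ereal t..ereal T. \<sigma> t s \<omega>)"

definition G_coeff :: "(real \<Rightarrow> real \<Rightarrow> real \<Rightarrow> 'w \<Rightarrow> real) \<Rightarrow> real \<Rightarrow> real \<Rightarrow> real \<Rightarrow> 'w \<Rightarrow> real" where
  "G_coeff \<gamma> t x T \<omega> = - (LBINT s=ereal t..ereal T. \<gamma> t x s \<omega>)"

text \<open>The supremum norm of a real sequence; it is \<open>\<infinity>\<close> exactly if the sequence is not in \<open>B\<close>.\<close>

definition norm_B :: "(nat \<Rightarrow> real) \<Rightarrow> ennreal" where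
  "norm_B z = (SUP i. ennreal \<bar>z i\<bar>)"

text \<open>The duality of \<open>l\<^sup>1\<close> and \<open>B\<close>.\<close>

definition pairing :: "(nat \<Rightarrow> real) \<Rightarrow> (nat \<Rightarrow> real) \<Rightarrow> real" where
  "pairing p z = (\<Sum>j. p j * z j)"

text \<open>
  \<open>f t T\<close> is the forward rate, \<open>B\<close> the bank account and \<open>Tm\<close> the enumeration of the set \<open>J\<close> of
  traded maturities. The conditions \<open>drift_ok\<close>, \<open>jumps_ok\<close>, \<open>f_integrable\<close> and
  \<open>short_rate_ok\<close> say that the integrals in the forward rate dynamics, the bond prices and the
  bank account exist. That the sequences \<open>S(t)\<close> and \<open>G(t,x)\<close> belong to \<open>B\<close> (almost
  everywhere) follows from the integrability of \<open>\<sigma>\<close> and \<open>\<gamma>\<close>.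
\<close>

locale bond_market = levy_noise M Tst Z a b W \<nu>
  for M :: "'w measure" and Tst :: real and Z :: "real \<Rightarrow> 'w \<Rightarrow> real" and a b :: real
    and W :: "real \<Rightarrow> 'w \<Rightarrow> real" and \<nu> :: "real measure" +
  fixes f :: "real \<Rightarrow> real \<Rightarrow> 'w \<Rightarrow> real"
    and \<alpha> :: "real \<Rightarrow> real \<Rightarrow> 'w \<Rightarrow> real"
    and \<sigma> :: "real \<Rightarrow> real \<Rightarrow> 'w \<Rightarrow> real"
    and \<gamma> :: "real \<Rightarrow> real \<Rightarrow> real \<Rightarrow> 'w \<Rightarrow> real"
    and B :: "real \<Rightarrow> 'w \<Rightarrow> real"
    and Tm :: "nat \<Rightarrow> real"
  assumes alpha_predictable:
        "(\<lambda>((\<omega>, t), T). \<alpha> t T \<omega>) \<in> borel_measurable (pred_alg \<Otimes>\<^sub>M maturities)"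
    and sigma_predictable:
        "(\<lambda>((\<omega>, t), T). \<sigma> t T \<omega>) \<in> borel_measurable (pred_alg \<Otimes>\<^sub>M maturities)"
    and gamma_predictable:
        "(\<lambda>(((\<omega>, t), x), T). \<gamma> t x T \<omega>)
           \<in> borel_measurable ((pred_alg \<Otimes>\<^sub>M (borel :: real measure)) \<Otimes>\<^sub>M maturities)"
    and alpha_integrable: "AE \<omega> in M.
          (\<integral>\<^sup>+ t\<in>{0..Tst}. (\<integral>\<^sup>+ T\<in>{0..Tst}. ennreal \<bar>\<alpha> t T \<omega>\<bar> \<partial>lborel) \<partial>lborel) < \<infinity>"
    and sigma_integrable: "AE \<omega> in M.
          (\<integral>\<^sup>+ t\<in>{0..Tst}. (\<integral>\<^sup>+ T\<in>{0..Tst}. ennreal (\<bar>\<sigma> t T \<omega>\<bar>\<^sup>2) \<partial>lborel) \<partial>lborel) < \<infinity>"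
    and gamma_integrable: "AE \<omega> in M.
          (\<integral>\<^sup>+ t\<in>{0..Tst}. (\<integral>\<^sup>+ T\<in>{0..Tst}. (\<integral>\<^sup>+ x. ennreal \<bar>\<gamma> t x T \<omega>\<bar> \<partial>\<nu>) \<partial>lborel) \<partial>lborel) < \<infinity>"
    and zero_after_maturity: "AE \<omega> in M. \<forall>t\<in>{0..Tst}. \<forall>T\<in>{0..Tst}. t > T \<longrightarrow>
          \<alpha> t T \<omega> = 0 \<and> \<sigma> t T \<omega> = 0 \<and> (\<forall>x. \<gamma> t x T \<omega> = 0)"
    and drift_ok: "\<And>T. T \<in> {0..Tst} \<Longrightarrow>
          AE \<omega> in M. set_integrable lborel {0..Tst} (\<lambda>s. \<alpha> s T \<omega>)"
    and jumps_ok: "\<And>T. T \<in> {0..Tst} \<Longrightarrow>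
          AE \<omega> in M. (\<lambda>s. \<gamma> s (jump Z s \<omega>) T \<omega>) summable_on jump_times Z Tst \<omega>"
    and forward_rate: "\<And>T. T \<in> {0..Tst} \<Longrightarrow>
          \<exists>X. is_ito_integral M Tst F W (\<lambda>s. \<sigma> s T) X \<and>
            (AE \<omega> in M. \<forall>t\<in>{0..Tst}.
               f t T \<omega> = f 0 T \<omega> + (LINT s:{0..t}|lborel. \<alpha> s T \<omega>) + X t \<omega>
                 + jump_integral Z (\<lambda>s x. \<gamma> s x T) t \<omega>)"
    and f_integrable: "AE \<omega> in M. \<forall>t\<in>{0..Tst}. set_integrable lborel {0..Tst} (\<lambda>s. f t s \<omega>)"
    and short_rate_ok: "AE \<omega> in M. set_integrable lborel {0..Tst} (\<lambda>s. f s s \<omega> * B s \<omega>)"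
    and bank_account: "AE \<omega> in M. B 0 \<omega> > 0 \<and>
          (\<forall>t\<in>{0..Tst}. B t \<omega> = B 0 \<omega> + (LINT s:{0..t}|lborel. f s s \<omega> * B s \<omega>))"
    and martingale_measure: "\<And>T. T \<in> {0..Tst} \<Longrightarrow>
          local_martingale_on M Tst F (\<lambda>t. disc_bond_price f B t T)"
    and maturities_dense: "range Tm \<subseteq> {0..Tst}" "{0..Tst} \<subseteq> closure (range Tm)"
    and prices_in_B: "AE \<omega> in M. \<forall>t\<in>{0..Tst}. norm_B (\<lambda>i. disc_bond_price_left f B t (Tm i) \<omega>) < \<infinity>"
begin

text \<open>
  A strategy is an \<open>l\<^sup>1\<close>-valued process; as \<open>l\<^sup>1\<close> is separable, predictability amounts to
  predictability of all coordinates. \<open>\<phi> t \<omega> j\<close> is the position in the bond with maturity \<open>Tm j\<close>.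
\<close>

definition trading_strategy :: "(real \<Rightarrow> 'w \<Rightarrow> nat \<Rightarrow> real) \<Rightarrow> bool" where
  "trading_strategy \<phi> \<longleftrightarrow>
     (\<forall>t\<in>{0..Tst}. \<forall>\<omega>\<in>space M. summable (\<lambda>j. \<bar>\<phi> t \<omega> j\<bar>)) \<and>
     (\<forall>j. (\<lambda>(\<omega>, t). \<phi> t \<omega> j) \<in> borel_measurable pred_alg)"

definition W_integrand :: "(real \<Rightarrow> 'w \<Rightarrow> nat \<Rightarrow> real) \<Rightarrow> real \<Rightarrow> 'w \<Rightarrow> real" where
  "W_integrand \<phi> s \<omega> =
     pairing (\<phi> s \<omega>) (\<lambda>j. disc_bond_price_left f B s (Tm j) \<omega> * S_coeff \<sigma> s (Tm j) \<omega>)"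

definition N_integrand :: "(real \<Rightarrow> 'w \<Rightarrow> nat \<Rightarrow> real) \<Rightarrow> real \<Rightarrow> real \<Rightarrow> 'w \<Rightarrow> real" where
  "N_integrand \<phi> s x \<omega> =
     pairing (\<phi> s \<omega>) (\<lambda>j. disc_bond_price_left f B s (Tm j) \<omega> * (exp (G_coeff \<gamma> s x (Tm j) \<omega>) - 1))"

definition price_integrable :: "(real \<Rightarrow> 'w \<Rightarrow> nat \<Rightarrow> real) \<Rightarrow> bool" where
  "price_integrable \<phi> \<longleftrightarrow>
     trading_strategy \<phi> \<and>
     W_integrand \<phi> \<in> Phi_class M Tst F \<and>
     N_integrand \<phi> \<in> Psi12_class M Tst F \<nu>"

text \<open>\<open>V\<close> is (a version of) the process of integrals of \<open>\<phi>\<close> with respect to the discounted prices.\<close>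

definition is_price_integral :: "(real \<Rightarrow> 'w \<Rightarrow> nat \<Rightarrow> real) \<Rightarrow> (real \<Rightarrow> 'w \<Rightarrow> real) \<Rightarrow> bool" where
  "is_price_integral \<phi> V \<longleftrightarrow>
     (\<exists>X Y. is_ito_integral M Tst F W (W_integrand \<phi>) X \<and>
            is_compensated_integral M Tst F Z \<nu> (N_integrand \<phi>) Y \<and>
            V = (\<lambda>t \<omega>. X t \<omega> + Y t \<omega>))"

definition admissible :: "(real \<Rightarrow> 'w \<Rightarrow> nat \<Rightarrow> real) \<Rightarrow> bool" where
  "admissible \<phi> \<longleftrightarrow>
     price_integrable \<phi> \<and> (\<exists>V. is_price_integral \<phi> V \<and> martingale_on M Tst F V)"

definition replicable :: "('w \<Rightarrow> real) \<Rightarrow> bool" where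
  "replicable X \<longleftrightarrow>
     (\<exists>x \<phi> V. admissible \<phi> \<and> is_price_integral \<phi> V \<and> (AE \<omega> in M. X \<omega> = x + V Tst \<omega>))"

definition L2_complete :: bool where
  "L2_complete \<longleftrightarrow>
     (\<forall>X. X \<in> borel_measurable (F Tst) \<and> integrable M (\<lambda>\<omega>. (X \<omega>)\<^sup>2) \<longrightarrow> replicable X)"

end

text \<open>The topological support of a Borel measure.\<close>

definition measure_support :: "real measure \<Rightarrow> real set" where
  "measure_support \<mu> = {x. \<forall>U. open U \<and> x \<in> U \<longrightarrow> emeasure \<mu> U > 0}"

end

theory Submission
  imports Defs
begin

text \<open>
  Since the support of \<open>\<nu>\<close> is discrete, \<open>\<nu>\<close> is finite and \<open>Z\<close> almost surely has finitely many jumps,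
  all with sizes \<open>x i\<close>. Choose weights \<open>c i\<close> that are unbounded but integrable and square-integrable
  for \<open>\<nu>\<close>. The compensated sum \<open>U\<close> of the weights of the jumps is a square-integrable martingale. If
  its terminal value were replicated by a strategy \<open>\<phi>\<close>, then the price integral would be a martingale
  with the same terminal value up to a constant, so it would have the same jumps as \<open>U\<close>. Hence the
  \<open>N\<close>-integrand of \<open>\<phi>\<close> would equal \<open>c i\<close> at every jump of size \<open>x i\<close>, and by the compensator
  formula for predictable sets it would equal \<open>c i\<close> at \<open>x i\<close> almost everywhere. But where
  \<open>\<parallel>G(t, x i)\<parallel>\<close> converges, the integrand is bounded in \<open>i\<close>, because \<open>\<phi>\<close> is \<open>l\<^sup>1\<close>-valued.
\<close>

section \<open>Jumps of cadlag paths\<close>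

text \<open>Three obstacles shape the proof. Replication is only an identity between random
  variables at the terminal time, while the integrand is seen through jumps of paths. Conditioning
  carries the identity to each fixed time, hence to countably many times at once, and one-sided
  limits then carry it to the random jump times; the Wiener part drops out there because it is
  continuous. Secondly, the moments of the jump counts have to be extracted from the intensity and
  from the independence of the increments of \<open>Z\<close>. Discreteness makes this possible:
  there is a gap around each atom, so that a jump count is a limit of counts of increments over a
  grid. Thirdly, the stochastic integrals are given as limits in probability, unique only up to
  versions, so that the version that is a martingale and the version that replicates have to be
  matched at the terminal time. The weights exist because \<nu> is finite: the masses of the atoms
  tend to 0, and a weight may grow along a sparse subsequence of them.\<close>

lemma cadlag_left_lim:
  assumes "cadlag_on T g" "0 < s" "s \<le> T"
  shows "(g \<longlongrightarrow> left_lim g s) (at_left s)"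
proof -
  obtain l where l: "(g \<longlongrightarrow> l) (at_left s)"
    using assms unfolding cadlag_on_def by force
  then have "Lim (at_left s) g = l"
    by (intro tendsto_Lim) simp_all
  with l assms show ?thesis by (simp add: left_lim_def)
qed

text \<open>On either side of \<open>s\<close> the path oscillates by less than \<epsilon>, because
  both one-sided limits exist; an increment across \<open>s\<close> is then close to the jump at
  \<open>s\<close>. The value \<open>g s\<close> belongs to the right side, whence the condition
  \<open>q < s \<and> s \<le> r\<close>.\<close>

lemma cadlag_local:
  assumes g: "cadlag_on T g" and e: "\<epsilon> > 0" and s: "s \<in> {0..T}"
  shows "\<exists>\<eta>>0. \<forall>q r. 0 \<le> q \<longrightarrow> q < r \<longrightarrow> r \<le> T \<longrightarrow> \<bar>q - s\<bar> < \<eta> \<longrightarrow> \<bar>r - s\<bar> < \<eta> \<longrightarrow>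
           \<bar>g r - g q - (if q < s \<and> s \<le> r then g s - left_lim g s else 0)\<bar> < \<epsilon>"
proof -
  have "\<exists>a>0. \<forall>y. 0 \<le> y \<longrightarrow> s - a < y \<longrightarrow> y < s \<longrightarrow> \<bar>g y - left_lim g s\<bar> < \<epsilon> / 2"
  proof (cases "s = 0")
    case True then show ?thesis by (intro exI[of _ 1]) auto
  next
    case False
    then have "(g \<longlongrightarrow> left_lim g s) (at_left s)" using cadlag_left_lim[OF g] s by auto
    then have "\<forall>\<^sub>F y in at_left s. dist (g y) (left_lim g s) < \<epsilon> / 2"
      using e by (intro tendstoD) auto
    then obtain b where "b < s" "\<And>y. b < y \<Longrightarrow> y < s \<Longrightarrow> dist (g y) (left_lim g s) < \<epsilon> / 2"
      unfolding eventually_at_left_field by auto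
    then show ?thesis by (intro exI[of _ "s - b"]) (auto simp: dist_real_def)
  qed
  then obtain a where a: "a > 0"
    "\<And>y. 0 \<le> y \<Longrightarrow> s - a < y \<Longrightarrow> y < s \<Longrightarrow> \<bar>g y - left_lim g s\<bar> < \<epsilon> / 2" by auto
  have "\<exists>c>0. \<forall>y. y \<le> T \<longrightarrow> s \<le> y \<longrightarrow> y < s + c \<longrightarrow> \<bar>g y - g s\<bar> < \<epsilon> / 2"
  proof (cases "s = T")
    case True then show ?thesis using e by (intro exI[of _ 1]) (auto dest: antisym)
  next
    case False
    then have "(g \<longlongrightarrow> g s) (at_right s)" using g s unfolding cadlag_on_def by auto
    then have "\<forall>\<^sub>F y in at_right s. dist (g y) (g s) < \<epsilon> / 2"
      using e by (intro tendstoD) auto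
    then obtain b where b: "b > s" "\<And>y. s < y \<Longrightarrow> y < b \<Longrightarrow> dist (g y) (g s) < \<epsilon> / 2"
      unfolding eventually_at_right_field by auto
    have "\<bar>g y - g s\<bar> < \<epsilon> / 2" if "s \<le> y" "y < b" for y
      using b(2)[of y] that e by (cases "y = s") (auto simp: dist_real_def)
    with b(1) show ?thesis by (intro exI[of _ "b - s"]) auto
  qed
  then obtain c where c: "c > 0"
    "\<And>y. y \<le> T \<Longrightarrow> s \<le> y \<Longrightarrow> y < s + c \<Longrightarrow> \<bar>g y - g s\<bar> < \<epsilon> / 2" by auto
  show ?thesis
  proof (intro exI[of _ "min a c"] conjI allI impI)
    show "0 < min a c" using a c by simp
    fix q r assume q: "0 \<le> q" "q < r" "r \<le> T" "\<bar>q - s\<bar> < min a c" "\<bar>r - s\<bar> < min a c"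
    consider "r < s" | "q < s" "s \<le> r" | "s \<le> q" by linarith
    then show "\<bar>g r - g q - (if q < s \<and> s \<le> r then g s - left_lim g s else 0)\<bar> < \<epsilon>"
    proof cases
      case 1 then show ?thesis using a(2)[of q] a(2)[of r] q by (auto simp: abs_if split: if_splits)
    next
      case 2 then show ?thesis using a(2)[of q] c(2)[of r] q by (auto simp: abs_if split: if_splits)
    next
      case 3 then show ?thesis using c(2)[of q] c(2)[of r] q by (auto simp: abs_if split: if_splits)
    qed
  qed
qed

text \<open>Letting \<open>q\<close> tend to \<open>r\<close> from the left in
  \<open>cadlag_local\<close> turns the bound on increments into a bound on jumps, at the price of a
  weak inequality.\<close>

lemma cadlag_local_jumps:
  assumes g: "cadlag_on T g" and e: "\<epsilon> > 0" and s: "s \<in> {0..T}"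
  shows "\<exists>\<eta>>0. (\<forall>q r. 0 \<le> q \<longrightarrow> q < r \<longrightarrow> r \<le> T \<longrightarrow> \<bar>q - s\<bar> < \<eta> \<longrightarrow> \<bar>r - s\<bar> < \<eta> \<longrightarrow>
           \<bar>g r - g q - (if q < s \<and> s \<le> r then g s - left_lim g s else 0)\<bar> < \<epsilon>) \<and>
         (\<forall>r. 0 < r \<longrightarrow> r \<le> T \<longrightarrow> \<bar>r - s\<bar> < \<eta> \<longrightarrow> r \<noteq> s \<longrightarrow> \<bar>g r - left_lim g r\<bar> \<le> \<epsilon>)"
proof -
  obtain \<eta> where \<eta>: "\<eta> > 0" "\<And>q r. 0 \<le> q \<Longrightarrow> q < r \<Longrightarrow> r \<le> T \<Longrightarrow> \<bar>q - s\<bar> < \<eta> \<Longrightarrow> \<bar>r - s\<bar> < \<eta> \<Longrightarrow>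
           \<bar>g r - g q - (if q < s \<and> s \<le> r then g s - left_lim g s else 0)\<bar> < \<epsilon>"
    using cadlag_local[OF assms] by blast
  have "\<bar>g r - left_lim g r\<bar> \<le> \<epsilon>" if r: "0 < r" "r \<le> T" "\<bar>r - s\<bar> < \<eta>" "r \<noteq> s" for r
  proof -
    have "((\<lambda>q. \<bar>g r - g q\<bar>) \<longlongrightarrow> \<bar>g r - left_lim g r\<bar>) (at_left r)"
      using cadlag_left_lim[OF g r(1,2)] by (intro tendsto_intros)
    moreover have "\<forall>\<^sub>F q in at_left r. \<bar>g r - g q\<bar> \<le> \<epsilon>"
      unfolding eventually_at_left_field
    \<comment> \<open>Beyond this bound, \<open>q\<close> is nonnegative, within \<eta> of
      \<open>s\<close> and on the same side of \<open>s\<close> as \<open>r\<close>, so that the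
      jump at \<open>s\<close> does not intervene.\<close>
    proof (intro exI[of _ "max (max 0 (s - \<eta>)) (if s < r then s else 0)"] conjI allI impI)
      show "max (max 0 (s - \<eta>)) (if s < r then s else 0) < r" using r \<eta>(1) by auto
      fix q assume q: "max (max 0 (s - \<eta>)) (if s < r then s else 0) < q" "q < r"
      then have "\<not> (q < s \<and> s \<le> r)" using r(4) by (auto split: if_splits)
      then show "\<bar>g r - g q\<bar> \<le> \<epsilon>" using \<eta>(2)[of q r] r q by (auto split: if_splits)
    qed
    ultimately show ?thesis by (rule tendsto_upperbound) simp
  qed
  with \<eta> show ?thesis by blast
qed

text \<open>A Lebesgue number for the cover of \<open>{0..T}\<close> by the neighbourhoods of
  \<open>cadlag_local_jumps\<close> makes \<eta> uniform: a short interval contains at most one jump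
  of size \<epsilon> or more, and the increment over it is close to that jump.\<close>

lemma cadlag_mesh:
  assumes g: "cadlag_on T g" and e: "\<epsilon> > 0"
  obtains \<eta> where "\<eta> > 0"
    "\<And>q r. 0 \<le> q \<Longrightarrow> q < r \<Longrightarrow> r \<le> T \<Longrightarrow> r - q < \<eta> \<Longrightarrow>
       \<exists>s\<in>{q<..r}. \<bar>g r - g q - (g s - left_lim g s)\<bar> < \<epsilon> \<and>
        (\<forall>s'\<in>{q<..r} - {s}. \<bar>g s' - left_lim g s'\<bar> < \<epsilon>)"
proof -
  define P where "P s \<eta> \<longleftrightarrow> \<eta> > 0 \<and>
      (\<forall>q r. 0 \<le> q \<longrightarrow> q < r \<longrightarrow> r \<le> T \<longrightarrow> \<bar>q - s\<bar> < \<eta> \<longrightarrow> \<bar>r - s\<bar> < \<eta> \<longrightarrow>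
           \<bar>g r - g q - (if q < s \<and> s \<le> r then g s - left_lim g s else 0)\<bar> < \<epsilon> / 3) \<and>
      (\<forall>r. 0 < r \<longrightarrow> r \<le> T \<longrightarrow> \<bar>r - s\<bar> < \<eta> \<longrightarrow> r \<noteq> s \<longrightarrow> \<bar>g r - left_lim g r\<bar> \<le> \<epsilon> / 3)" for s \<eta>
  have "\<exists>\<eta>. P s \<eta>" if "s \<in> {0..T}" for s
    unfolding P_def using cadlag_local_jumps[OF g _ that, of "\<epsilon> / 3"] e by simp
  then obtain \<eta> where P: "\<And>s. s \<in> {0..T} \<Longrightarrow> P s (\<eta> s)"
    using bchoice[of "{0..T}" P] by blast
  have \<eta>: "\<And>s. s \<in> {0..T} \<Longrightarrow> \<eta> s > 0"
     "\<And>s q r. s \<in> {0..T} \<Longrightarrow> 0 \<le> q \<Longrightarrow> q < r \<Longrightarrow> r \<le> T \<Longrightarrow> \<bar>q - s\<bar> < \<eta> s \<Longrightarrow> \<bar>r - s\<bar> < \<eta> s \<Longrightarrow>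
           \<bar>g r - g q - (if q < s \<and> s \<le> r then g s - left_lim g s else 0)\<bar> < \<epsilon> / 3"
     "\<And>s r. s \<in> {0..T} \<Longrightarrow> 0 < r \<Longrightarrow> r \<le> T \<Longrightarrow> \<bar>r - s\<bar> < \<eta> s \<Longrightarrow> r \<noteq> s \<Longrightarrow> \<bar>g r - left_lim g r\<bar> \<le> \<epsilon> / 3"
    using P unfolding P_def by simp_all
  have cover: "{0..T} \<subseteq> \<Union> ((\<lambda>s. ball s (\<eta> s)) ` {0..T})" using \<eta>(1) by force
  obtain d where d: "d > 0"
    "\<forall>q\<in>{0..T}. \<exists>G\<in>(\<lambda>s. ball s (\<eta> s)) ` {0..T}. ball q d \<subseteq> G"
    by (rule Heine_Borel_lemma[OF compact_Icc cover]) auto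
  show ?thesis
  proof (rule that[OF d(1)])
    fix q r assume q: "0 \<le> q" "q < r" "r \<le> T" "r - q < d"
    then obtain s where s: "s \<in> {0..T}" "ball q d \<subseteq> ball s (\<eta> s)" using d(2) by force
    have near: "\<bar>y - s\<bar> < \<eta> s" if "q \<le> y" "y \<le> r" for y
    proof -
      have "y \<in> ball q d" using that q by (auto simp: dist_real_def)
      then show ?thesis using s(2) by (auto simp: dist_real_def)
    qed
    have small: "\<bar>g s' - left_lim g s'\<bar> \<le> \<epsilon> / 3" if "s' \<in> {q<..r}" "s' \<noteq> s" for s'
      using \<eta>(3)[OF s(1), of s'] near[of s'] that q by auto
    have incr: "\<bar>g r - g q - (if q < s \<and> s \<le> r then g s - left_lim g s else 0)\<bar> < \<epsilon> / 3"
      using \<eta>(2)[OF s(1), of q r] near[of q] near[of r] q by auto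
    show "\<exists>s\<in>{q<..r}. \<bar>g r - g q - (g s - left_lim g s)\<bar> < \<epsilon> \<and>
        (\<forall>s'\<in>{q<..r} - {s}. \<bar>g s' - left_lim g s'\<bar> < \<epsilon>)"
    proof (cases "q < s \<and> s \<le> r")
      case True
      then show ?thesis using incr small e by (intro bexI[of _ s]) (force+)
    next
      \<comment> \<open>The centre \<open>s\<close> lies outside the interval, so that all jumps in
        the interval are small and \<open>r\<close> can serve as the distinguished time.\<close>
      case False
      then have "\<bar>g r - g q\<bar> < \<epsilon> / 3" using incr by (simp only: if_False diff_zero)
      moreover have "\<bar>g r - left_lim g r\<bar> \<le> \<epsilon> / 3" using small[of r] False q by auto
      moreover have "\<bar>g s' - left_lim g s'\<bar> < \<epsilon>" if "s' \<in> {q<..r}" for s'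
        using small[of s'] False that e by force
      moreover have "\<bar>g r - g q - (g r - left_lim g r)\<bar> < \<epsilon>"
        using calculation(1,2) e by linarith
      ultimately show ?thesis using q by (intro bexI[of _ r]) (auto simp del: diff_diff_eq2)
    qed
  qed
qed

text \<open>Large jumps cannot accumulate: \<open>cadlag_local_jumps\<close> at the accumulation
  point excludes them nearby.\<close>

lemma cadlag_finite_jumps:
  assumes g: "cadlag_on T g" and e: "\<epsilon> > 0"
  shows "finite {s \<in> {0..T}. \<epsilon> \<le> \<bar>g s - left_lim g s\<bar>}" (is "finite ?J")
proof (rule ccontr)
  assume "infinite ?J"
  moreover have "?J \<subseteq> {0..T}" by auto
  ultimately obtain s where s: "s \<in> {0..T}" "s islimpt ?J"
    using compact_Icc[of 0 T] unfolding compact_eq_Bolzano_Weierstrass by blast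
  obtain \<eta> where \<eta>: "\<eta> > 0"
    "\<And>r. 0 < r \<Longrightarrow> r \<le> T \<Longrightarrow> \<bar>r - s\<bar> < \<eta> \<Longrightarrow> r \<noteq> s \<Longrightarrow> \<bar>g r - left_lim g r\<bar> \<le> \<epsilon> / 2"
    using cadlag_local_jumps[OF g half_gt_zero[OF e] s(1)] by blast
  obtain r where r: "r \<in> ?J" "r \<noteq> s" "dist r s < \<eta>"
    using s(2) \<eta>(1) unfolding islimpt_approachable by blast
  then have "r \<noteq> 0" using e by (auto simp: left_lim_def)
  then show False using \<eta>(2)[of r] r e by (auto simp: dist_real_def)
qed

text \<open>Only finitely many jumps have size at least \<open>d / 2\<close>, and together they keep
  a positive distance \<open>e\<close> from \<open>K\<close> if none of them lies in it. Over a
  short interval, the increment is within \<open>min e (d / 2)\<close> of a single jump: a large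
  jump keeps it out of \<open>K\<close> by the choice of \<open>e\<close>, a small one leaves it in
  the ball of radius \<open>d\<close> around 0, which avoids \<open>K\<close>.\<close>

lemma cadlag_jump_in_closed:
  assumes g: "cadlag_on T g" and K: "closed K" "0 \<notin> K"
    and approx: "\<And>n::nat. \<exists>q r. 0 \<le> q \<and> q < r \<and> r \<le> T \<and> r - q < 1 / real (Suc n) \<and> g r - g q \<in> K"
  shows "\<exists>s\<in>{0..T}. g s - left_lim g s \<in> K"
proof (rule ccontr)
  assume none: "\<not> ?thesis"
  obtain d where d: "d > 0" "ball 0 d \<subseteq> - K"
    using K open_contains_ball[of "- K"] by (auto simp: open_Compl)
  define J where "J = {s \<in> {0..T}. d / 2 \<le> \<bar>g s - left_lim g s\<bar>}"
  have "finite J" unfolding J_def using d by (intro cadlag_finite_jumps[OF g]) simp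
  then have "compact ((\<lambda>s. g s - left_lim g s) ` J)" by (intro finite_imp_compact) auto
  moreover have "(\<lambda>s. g s - left_lim g s) ` J \<inter> K = {}" using none by (auto simp: J_def)
  ultimately obtain e where "e > 0"
    "\<forall>x\<in>(\<lambda>s. g s - left_lim g s) ` J. \<forall>y\<in>K. e \<le> dist x y"
    using separate_compact_closed[OF _ K(1)] by blast
  then have e: "e > 0" "\<And>s y. s \<in> J \<Longrightarrow> y \<in> K \<Longrightarrow> e \<le> dist (g s - left_lim g s) y"
    by auto
  have ed: "min e (d / 2) > 0" using e d by simp
  obtain \<eta> where \<eta>: "\<eta> > 0" "\<And>q r. 0 \<le> q \<Longrightarrow> q < r \<Longrightarrow> r \<le> T \<Longrightarrow> r - q < \<eta> \<Longrightarrow>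
     \<exists>s\<in>{q<..r}. \<bar>g r - g q - (g s - left_lim g s)\<bar> < min e (d / 2) \<and>
        (\<forall>s'\<in>{q<..r} - {s}. \<bar>g s' - left_lim g s'\<bar> < min e (d / 2))"
    by (fact cadlag_mesh[OF g ed])
  obtain n where n: "1 / real (Suc n) < \<eta>" using \<eta>(1) nat_approx_posE by blast
  obtain q r where qr: "0 \<le> q" "q < r" "r \<le> T" "r - q < 1 / real (Suc n)" "g r - g q \<in> K"
    using approx by blast
  then obtain s where s: "s \<in> {q<..r}" "\<bar>g r - g q - (g s - left_lim g s)\<bar> < min e (d / 2)"
    using \<eta>(2)[of q r] n by auto
  show False
  proof (cases "s \<in> J")
    case True
    then show False using e(2)[OF True qr(5)] s(2) by (auto simp: dist_real_def)
  next
    case False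
    then have "\<bar>g s - left_lim g s\<bar> < d / 2" using s(1) qr by (auto simp: J_def)
    then have "\<bar>g r - g q\<bar> < d" using s(2) unfolding abs_less_iff min_less_iff_conj by linarith
    then show False using d(2) qr(5) by (auto simp: dist_real_def subset_iff)
  qed
qed

text \<open>Together with \<open>cadlag_jump_in_closed\<close>, this expresses the existence of a
  jump in a set through countably many increments, hence measurably. The endpoint \<open>T\<close>
  joins the rationals because a jump at \<open>T\<close> needs a later time \<open>r\<close> that is
  \<open>T\<close> itself.\<close>

lemma cadlag_jump_approx:
  assumes g: "cadlag_on T g" and s: "0 < s" "s \<le> T" and U: "open U" "g s - left_lim g s \<in> U"
    and e: "\<eta> > 0"
  shows "\<exists>q\<in>insert T (\<rat> \<inter> {0..T}). \<exists>r\<in>insert T (\<rat> \<inter> {0..T}). q < r \<and> r - q < \<eta> \<and> g r - g q \<in> U"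
proof -
  obtain d where d: "d > 0" "ball (g s - left_lim g s) d \<subseteq> U" using U openE by blast
  obtain \<theta> where \<theta>: "\<theta> > 0" "\<And>q r. 0 \<le> q \<Longrightarrow> q < r \<Longrightarrow> r \<le> T \<Longrightarrow> \<bar>q - s\<bar> < \<theta> \<Longrightarrow> \<bar>r - s\<bar> < \<theta> \<Longrightarrow>
           \<bar>g r - g q - (if q < s \<and> s \<le> r then g s - left_lim g s else 0)\<bar> < d"
    using cadlag_local[OF g d(1), of s] s by auto
  obtain q where q: "q \<in> \<rat>" "max 0 (s - min \<theta> (\<eta> / 2)) < q" "q < s"
    using Rats_dense_in_real[of "max 0 (s - min \<theta> (\<eta> / 2))" s] s \<theta>(1) e by auto
  have "\<exists>r\<in>insert T (\<rat> \<inter> {0..T}). s \<le> r \<and> r < s + min \<theta> (\<eta> / 2)"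
  proof (cases "s = T")
    case True then show ?thesis using \<theta>(1) e by (intro bexI[of _ T]) auto
  next
    case False
    then obtain r where "r \<in> \<rat>" "s < r" "r < min T (s + min \<theta> (\<eta> / 2))"
      using Rats_dense_in_real[of s "min T (s + min \<theta> (\<eta> / 2))"] s \<theta>(1) e by auto
    then show ?thesis using s by (intro bexI[of _ r]) auto
  qed
  then obtain r where r: "r \<in> insert T (\<rat> \<inter> {0..T})" "s \<le> r" "r < s + min \<theta> (\<eta> / 2)" by blast
  have "\<bar>g r - g q - (g s - left_lim g s)\<bar> < d"
    using \<theta>(2)[of q r] q r s by (auto split: if_splits)
  then have "g r - g q \<in> ball (g s - left_lim g s) d" by (auto simp: dist_real_def)
  then have "g r - g q \<in> U" using d(2) by blast
  then show ?thesis using q r s by (intro bexI[of _ q] bexI[of _ r]) auto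
qed

text \<open>The gap \<open>2 * \<epsilon>\<close> makes the criterion exact: on a fine grid each
  cell contains at most one jump of size \<epsilon> or more, and its increment is within \<epsilon>
  of \<open>z\<close> only if that jump equals \<open>z\<close>. The half-open cells partition
  \<open>{u<..v}\<close>, so that counting cells counts jumps.\<close>

lemma grid_jump_count:
  assumes g: "cadlag_on T g" and uv: "0 \<le> u" "u < v" "v \<le> T"
    and e: "\<epsilon> > 0" and z: "2 * \<epsilon> \<le> \<bar>z\<bar>"
    and sep: "\<And>s. s \<in> {0..T} \<Longrightarrow> g s - left_lim g s \<noteq> z \<Longrightarrow> 2 * \<epsilon> \<le> \<bar>g s - left_lim g s - z\<bar>"
  shows "\<forall>\<^sub>F n in sequentially.
     card {j. j < n \<and> \<bar>g (u + (v - u) * real (Suc j) / real n) - g (u + (v - u) * real j / real n) - z\<bar> < \<epsilon>}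
       = card {s \<in> {u<..v}. g s - left_lim g s = z}"
proof -
  obtain \<eta> where \<eta>: "\<eta> > 0" "\<And>q r. 0 \<le> q \<Longrightarrow> q < r \<Longrightarrow> r \<le> T \<Longrightarrow> r - q < \<eta> \<Longrightarrow>
     \<exists>s\<in>{q<..r}. \<bar>g r - g q - (g s - left_lim g s)\<bar> < \<epsilon> \<and>
        (\<forall>s'\<in>{q<..r} - {s}. \<bar>g s' - left_lim g s'\<bar> < \<epsilon>)"
    by (fact cadlag_mesh[OF g e])
  obtain N :: nat where N: "(v - u) / \<eta> < N" using reals_Archimedean2 by blast
  define K where "K = {s \<in> {u<..v}. g s - left_lim g s = z}"
  have "K \<subseteq> {s \<in> {0..T}. \<bar>z\<bar> \<le> \<bar>g s - left_lim g s\<bar>}" using uv by (auto simp: K_def)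
  then have finK: "finite K" using cadlag_finite_jumps[OF g, of "\<bar>z\<bar>"] z e finite_subset by fastforce
  have "card {j. j < n \<and> \<bar>g (u + (v - u) * real (Suc j) / real n) - g (u + (v - u) * real j / real n) - z\<bar> < \<epsilon>} = card K"
    if n: "n \<ge> Suc N" for n
  proof -
    define t where "t j = u + (v - u) * real j / real n" for j
    have n0: "n > 0" and "(v - u) / \<eta> < n" using n N by auto
    then have step: "(v - u) / n < \<eta>" using \<eta>(1) by (simp add: field_simps)
    have t_less: "t j < t (Suc j)" for j using uv n0 by (simp add: t_def field_simps)
    have t_diff: "t (Suc j) - t j = (v - u) / n" for j by (simp add: t_def ring_distribs add_divide_distrib diff_divide_distrib)
    have t0: "t 0 = u" and tn: "t n = v" using n0 by (simp_all add: t_def)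
    have t_mono: "t i \<le> t j" if "i \<le> j" for i j
      using lift_Suc_mono_le[of t, OF less_imp_le[OF t_less] that] .
    have cell: "card (K \<inter> {t j<..t (Suc j)}) = (if \<bar>g (t (Suc j)) - g (t j) - z\<bar> < \<epsilon> then 1 else 0)"
      if j: "j < n" for j
    proof -
      have b: "u \<le> t j" "t (Suc j) \<le> v" using t_mono[of 0 j] t_mono[of "Suc j" n] t0 tn j by auto
      obtain s where s: "s \<in> {t j<..t (Suc j)}" "\<bar>g (t (Suc j)) - g (t j) - (g s - left_lim g s)\<bar> < \<epsilon>"
        "\<And>s'. s' \<in> {t j<..t (Suc j)} \<Longrightarrow> s' \<noteq> s \<Longrightarrow> \<bar>g s' - left_lim g s'\<bar> < \<epsilon>"
        using \<eta>(2)[of "t j" "t (Suc j)"] t_less[of j] b uv step t_diff[of j] by auto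
      have sT: "s \<in> {0..T}" "s \<in> {u<..v}" using s(1) b uv by auto
      show ?thesis
      proof (cases "g s - left_lim g s = z")
        case True
        have "K \<inter> {t j<..t (Suc j)} = {s}"
        proof (rule antisym; rule subsetI)
          fix s' assume "s' \<in> K \<inter> {t j<..t (Suc j)}"
          then show "s' \<in> {s}" using s(3)[of s'] z e by (force simp: K_def)
        next
          fix s' assume "s' \<in> {s}"
          then show "s' \<in> K \<inter> {t j<..t (Suc j)}" using True sT s by (auto simp: K_def)
        qed
        then show ?thesis using s(2) True by simp
      next
        case False
        have "s' \<notin> K \<inter> {t j<..t (Suc j)}" for s'
          using s(3)[of s'] z e False by (cases "s' = s") (force simp: K_def)+
        moreover have "\<not> \<bar>g (t (Suc j)) - g (t j) - z\<bar> < \<epsilon>"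
          using sep[OF sT(1) False] s(2) by linarith
        ultimately show ?thesis by (metis card.empty equals0I)
      qed
    qed
    have "card (K \<inter> {u<..t m}) = card {j. j < m \<and> \<bar>g (t (Suc j)) - g (t j) - z\<bar> < \<epsilon>}" if "m \<le> n" for m
      using that
    proof (induction m)
      case 0 then show ?case by (simp add: t0)
    next
      case (Suc m)
      have "K \<inter> {u<..t (Suc m)} = (K \<inter> {u<..t m}) \<union> (K \<inter> {t m<..t (Suc m)})"
        using t_mono[of 0 m] t_less[of m] t0 by auto
      then have "card (K \<inter> {u<..t (Suc m)}) = card (K \<inter> {u<..t m}) + card (K \<inter> {t m<..t (Suc m)})"
        using finK by (simp add: card_Un_disjoint disjoint_iff)
      moreover have "{j. j < Suc m \<and> \<bar>g (t (Suc j)) - g (t j) - z\<bar> < \<epsilon>}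
        = {j. j < m \<and> \<bar>g (t (Suc j)) - g (t j) - z\<bar> < \<epsilon>} \<union> (if \<bar>g (t (Suc m)) - g (t m) - z\<bar> < \<epsilon> then {m} else {})"
        by (auto simp: less_Suc_eq)
      then have "card {j. j < Suc m \<and> \<bar>g (t (Suc j)) - g (t j) - z\<bar> < \<epsilon>}
        = card {j. j < m \<and> \<bar>g (t (Suc j)) - g (t j) - z\<bar> < \<epsilon>} + (if \<bar>g (t (Suc m)) - g (t m) - z\<bar> < \<epsilon> then 1 else 0)"
        by (auto simp: card_insert_if)
      ultimately show ?case using Suc cell[of m] by simp
    qed
    from this[of n] have "card {j. j < n \<and> \<bar>g (t (Suc j)) - g (t j) - z\<bar> < \<epsilon>} = card K"
      using tn by (simp add: K_def Int_def conj_commute conj_left_commute)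
    then show ?thesis by (simp only: t_def)
  qed
  then show ?thesis unfolding K_def[symmetric] eventually_sequentially by blast
qed

section \<open>One-sided limits and jumps of finite step functions\<close>

lemma step_function_at_right:
  fixes J :: "real set"
  assumes "finite J"
  shows "((\<lambda>t. \<Sum>r\<in>J \<inter> {..t}. a r :: real) \<longlongrightarrow> (\<Sum>r\<in>J \<inter> {..s}. a r)) (at_right s)"
proof -
  have "\<forall>\<^sub>F t in at_right s. \<forall>r\<in>J. r \<le> t \<longleftrightarrow> r \<le> s"
  proof (rule eventually_ball_finite[OF assms ballI])
    fix r assume "r \<in> J"
    show "\<forall>\<^sub>F t in at_right s. r \<le> t \<longleftrightarrow> r \<le> s"
      unfolding eventually_at_right_field
      by (intro exI[of _ "if r \<le> s then s + 1 else r"]) auto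
  qed
  then have "\<forall>\<^sub>F t in at_right s. (\<Sum>r\<in>J \<inter> {..t}. a r) = (\<Sum>r\<in>J \<inter> {..s}. a r)"
    by eventually_elim (rule sum.cong, auto)
  then show ?thesis by (rule tendsto_eventually)
qed

lemma step_function_at_left:
  fixes J :: "real set"
  assumes "finite J"
  shows "((\<lambda>t. \<Sum>r\<in>J \<inter> {..t}. a r :: real) \<longlongrightarrow> (\<Sum>r\<in>J \<inter> {..<s}. a r)) (at_left s)"
proof -
  have "\<forall>\<^sub>F t in at_left s. \<forall>r\<in>J. r \<le> t \<longleftrightarrow> r < s"
  proof (rule eventually_ball_finite[OF assms ballI])
    fix r assume "r \<in> J"
    show "\<forall>\<^sub>F t in at_left s. r \<le> t \<longleftrightarrow> r < s"
      unfolding eventually_at_left_field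
      by (intro exI[of _ "if r < s then r else s - 1"]) auto
  qed
  then have "\<forall>\<^sub>F t in at_left s. (\<Sum>r\<in>J \<inter> {..t}. a r) = (\<Sum>r\<in>J \<inter> {..<s}. a r)"
    by eventually_elim (rule sum.cong, auto)
  then show ?thesis by (rule tendsto_eventually)
qed

lemma step_function_jump:
  fixes J :: "real set"
  assumes "finite J"
  shows "(\<Sum>r\<in>J \<inter> {..s}. a r) - (\<Sum>r\<in>J \<inter> {..<s}. a r) = (if s \<in> J then a s else (0::real))"
proof -
  have "J \<inter> {..s} = (if s \<in> J then insert s (J \<inter> {..<s}) else J \<inter> {..<s})"
    by (auto simp: less_le)
  then show ?thesis using assms by auto
qed

section \<open>Levy processes with discrete jump sizes\<close>

lemma (in prob_space) prob_tendsto_AE: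
  assumes E: "\<And>n. E n \<in> events" "E' \<in> events"
    and ev: "AE \<omega> in M. \<forall>\<^sub>F n in sequentially. \<omega> \<in> E n \<longleftrightarrow> \<omega> \<in> E'"
  shows "(\<lambda>n. prob (E n)) \<longlonglongrightarrow> prob E'"
proof -
  have "(\<lambda>n. integral\<^sup>L M (indicator (E n) :: 'a \<Rightarrow> real)) \<longlonglongrightarrow> integral\<^sup>L M (indicator E' :: 'a \<Rightarrow> real)"
  proof (rule integral_dominated_convergence[where w = "\<lambda>_. 1"])
    show "AE \<omega> in M. (\<lambda>n. indicator (E n) \<omega> :: real) \<longlonglongrightarrow> indicator E' \<omega>"
      using ev
    proof eventually_elim
      case (elim \<omega>)
      then have "\<forall>\<^sub>F n in sequentially. (indicator (E n) \<omega> :: real) = indicator E' \<omega>"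
        by eventually_elim (auto simp: indicator_def)
      then show ?case by (rule tendsto_eventually)
    qed
  qed (use E in auto)
  then show ?thesis using E by simp
qed

section \<open>The augmented filtration of the Levy process\<close>

context levy_noise
begin

lemma Z_measurable: "t \<in> {0..Tst} \<Longrightarrow> Z t \<in> borel_measurable M"
  using levy by (auto simp: levy_process_def)

lemma Z_cadlag: "\<omega> \<in> space M \<Longrightarrow> cadlag_on Tst (\<lambda>t. Z t \<omega>)"
  using levy by (auto simp: levy_process_def)

lemma jump_0 [simp]: "jump Z 0 \<omega> = 0"
  by (simp add: jump_def left_lim_def)

lemma filtration_generators:
  "{Z s -` A \<inter> space M | s A. 0 \<le> s \<and> s \<le> t \<and> s \<le> Tst \<and> A \<in> sets borel} \<union> null_sets M \<subseteq> sets M"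
  using Z_measurable by (auto intro: measurable_sets)

lemma space_F [simp]: "space (F t) = space M"
  by (simp add: gen_filtration_def space_measure_of_conv)

lemma sets_F: "sets (F t) = sigma_sets (space M)
    ({Z s -` A \<inter> space M | s A. 0 \<le> s \<and> s \<le> t \<and> s \<le> Tst \<and> A \<in> sets borel} \<union> null_sets M)"
  unfolding gen_filtration_def
  using filtration_generators[of t] sets.sets_into_space by (intro sets_measure_of) blast

lemma subalgebra_F: "subalgebra M (F t)"
  unfolding subalgebra_def sets_F
  using sets.sigma_sets_subset[OF filtration_generators[of t]] by simp

lemma sets_F_sub: "A \<in> sets (F t) \<Longrightarrow> A \<in> sets M"
  using subalgebra_F unfolding subalgebra_def by auto

lemma sets_F_mono: "s \<le> t \<Longrightarrow> A \<in> sets (F s) \<Longrightarrow> A \<in> sets (F t)"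
proof -
  assume "s \<le> t" "A \<in> sets (F s)"
  have "{Z r -` A \<inter> space M | r A. 0 \<le> r \<and> r \<le> s \<and> r \<le> Tst \<and> A \<in> sets borel} \<union> null_sets M
    \<subseteq> {Z r -` A \<inter> space M | r A. 0 \<le> r \<and> r \<le> t \<and> r \<le> Tst \<and> A \<in> sets borel} \<union> null_sets M"
    using \<open>s \<le> t\<close> order_trans by blast
  then show "A \<in> sets (F t)" using \<open>A \<in> sets (F s)\<close> 
    unfolding sets_F by (rule subsetD[OF sigma_sets_mono'])
qed

lemma measurable_F_mono: "s \<le> t \<Longrightarrow> h \<in> measurable (F s) N \<Longrightarrow> h \<in> measurable (F t) N"
  using sets_F_mono measurable_mono[of N N "F s" "F t"] by fastforce

lemma measurable_F_sub: "h \<in> measurable (F s) N \<Longrightarrow> h \<in> measurable M N"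
  by (rule measurable_from_subalg[OF subalgebra_F])

lemma Z_measurable_F: "0 \<le> s \<Longrightarrow> s \<le> t \<Longrightarrow> s \<le> Tst \<Longrightarrow> Z s \<in> borel_measurable (F t)"
  unfolding measurable_def sets_F space_F by (auto intro: sigma_sets.Basic)

lemma null_sets_F: "N \<in> null_sets M \<Longrightarrow> N \<in> sets (F t)"
  unfolding sets_F by (rule sigma_sets.Basic) (rule UnI2)

lemma Z_increment_indep:
  assumes "0 \<le> s" "s < t" "t \<le> Tst" and A: "A \<in> sets (F s)" and U: "U \<in> sets borel"
  shows "prob (A \<inter> {\<omega> \<in> space M. Z t \<omega> - Z s \<omega> \<in> U}) = prob A * prob {\<omega> \<in> space M. Z t \<omega> - Z s \<omega> \<in> U}"
proof -
  have "indep_set (sets (F s)) {(\<lambda>\<omega>. Z t \<omega> - Z s \<omega>) -` A \<inter> space M | A. A \<in> sets borel}"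
    using levy assms(1-3) by (auto simp: levy_process_def indep_of_def)
  moreover have "{\<omega> \<in> space M. Z t \<omega> - Z s \<omega> \<in> U} = (\<lambda>\<omega>. Z t \<omega> - Z s \<omega>) -` U \<inter> space M" by auto
  ultimately show ?thesis using A U by (auto intro!: indep_setD)
qed

end

section \<open>Atoms of the Levy measure and finiteness of the jumps\<close>

locale discrete_levy_noise = levy_noise M Tst Z a b W \<nu>
  for M :: "'w measure" and Tst :: real and Z :: "real \<Rightarrow> 'w \<Rightarrow> real" and a b :: real
    and W :: "real \<Rightarrow> 'w \<Rightarrow> real" and \<nu> :: "real measure" +
  fixes x :: "nat \<Rightarrow> real"
  assumes inj_x: "inj x"
    and support: "measure_support \<nu> = range x"
    and x_at_top: "filterlim (\<lambda>i. \<bar>x i\<bar>) at_top sequentially"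
begin

lemma finite_atoms: "finite {z \<in> range x. \<bar>z\<bar> \<le> c}"
proof -
  have "\<forall>\<^sub>F i in sequentially. c < \<bar>x i\<bar>"
    using x_at_top by (auto simp: filterlim_at_top_dense)
  then obtain n where n: "\<And>i. i \<ge> n \<Longrightarrow> c < \<bar>x i\<bar>" by (auto simp: eventually_sequentially)
  have "{z \<in> range x. \<bar>z\<bar> \<le> c} \<subseteq> x ` {..<n}"
  proof
    fix z assume "z \<in> {z \<in> range x. \<bar>z\<bar> \<le> c}"
    then obtain i where i: "z = x i" "\<bar>x i\<bar> \<le> c" by auto
    then have "i < n" using n[of i] by (meson not_le)
    then show "z \<in> x ` {..<n}" using i by auto
  qed
  then show ?thesis by (rule finite_subset) simp
qed

lemma range_x_borel [measurable]: "range x \<in> sets borel"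
  by (rule sets.countable) auto

lemma atoms_separated: "\<exists>d>0. \<forall>z\<in>range x. z \<noteq> y \<longrightarrow> d \<le> \<bar>z - y\<bar>"
proof -
  obtain d where d: "d > 0" "\<forall>z\<in>{z \<in> range x. \<bar>z\<bar> \<le> \<bar>y\<bar> + 1}. z \<noteq> y \<longrightarrow> d \<le> dist y z"
    using finite_set_avoid[OF finite_atoms[of "\<bar>y\<bar> + 1"], of y] by blast
  \<comment> \<open>An atom outside the enlarged ball has distance greater than 1 from
    \<open>y\<close>, whence the minimum with 1.\<close>
  have "min d 1 \<le> \<bar>z - y\<bar>" if "z \<in> range x" "z \<noteq> y" for z
    using d(2) that by (cases "\<bar>z\<bar> \<le> \<bar>y\<bar> + 1") (auto simp: dist_real_def)
  then show ?thesis using d(1) by (intro exI[of _ "min d 1"]) auto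
qed

text \<open>The complement of the support is a union of open null sets, and by the Lindeloef
  property countably many of them suffice.\<close>

lemma nu_outside_atoms: "emeasure \<nu> (- range x) = 0"
proof -
  define U where "U = {S. open S \<and> emeasure \<nu> S = 0}"
  obtain U' where U': "U' \<subseteq> U" "countable U'" "\<Union>U' = \<Union>U"
    using Lindelof[of U] by (auto simp: U_def)
  have null: "\<Union>U' \<in> null_sets \<nu>"
    using U' by (intro null_sets_UN'[of U' "\<lambda>S. S", simplified]) (auto simp: U_def sets_nu null_sets_def)
  have sub: "- range x \<subseteq> \<Union>U"
  proof
    fix z assume "z \<in> - range x"
    then have "z \<notin> measure_support \<nu>" using support by simp
    then show "z \<in> \<Union>U" by (auto simp: measure_support_def U_def)
  qed
  show ?thesis
    by (rule emeasure_eq_0[OF null_setsD2[OF null] null_setsD1[OF null] sub[folded U'(3)]])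
qed

text \<open>A small ball around \<open>x i\<close> contains no other atom, so that its mass, which
  is positive because \<open>x i\<close> is in the support, sits at \<open>x i\<close>
  alone.\<close>

lemma atom_pos: "emeasure \<nu> {x i} > 0"
proof -
  obtain d where d: "d > 0" "\<forall>z\<in>range x. z \<noteq> x i \<longrightarrow> d \<le> \<bar>z - x i\<bar>"
    using atoms_separated[of "x i"] by blast
  have "x i \<in> measure_support \<nu>" using support by simp
  then have pos: "0 < emeasure \<nu> (ball (x i) d)" using d(1) by (auto simp: measure_support_def)
  have "ball (x i) d \<subseteq> {x i} \<union> - range x"
    using d by (force simp: dist_real_def)
  then have "emeasure \<nu> (ball (x i) d) \<le> emeasure \<nu> ({x i} \<union> - range x)"
    by (intro emeasure_mono) (auto simp: sets_nu)
  also have "\<dots> \<le> emeasure \<nu> {x i} + emeasure \<nu> (- range x)"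
    by (intro emeasure_subadditive) (auto simp: sets_nu)
  finally have "0 < emeasure \<nu> {x i} + emeasure \<nu> (- range x)" by (rule less_le_trans[OF pos])
  then show ?thesis by (simp only: nu_outside_atoms add_0_right)
qed

lemma x_nonzero: "x i \<noteq> 0"
proof
  assume 0: "x i = 0"
  show False using atom_pos[of i] unfolding 0 nu_zero by simp
qed

text \<open>A single \<epsilon> separates the atoms both from 0 and from \<open>y\<close>; the
  factor 2 is the one that \<open>grid_jump_count\<close> requires.\<close>

lemma atoms_gap: "\<exists>\<epsilon>>0. \<forall>z\<in>range x. 2 * \<epsilon> \<le> \<bar>z\<bar> \<and> (z \<noteq> y \<longrightarrow> 2 * \<epsilon> \<le> \<bar>z - y\<bar>)"
proof -
  obtain d where d: "d > 0" "\<forall>z\<in>range x. z \<noteq> y \<longrightarrow> d \<le> \<bar>z - y\<bar>" using atoms_separated[of y] by blast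
  obtain e where e: "e > 0" "\<forall>z\<in>range x. z \<noteq> 0 \<longrightarrow> e \<le> \<bar>z - 0\<bar>" using atoms_separated[of 0] by blast
  have "2 * (min d e / 2) \<le> \<bar>z\<bar> \<and> (z \<noteq> y \<longrightarrow> 2 * (min d e / 2) \<le> \<bar>z - y\<bar>)" if z: "z \<in> range x" for z
  proof -
    have "z \<noteq> 0" using z x_nonzero by (metis rangeE)
    then have "e \<le> \<bar>z\<bar>" "z \<noteq> y \<longrightarrow> d \<le> \<bar>z - y\<bar>" using d(2) e(2) z by auto
    then show ?thesis by linarith
  qed
  moreover have "min d e / 2 > 0" using d(1) e(1) by simp
  ultimately show ?thesis by blast
qed

text \<open>The atoms stay away from 0, so that \<open>min (\<bar>z\<bar>\<^sup>2) 1\<close> is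
  bounded below by a positive constant on them.\<close>

lemma nu_finite: "emeasure \<nu> UNIV < \<infinity>"
proof -
  obtain e where e: "e > 0" "\<forall>z\<in>range x. z \<noteq> 0 \<longrightarrow> e \<le> \<bar>z - 0\<bar>" using atoms_separated[of 0] by blast
  define c where "c = min (e\<^sup>2) 1"
  have c: "c > 0" using e by (simp add: c_def)
  have "ennreal c * emeasure \<nu> (range x) = (\<integral>\<^sup>+ z. ennreal c * indicator (range x) z \<partial>\<nu>)"
    by (subst nn_integral_cmult_indicator) (auto simp: sets_nu)
  also have "\<dots> \<le> (\<integral>\<^sup>+ z. ennreal (min (\<bar>z\<bar>\<^sup>2) 1) \<partial>\<nu>)"
  proof (intro nn_integral_mono)
    fix z
    have "e\<^sup>2 \<le> z\<^sup>2" if z: "z \<in> range x"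
    proof -
      have "z \<noteq> 0" using z x_nonzero by (metis rangeE)
      then have "e \<le> \<bar>z\<bar>" using e(2) z by auto
      then show ?thesis using e(1) power_mono[of e "\<bar>z\<bar>" 2] by simp
    qed
    then show "ennreal c * indicator (range x) z \<le> ennreal (min (\<bar>z\<bar>\<^sup>2) 1)"
      by (auto simp: indicator_def c_def intro!: ennreal_leI)
  qed
  also have "\<dots> < \<infinity>" by (rule nu_integrable)
  finally have "emeasure \<nu> (range x) < \<infinity>" using c by (auto simp: ennreal_mult_less_top)
  moreover have "emeasure \<nu> UNIV \<le> emeasure \<nu> (range x) + emeasure \<nu> (- range x)"
    using emeasure_subadditive[of "range x" \<nu> "- range x"] by (simp add: sets_nu)
  ultimately show ?thesis by (auto simp: nu_outside_atoms)
qed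

lemma finite_nu: "finite_measure \<nu>"
  using nu_finite sets_eq_imp_space_eq[OF sets_nu] by (intro finite_measureI) auto

lemma emeasure_nu: "emeasure \<nu> A = ennreal (measure \<nu> A)"
  using finite_measure.emeasure_eq_measure[OF finite_nu] .

text \<open>
  The jump counts are not known to be measurable at this point, and a vanishing integral of a
  nonmeasurable function says little. The proof therefore uses measurable events \<open>H m\<close>, defined by
  increments between rational times, that lie below the jump counts.
\<close>

lemma AE_jumps: "AE \<omega> in M. \<forall>s\<in>{0..Tst}. jump Z s \<omega> = 0 \<or> jump Z s \<omega> \<in> range x"
proof -
  \<comment> \<open>The sets \<open>K m\<close> exhaust the complement of the atoms and of 0 by
    closed sets away from 0. Closedness and the distance from 0 are what
    \<open>cadlag_jump_in_closed\<close> and \<open>nu_intensity\<close> ask for.\<close>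
  define K where "K m = {z. 1 / real (Suc m) \<le> \<bar>z\<bar>} \<inter> (\<Inter>i. {z. 1 / real (Suc m) \<le> \<bar>z - x i\<bar>})" for m
  define D where "D = insert Tst (\<rat> \<inter> {0..Tst})"
  have D: "countable D" "D \<subseteq> {0..Tst}"
    using horizon_pos by (auto simp: D_def intro: countable_subset[OF _ countable_rat])
  have closed_K: "closed (K m)" for m
    unfolding K_def by (intro closed_Int closed_INT ballI closed_Collect_le continuous_intros)
  have K0: "0 \<notin> K m" for m by (auto simp: K_def)
  have K_range: "K m \<subseteq> - range x" for m
  proof
    fix z assume z: "z \<in> K m"
    show "z \<in> - range x"
    proof
      assume "z \<in> range x"
      then obtain i where "z = x i" by auto
      with z have "1 / real (Suc m) \<le> \<bar>x i - x i\<bar>" unfolding K_def by blast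
      then show False by simp
    qed
  qed
  define H where "H m = {\<omega> \<in> space M. \<forall>n. \<exists>q\<in>D. \<exists>r\<in>D. q < r \<and> r - q < 1 / real (Suc n) \<and> Z r \<omega> - Z q \<omega> \<in> K m}" for m
  have H_sets: "H m \<in> sets M" for m
  proof -
    have "H m = (\<Inter>n. \<Union>q\<in>D. \<Union>r\<in>{r\<in>D. q < r \<and> r - q < 1 / real (Suc n)}.
             (\<lambda>\<omega>. Z r \<omega> - Z q \<omega>) -` K m \<inter> space M)"
      by (auto simp: H_def) blast+
    also have "\<dots> \<in> sets M"
    proof -
      have *: "(\<lambda>\<omega>. Z r \<omega> - Z q \<omega>) -` K m \<inter> space M \<in> sets M" if "r \<in> D" "q \<in> D" for q r
      proof -
        have [measurable]: "Z r \<in> borel_measurable M" "Z q \<in> borel_measurable M"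
          using that D(2) Z_measurable by auto
        have [measurable]: "K m \<in> sets borel" using closed_K by (rule borel_closed)
        show ?thesis by measurable
      qed
      have "(\<Union>q\<in>D. \<Union>r\<in>{r\<in>D. q < r \<and> r - q < 1 / real (Suc n)}.
             (\<lambda>\<omega>. Z r \<omega> - Z q \<omega>) -` K m \<inter> space M) \<in> sets M" for n
      proof (rule sets.countable_UN''[OF D(1)])
        fix q assume q: "q \<in> D"
        have "countable {r \<in> D. q < r \<and> r - q < 1 / real (Suc n)}"
          using D(1) by (rule countable_subset[rotated]) auto
        then show "(\<Union>r\<in>{r\<in>D. q < r \<and> r - q < 1 / real (Suc n)}.
             (\<lambda>\<omega>. Z r \<omega> - Z q \<omega>) -` K m \<inter> space M) \<in> sets M"
          by (rule sets.countable_UN'') (use q * in auto)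
      qed
      then show ?thesis by (intro sets.countable_INT) auto
    qed
    finally show ?thesis .
  qed
  have H_null: "emeasure M (H m) = 0" for m
  proof -
    have "indicator (H m) \<omega> \<le> jump_count Z Tst (K m) \<omega>" if "\<omega> \<in> space M" for \<omega>
    proof (cases "\<omega> \<in> H m")
      case True
      have "\<exists>s\<in>{0..Tst}. Z s \<omega> - left_lim (\<lambda>t. Z t \<omega>) s \<in> K m"
      proof (rule cadlag_jump_in_closed[OF Z_cadlag[OF that] closed_K K0])
        fix n
        obtain q r where "q \<in> D" "r \<in> D" "q < r" "r - q < 1 / real (Suc n)" "Z r \<omega> - Z q \<omega> \<in> K m"
          using True unfolding H_def by blast
        then show "\<exists>q r. 0 \<le> q \<and> q < r \<and> r \<le> Tst \<and> r - q < 1 / real (Suc n) \<and> Z r \<omega> - Z q \<omega> \<in> K m"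
          using D(2) by (intro exI[of _ q] exI[of _ r]) auto
      qed
      then obtain s where s: "s \<in> {0..Tst}" "jump Z s \<omega> \<in> K m" unfolding jump_def by blast
      have "1 = emeasure (count_space UNIV) {s}" by simp
      also have "\<dots> \<le> jump_count Z Tst (K m) \<omega>"
        unfolding jump_count_def using s by (intro emeasure_mono) auto
      finally show ?thesis by (auto simp: indicator_def)
    qed auto
    then have "(\<integral>\<^sup>+ \<omega>. indicator (H m) \<omega> \<partial>M) \<le> (\<integral>\<^sup>+ \<omega>. jump_count Z Tst (K m) \<omega> \<partial>M)"
      by (intro nn_integral_mono) auto
    also have "\<dots> = ennreal Tst * emeasure \<nu> (K m)"
      using closed_K K0 horizon_pos by (intro nu_intensity) (auto simp: borel_closed closure_closed)
    also have "\<dots> = 0"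
      using emeasure_mono[OF K_range, of \<nu> m] by (simp add: sets_nu nu_outside_atoms)
    finally show ?thesis using H_sets by simp
  qed
  have "AE \<omega> in M. \<omega> \<notin> (\<Union>m. H m)"
    using H_sets H_null by (intro AE_not_in null_sets_UN) (auto simp: null_sets_def)
  then show ?thesis
  proof (rule AE_mp, intro AE_I2 impI ballI)
    fix \<omega> s assume \<omega>: "\<omega> \<in> space M" "\<omega> \<notin> (\<Union>m. H m)" and s: "s \<in> {0..Tst}"
    show "jump Z s \<omega> = 0 \<or> jump Z s \<omega> \<in> range x"
    proof (rule ccontr)
      assume no: "\<not> ?thesis"
      define z where "z = jump Z s \<omega>"
      have z: "z \<noteq> 0" "z \<notin> range x" using no by (auto simp: z_def)
      have s0: "0 < s" using z s by (cases "s = 0") (auto simp: z_def)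
      obtain d where d: "d > 0" "\<forall>y\<in>range x. y \<noteq> z \<longrightarrow> d \<le> \<bar>y - z\<bar>"
        using atoms_separated[of z] by blast
      have dx: "d \<le> \<bar>x i - z\<bar>" for i using d(2) z(2) by (metis rangeI)
      have "0 < min d \<bar>z\<bar> / 2" using d z by simp
      \<comment> \<open>With this \<open>m\<close>, the ball of radius
        \<open>1 / real (Suc m)\<close> around \<open>z\<close> lies in \<open>K m\<close>; it is
        the open set to which \<open>cadlag_jump_approx\<close> is applied.\<close>
      then obtain m where m: "1 / real (Suc m) < min d \<bar>z\<bar> / 2" using nat_approx_posE by blast
      have sub: "ball z (1 / real (Suc m)) \<subseteq> K m"
      proof
        fix y assume "y \<in> ball z (1 / real (Suc m))"
        then have y: "\<bar>z - y\<bar> < 1 / real (Suc m)" by (auto simp: dist_real_def)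
        have "1 / real (Suc m) \<le> \<bar>y\<bar>" using y m by linarith
        moreover have "1 / real (Suc m) \<le> \<bar>y - x i\<bar>" for i using dx[of i] y m by linarith
        ultimately show "y \<in> K m" by (auto simp: K_def)
      qed
      have "\<omega> \<in> H m"
        unfolding H_def
      proof (intro CollectI conjI allI \<omega>(1))
        fix n
        have *: "open (ball z (1 / real (Suc m)))" "Z s \<omega> - left_lim (\<lambda>t. Z t \<omega>) s \<in> ball z (1 / real (Suc m))"
          by (auto simp: z_def jump_def)
        show "\<exists>q\<in>D. \<exists>r\<in>D. q < r \<and> r - q < 1 / real (Suc n) \<and> Z r \<omega> - Z q \<omega> \<in> K m"
          using cadlag_jump_approx[OF Z_cadlag[OF \<omega>(1)] s0 _ *, of "1 / real (Suc n)"] s sub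
          unfolding D_def by fastforce
      qed
      then show False using \<omega>(2) by blast
    qed
  qed
qed

text \<open>One event is fixed for all pathwise arguments. Its complement is a measurable null set
  and so belongs to every \<open>F t\<close> by the augmentation; hence restricting to it preserves
  adaptedness.\<close>

definition regular :: "'w set" where
  "regular = (SOME R. R \<subseteq> space M \<and> space M - R \<in> null_sets M \<and>
     (\<forall>\<omega>\<in>R. \<forall>s\<in>{0..Tst}. jump Z s \<omega> = 0 \<or> jump Z s \<omega> \<in> range x))"

lemma regular: "regular \<subseteq> space M" "space M - regular \<in> null_sets M"
  "\<omega> \<in> regular \<Longrightarrow> s \<in> {0..Tst} \<Longrightarrow> jump Z s \<omega> = 0 \<or> jump Z s \<omega> \<in> range x"
proof -
  obtain N where N: "N \<in> null_sets M"
    "{\<omega> \<in> space M. \<not> (\<forall>s\<in>{0..Tst}. jump Z s \<omega> = 0 \<or> jump Z s \<omega> \<in> range x)} \<subseteq> N"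
    using AE_jumps by (auto elim!: AE_E simp: null_sets_def)
  have "N \<subseteq> space M" using N(1) sets.sets_into_space by blast
  then have "space M - (space M - N) = N" by auto
  then have "\<exists>R. R \<subseteq> space M \<and> space M - R \<in> null_sets M \<and>
     (\<forall>\<omega>\<in>R. \<forall>s\<in>{0..Tst}. jump Z s \<omega> = 0 \<or> jump Z s \<omega> \<in> range x)"
    using N by (intro exI[of _ "space M - N"]) auto
  from someI_ex[OF this, folded regular_def]
  show "regular \<subseteq> space M" "space M - regular \<in> null_sets M"
    "\<omega> \<in> regular \<Longrightarrow> s \<in> {0..Tst} \<Longrightarrow> jump Z s \<omega> = 0 \<or> jump Z s \<omega> \<in> range x" by blast+
qed

lemma regular_sets_F: "regular \<in> sets (F t)"
proof -
  have "space (F t) - (space M - regular) \<in> sets (F t)"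
    by (rule sets.compl_sets[OF null_sets_F[OF regular(2)]])
  moreover have "space (F t) - (space M - regular) = regular" using regular(1) by auto
  ultimately show ?thesis by simp
qed

lemma AE_regular: "AE \<omega> in M. \<omega> \<in> regular"
  using AE_not_in[OF regular(2)] AE_space by eventually_elim auto

text \<open>The atoms keep a positive distance from 0, so that every nonzero jump is a large
  one.\<close>

lemma finite_jumps_regular: "\<omega> \<in> regular \<Longrightarrow> finite {s \<in> {0..Tst}. jump Z s \<omega> \<noteq> 0}"
proof -
  assume \<omega>: "\<omega> \<in> regular"
  obtain e where e: "e > 0" "\<forall>z\<in>range x. 2 * e \<le> \<bar>z\<bar> \<and> (z \<noteq> 0 \<longrightarrow> 2 * e \<le> \<bar>z - 0\<bar>)"
    using atoms_gap[of 0] by blast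
  have "{s \<in> {0..Tst}. jump Z s \<omega> \<noteq> 0} \<subseteq> {s \<in> {0..Tst}. e \<le> \<bar>jump Z s \<omega>\<bar>}"
    using regular(3)[OF \<omega>] e by fastforce
  moreover have "finite {s \<in> {0..Tst}. e \<le> \<bar>jump Z s \<omega>\<bar>}"
    unfolding jump_def using \<omega> regular(1) by (intro cadlag_finite_jumps[OF Z_cadlag e(1)]) auto
  ultimately show ?thesis by (rule finite_subset)
qed

end

section \<open>Independence of jump counts from the past\<close>

context discrete_levy_noise
begin

text \<open>The empty value off \<open>regular\<close> makes these sets finite at every outcome, so
  that the counts below need no exceptional event.\<close>

definition jumps_at :: "nat \<Rightarrow> 'w \<Rightarrow> real set" where
  "jumps_at i \<omega> = (if \<omega> \<in> regular then {s \<in> {0..Tst}. jump Z s \<omega> = x i} else {})"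

definition njumps :: "nat \<Rightarrow> real \<Rightarrow> real \<Rightarrow> 'w \<Rightarrow> nat" where
  "njumps i u v \<omega> = card (jumps_at i \<omega> \<inter> {u<..v})"

lemma finite_jumps_at [simp]: "finite (jumps_at i \<omega>)"
proof (cases "\<omega> \<in> regular")
  case True
  then have "jumps_at i \<omega> \<subseteq> {s \<in> {0..Tst}. jump Z s \<omega> \<noteq> 0}"
    using x_nonzero by (auto simp: jumps_at_def)
  then show ?thesis using finite_jumps_regular[OF True] by (rule finite_subset)
qed (simp add: jumps_at_def)

lemma jumps_at_subset: "jumps_at i \<omega> \<subseteq> {0<..Tst}"
proof
  fix s assume "s \<in> jumps_at i \<omega>"
  then have "s \<in> {0..Tst}" "jump Z s \<omega> = x i" by (auto simp: jumps_at_def split: if_splits)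
  then show "s \<in> {0<..Tst}" using x_nonzero[of i] by (cases "s = 0") auto
qed

lemma njumps_add: "u \<le> v \<Longrightarrow> v \<le> w \<Longrightarrow> njumps i u w \<omega> = njumps i u v \<omega> + njumps i v w \<omega>"
proof -
  assume "u \<le> v" "v \<le> w"
  then have "jumps_at i \<omega> \<inter> {u<..w} = (jumps_at i \<omega> \<inter> {u<..v}) \<union> (jumps_at i \<omega> \<inter> {v<..w})" by auto
  then show ?thesis unfolding njumps_def by (simp add: card_Un_disjoint disjoint_iff)
qed

text \<open>
  Counting the increments over the cells of a grid that are close to an atom gives sums of
  indicators, each of which is independent of the past. This is how the independence of
  jump counts from the past is obtained from that of single increments.
\<close>

definition grid_count :: "real \<Rightarrow> nat \<Rightarrow> real \<Rightarrow> real \<Rightarrow> nat \<Rightarrow> nat \<Rightarrow> 'w \<Rightarrow> nat" where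
  "grid_count \<epsilon> i u v n k \<omega> = card {j. j < k \<and>
     \<bar>Z (u + (v - u) * real (Suc j) / real n) \<omega> - Z (u + (v - u) * real j / real n) \<omega> - x i\<bar> < \<epsilon>}"

lemma grid_count_Suc:
  "grid_count \<epsilon> i u v n (Suc k) \<omega> = grid_count \<epsilon> i u v n k \<omega> +
     (if \<bar>Z (u + (v - u) * real (Suc k) / real n) \<omega> - Z (u + (v - u) * real k / real n) \<omega> - x i\<bar> < \<epsilon> then 1 else 0)"
proof -
  have "{j. j < Suc k \<and> P j} = (if P k then insert k {j. j < k \<and> P j} else {j. j < k \<and> P j})" for P :: "nat \<Rightarrow> bool"
    by (auto simp: less_Suc_eq)
  then show ?thesis unfolding grid_count_def by simp
qed

text \<open>Each cell contributes an event that is independent of the past up to the start of the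
  cell. The induction carries measurability at the end of the current cell along, because that is
  what makes the next cell independent of everything counted before.\<close>

lemma grid_count_indep:
  assumes uv: "0 \<le> u" "u < v" "v \<le> Tst" and n: "n > 0" and k: "k \<le> n"
  shows "(\<forall>m. {\<omega> \<in> space M. grid_count \<epsilon> i u v n k \<omega> = m} \<in> sets (F (u + (v - u) * real k / real n)))
    \<and> (\<forall>A m. A \<in> sets (F u) \<longrightarrow> prob (A \<inter> {\<omega> \<in> space M. grid_count \<epsilon> i u v n k \<omega> = m})
          = prob A * prob {\<omega> \<in> space M. grid_count \<epsilon> i u v n k \<omega> = m})"
  using k
proof (induction k)
  case 0
  have "{\<omega> \<in> space M. grid_count \<epsilon> i u v n 0 \<omega> = m} = (if m = 0 then space M else {})" for m
    by (auto simp: grid_count_def)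
  moreover have "A \<inter> space M = A" if "A \<in> sets (F u)" for A
    using sets.sets_into_space[OF sets_F_sub[OF that]] by auto
  moreover have "space M \<in> sets (F u)" using sets.top[of "F u"] by simp
  ultimately show ?case by (auto simp: prob_space)
next
  case (Suc k)
  define t where "t j = u + (v - u) * real j / real n" for j
  define C where "C k m = {\<omega> \<in> space M. grid_count \<epsilon> i u v n k \<omega> = m}" for k m
  define E where "E = {\<omega> \<in> space M. Z (t (Suc k)) \<omega> - Z (t k) \<omega> \<in> {y. \<bar>y - x i\<bar> < \<epsilon>}}"
  have IH: "\<And>m. C k m \<in> sets (F (t k))" "\<And>A m. A \<in> sets (F u) \<Longrightarrow> prob (A \<inter> C k m) = prob A * prob (C k m)"
    using Suc by (auto simp: C_def t_def)
  have "t (Suc k) \<le> t n" using uv n Suc.prems unfolding t_def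
    by (intro add_left_mono divide_right_mono mult_left_mono) auto
  moreover have "t n = v" using n by (simp add: t_def)
  moreover have "t k < t (Suc k)" using uv n by (simp add: t_def field_simps)
  moreover have "u \<le> t k" using uv by (simp add: t_def)
  ultimately have t: "0 \<le> u" "u \<le> t k" "t k < t (Suc k)" "t (Suc k) \<le> Tst"
    using uv by auto
  have U: "{y. \<bar>y - x i\<bar> < \<epsilon>} \<in> sets borel" by measurable
  have [measurable]: "Z (t (Suc k)) \<in> borel_measurable (F (t (Suc k)))" "Z (t k) \<in> borel_measurable (F (t (Suc k)))"
    using t by (auto intro!: Z_measurable_F)
  have "E = {\<omega> \<in> space (F (t (Suc k))). Z (t (Suc k)) \<omega> - Z (t k) \<omega> \<in> {y. \<bar>y - x i\<bar> < \<epsilon>}}" by (simp add: E_def)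
  also have "\<dots> \<in> sets (F (t (Suc k)))" using U by measurable
  finally have E_F: "E \<in> sets (F (t (Suc k)))" .
  have E_ev: "E \<in> events" using sets_F_sub[OF E_F] .
  have split: "C (Suc k) m = (C k m - E) \<union> (if m = 0 then {} else C k (m - 1) \<inter> E)" for m
    unfolding C_def E_def grid_count_Suc t_def by (auto split: if_splits)
  have C_F: "C k m \<in> sets (F (t (Suc k)))" for m using sets_F_mono[OF less_imp_le[OF t(3)] IH(1)] .
  have C_ev: "C k m \<in> events" for m using sets_F_sub[OF IH(1)] .
  have "C (Suc k) m \<in> sets (F (t (Suc k)))" for m
    unfolding split using C_F E_F by auto
  moreover have "prob (A \<inter> C (Suc k) m) = prob A * prob (C (Suc k) m)" if A: "A \<in> sets (F u)" for A m
  proof -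
    have indep: "prob (B \<inter> E) = prob B * prob E" if "B \<in> sets (F (t k))" for B
      unfolding E_def using t that U by (intro Z_increment_indep) auto
    \<comment> \<open>The recursion holds for every \<open>B\<close> in \<open>F u\<close>.
      Comparing it for \<open>A\<close> and for \<open>space M\<close> gives the product
      formula.\<close>
    have *: "prob (B \<inter> C (Suc k) m) = prob (B \<inter> C k m) * (1 - prob E) + (if m = 0 then 0 else prob (B \<inter> C k (m - 1)) * prob E)"
      if B: "B \<in> sets (F u)" for B
    proof -
      have B_k: "B \<in> sets (F (t k))" using sets_F_mono[OF t(2) B] .
      have B_ev: "B \<in> events" using sets_F_sub[OF B] .
      have "B \<inter> C (Suc k) m = (B \<inter> C k m - B \<inter> C k m \<inter> E) \<union> (if m = 0 then {} else B \<inter> C k (m - 1) \<inter> E)"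
        unfolding split by auto
      also have "prob \<dots> = prob (B \<inter> C k m - B \<inter> C k m \<inter> E) + prob (if m = 0 then {} else B \<inter> C k (m - 1) \<inter> E)"
        using B_ev C_ev E_ev by (intro finite_measure_Union) auto
      also have "prob (B \<inter> C k m - B \<inter> C k m \<inter> E) = prob (B \<inter> C k m) - prob (B \<inter> C k m \<inter> E)"
        using B_ev C_ev E_ev by (intro finite_measure_Diff) auto
      also have "prob (B \<inter> C k m \<inter> E) = prob (B \<inter> C k m) * prob E"
        using B_k IH(1) by (intro indep) auto
      also have "prob (if m = 0 then {} else B \<inter> C k (m - 1) \<inter> E) = (if m = 0 then 0 else prob (B \<inter> C k (m - 1)) * prob E)"
        using indep[of "B \<inter> C k (m - 1)"] B_k IH(1) by auto
      finally show ?thesis by (simp add: algebra_simps)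
    qed
    have "space M \<inter> C k m = C k m" for k m by (auto simp: C_def)
    moreover have "space M \<in> sets (F u)" using sets.top[of "F u"] by simp
    ultimately have eq: "prob (C (Suc k) m) = prob (C k m) * (1 - prob E) + (if m = 0 then 0 else prob (C k (m - 1)) * prob E)"
      using *[of "space M"] by simp
    show ?thesis unfolding *[OF A] eq IH(2)[OF A] by (simp add: algebra_simps)
  qed
  ultimately show ?case by (auto simp: C_def t_def)
qed

text \<open>The gap around the atom depends on \<open>i\<close> only, so that one \<epsilon> serves
  all intervals and all regular outcomes.\<close>

lemma grid_count_tendsto:
  obtains \<epsilon> where "\<epsilon> > 0"
    "\<And>u v \<omega>. 0 \<le> u \<Longrightarrow> u < v \<Longrightarrow> v \<le> Tst \<Longrightarrow> \<omega> \<in> regular \<Longrightarrow>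
       \<forall>\<^sub>F n in sequentially. grid_count \<epsilon> i u v n n \<omega> = njumps i u v \<omega>"
proof -
  obtain \<epsilon> where e: "\<epsilon> > 0" "\<forall>z\<in>range x. 2 * \<epsilon> \<le> \<bar>z\<bar> \<and> (z \<noteq> x i \<longrightarrow> 2 * \<epsilon> \<le> \<bar>z - x i\<bar>)"
    using atoms_gap[of "x i"] by blast
  show ?thesis
  proof (rule that[OF e(1)])
    fix u v \<omega> assume uv: "0 \<le> u" "u < v" "v \<le> Tst" and \<omega>: "\<omega> \<in> regular"
    have eq: "{s \<in> {u<..v}. Z s \<omega> - left_lim (\<lambda>t. Z t \<omega>) s = x i} = jumps_at i \<omega> \<inter> {u<..v}"
      using uv \<omega> by (auto simp: jumps_at_def jump_def)
    have sep: "2 * \<epsilon> \<le> \<bar>Z s \<omega> - left_lim (\<lambda>t. Z t \<omega>) s - x i\<bar>"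
      if "s \<in> {0..Tst}" "Z s \<omega> - left_lim (\<lambda>t. Z t \<omega>) s \<noteq> x i" for s
    proof -
      have "2 * \<epsilon> \<le> \<bar>x i\<bar>" using e(2) by blast
      moreover have "jump Z s \<omega> = 0 \<or> jump Z s \<omega> \<in> range x" using regular(3)[OF \<omega> that(1)] .
      moreover have "jump Z s \<omega> \<noteq> x i" using that(2) by (simp add: jump_def)
      ultimately have "2 * \<epsilon> \<le> \<bar>jump Z s \<omega> - x i\<bar>" using e(2) by auto
      then show ?thesis by (simp add: jump_def)
    qed
    have "2 * \<epsilon> \<le> \<bar>x i\<bar>" using e(2) by blast
    moreover have "\<omega> \<in> space M" using \<omega> regular(1) by auto
    ultimately show "\<forall>\<^sub>F n in sequentially. grid_count \<epsilon> i u v n n \<omega> = njumps i u v \<omega>"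
      using grid_jump_count[OF Z_cadlag uv e(1) _ sep] unfolding grid_count_def njumps_def eq by simp
  qed
qed

text \<open>The grid counts agree with the jump count from some index on, which makes the event a
  liminf of grid events up to a null set. The shift to \<open>Suc n\<close> avoids the grid without
  cells.\<close>

lemma njumps_event: 
  assumes uv: "0 \<le> u" "u < v" "v \<le> Tst"
  shows "{\<omega> \<in> space M. njumps i u v \<omega> = m} \<in> sets (F v)"
proof -
  obtain \<epsilon> where "\<epsilon> > 0" and all: "\<And>u v \<omega>. 0 \<le> u \<Longrightarrow> u < v \<Longrightarrow> v \<le> Tst \<Longrightarrow> \<omega> \<in> regular \<Longrightarrow>
       \<forall>\<^sub>F n in sequentially. grid_count \<epsilon> i u v n n \<omega> = njumps i u v \<omega>"
    by (fact grid_count_tendsto[of i])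
  note e = all[OF uv]
  have C: "{\<omega> \<in> space M. grid_count \<epsilon> i u v (Suc n) (Suc n) \<omega> = m} \<in> sets (F v)" for n
    using grid_count_indep[OF uv, of "Suc n" "Suc n" \<epsilon> i] by simp
  have ev: "njumps i u v \<omega> = m \<longleftrightarrow> (\<exists>N. \<forall>n\<in>{N..}. grid_count \<epsilon> i u v (Suc n) (Suc n) \<omega> = m)"
    if \<omega>: "\<omega> \<in> regular" for \<omega>
  proof -
    obtain N where N: "\<And>n. n \<ge> N \<Longrightarrow> grid_count \<epsilon> i u v n n \<omega> = njumps i u v \<omega>"
      using e[OF \<omega>] unfolding eventually_sequentially by blast
    show ?thesis
    proof
      assume "njumps i u v \<omega> = m"
      then show "\<exists>N. \<forall>n\<in>{N..}. grid_count \<epsilon> i u v (Suc n) (Suc n) \<omega> = m"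
        using N by (intro exI[of _ N]) auto
    next
      assume "\<exists>N. \<forall>n\<in>{N..}. grid_count \<epsilon> i u v (Suc n) (Suc n) \<omega> = m"
      then obtain N' where "\<And>n. n \<ge> N' \<Longrightarrow> grid_count \<epsilon> i u v (Suc n) (Suc n) \<omega> = m" by auto
      from this[of "max N N'"] show "njumps i u v \<omega> = m" using N[of "Suc (max N N')"] by simp
    qed
  qed
  \<comment> \<open>Off \<open>regular\<close> the count is 0, so that this null event joins exactly
    for \<open>m = 0\<close>.\<close>
  have "{\<omega> \<in> space M. njumps i u v \<omega> = m} =
     (regular \<inter> (\<Union>N. \<Inter>n\<in>{N..}. {\<omega> \<in> space M. grid_count \<epsilon> i u v (Suc n) (Suc n) \<omega> = m}))
       \<union> (if m = 0 then space M - regular else {})"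
  proof (rule set_eqI)
    fix \<omega>
    have "\<omega> \<notin> regular \<Longrightarrow> njumps i u v \<omega> = 0" by (simp add: njumps_def jumps_at_def)
    then show "\<omega> \<in> {\<omega> \<in> space M. njumps i u v \<omega> = m} \<longleftrightarrow> \<omega> \<in> (regular \<inter> (\<Union>N. \<Inter>n\<in>{N..}. {\<omega> \<in> space M. grid_count \<epsilon> i u v (Suc n) (Suc n) \<omega> = m}))
       \<union> (if m = 0 then space M - regular else {})"
      using ev[of \<omega>] regular(1) by (cases "\<omega> \<in> regular") auto
  qed
  also have "\<dots> \<in> sets (F v)"
  proof -
    have "(\<Inter>n\<in>{N..}. {\<omega> \<in> space M. grid_count \<epsilon> i u v (Suc n) (Suc n) \<omega> = m}) \<in> sets (F v)" for N
      using C by (intro sets.countable_INT') auto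
    then have "(\<Union>N. \<Inter>n\<in>{N..}. {\<omega> \<in> space M. grid_count \<epsilon> i u v (Suc n) (Suc n) \<omega> = m}) \<in> sets (F v)"
      by (intro sets.countable_UN) auto
    moreover have "space M - regular \<in> sets (F v)" using null_sets_F[OF regular(2)] .
    ultimately show ?thesis using regular_sets_F[of v] by auto
  qed
  finally show ?thesis .
qed

lemma njumps_measurable_F:
  assumes "0 \<le> u" "u \<le> v" "v \<le> Tst"
  shows "njumps i u v \<in> measurable (F v) (count_space UNIV)"
proof (cases "u = v")
  case True
  have "njumps i u v = (\<lambda>_. 0)" by (simp add: fun_eq_iff njumps_def True)
  then show ?thesis by simp
next
  case False
  then have "0 \<le> u" "u < v" "v \<le> Tst" using assms by auto
  from njumps_event[OF this, of i] show ?thesis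
    by (intro measurable_count_space_eq2_countable[THEN iffD2]) (auto simp: vimage_def Int_def conj_commute)
qed

lemma njumps_measurable:
  assumes "0 \<le> u" "u \<le> v" "v \<le> Tst"
  shows "njumps i u v \<in> measurable M (count_space UNIV)"
  using measurable_F_sub[OF njumps_measurable_F[OF assms]] .

text \<open>The product formula for the grid counts passes to the limit on both sides, since at
  almost every outcome membership in the grid events agrees eventually with membership in the limit
  event.\<close>

lemma njumps_indep:
  assumes uv: "0 \<le> u" "u < v" "v \<le> Tst" and A: "A \<in> sets (F u)"
  shows "prob (A \<inter> {\<omega> \<in> space M. njumps i u v \<omega> = m}) = prob A * prob {\<omega> \<in> space M. njumps i u v \<omega> = m}"
proof -
  obtain \<epsilon> where "\<epsilon> > 0" and all: "\<And>u v \<omega>. 0 \<le> u \<Longrightarrow> u < v \<Longrightarrow> v \<le> Tst \<Longrightarrow> \<omega> \<in> regular \<Longrightarrow>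
       \<forall>\<^sub>F n in sequentially. grid_count \<epsilon> i u v n n \<omega> = njumps i u v \<omega>"
    by (fact grid_count_tendsto[of i])
  note e = all[OF uv]
  define C where "C n = {\<omega> \<in> space M. grid_count \<epsilon> i u v (Suc n) (Suc n) \<omega> = m}" for n
  define C' where "C' = {\<omega> \<in> space M. njumps i u v \<omega> = m}"
  have C: "C n \<in> events" "prob (A \<inter> C n) = prob A * prob (C n)" for n
    using grid_count_indep[OF uv, of "Suc n" "Suc n" \<epsilon> i] A by (auto simp: C_def intro: sets_F_sub)
  have C': "C' \<in> events" using sets_F_sub[OF njumps_event[OF uv]] by (simp add: C'_def)
  have A': "A \<in> events" using sets_F_sub[OF A] .
  have lim: "AE \<omega> in M. \<forall>\<^sub>F n in sequentially. \<omega> \<in> C n \<longleftrightarrow> \<omega> \<in> C'"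
    using AE_regular
  proof eventually_elim
    case (elim \<omega>)
    have "\<forall>\<^sub>F n in sequentially. grid_count \<epsilon> i u v (Suc n) (Suc n) \<omega> = njumps i u v \<omega>"
      using e[OF elim] eventually_sequentially_Suc[of "\<lambda>n. grid_count \<epsilon> i u v n n \<omega> = njumps i u v \<omega>"] by blast
    then show ?case by eventually_elim (auto simp: C_def C'_def)
  qed
  have lim1: "(\<lambda>n. prob (C n)) \<longlonglongrightarrow> prob C'"
    using C C' lim by (intro prob_tendsto_AE) auto
  have "AE \<omega> in M. \<forall>\<^sub>F n in sequentially. \<omega> \<in> A \<inter> C n \<longleftrightarrow> \<omega> \<in> A \<inter> C'"
    using lim by eventually_elim (erule eventually_mono, blast)
  then have "(\<lambda>n. prob (A \<inter> C n)) \<longlonglongrightarrow> prob (A \<inter> C')"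
    using C(1) C' A' by (intro prob_tendsto_AE) auto
  moreover have "(\<lambda>n. prob (A \<inter> C n)) \<longlonglongrightarrow> prob A * prob C'"
    unfolding C(2) using lim1 by (intro tendsto_intros)
  ultimately show ?thesis unfolding C'_def by (rule LIMSEQ_unique)
qed

section \<open>First moments of the jump counts\<close>

lemma nn_integral_njumps_0:
  assumes "0 \<le> v" "v \<le> Tst"
  shows "(\<integral>\<^sup>+ \<omega>. of_nat (njumps i 0 v \<omega>) \<partial>M) = ennreal v * emeasure \<nu> {x i}"
proof -
  have "(\<integral>\<^sup>+ \<omega>. of_nat (njumps i 0 v \<omega>) \<partial>M) = (\<integral>\<^sup>+ \<omega>. jump_count Z v {x i} \<omega> \<partial>M)"
  proof (rule nn_integral_cong_AE)
    show "AE \<omega> in M. of_nat (njumps i 0 v \<omega>) = jump_count Z v {x i} \<omega>"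
      using AE_regular
    proof eventually_elim
      case (elim \<omega>)
      have "{s \<in> {0..v}. jump Z s \<omega> = x i} = jumps_at i \<omega> \<inter> {0<..v}"
      proof (rule set_eqI)
        fix s
        show "s \<in> {s \<in> {0..v}. jump Z s \<omega> = x i} \<longleftrightarrow> s \<in> jumps_at i \<omega> \<inter> {0<..v}"
          using elim assms x_nonzero[of i] by (cases "s = 0") (auto simp: jumps_at_def)
      qed
      then show ?case
        unfolding jump_count_def njumps_def by (simp add: emeasure_count_space_finite)
    qed
  qed
  also have "\<dots> = ennreal v * emeasure \<nu> {x i}"
    using assms x_nonzero[of i] by (intro nu_intensity) auto
  finally show ?thesis .
qed

text \<open>The intensity is known for intervals that start at 0. The general case is a difference,
  and the cancellation uses that the mass of an atom is finite.\<close>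

lemma nn_integral_njumps:
  assumes "0 \<le> u" "u \<le> v" "v \<le> Tst"
  shows "(\<integral>\<^sup>+ \<omega>. of_nat (njumps i u v \<omega>) \<partial>M) = ennreal (v - u) * emeasure \<nu> {x i}"
proof -
  have [measurable]: "njumps i 0 u \<in> measurable M (count_space UNIV)" "njumps i u v \<in> measurable M (count_space UNIV)"
    using assms by (auto intro!: njumps_measurable)
  have "ennreal v * emeasure \<nu> {x i} = (\<integral>\<^sup>+ \<omega>. of_nat (njumps i 0 v \<omega>) \<partial>M)"
    using assms by (intro nn_integral_njumps_0[symmetric]) auto
  also have "\<dots> = (\<integral>\<^sup>+ \<omega>. of_nat (njumps i 0 u \<omega>) + of_nat (njumps i u v \<omega>) \<partial>M)"
    using assms by (intro nn_integral_cong) (simp add: njumps_add[of 0 u v])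
  also have "\<dots> = (\<integral>\<^sup>+ \<omega>. of_nat (njumps i 0 u \<omega>) \<partial>M) + (\<integral>\<^sup>+ \<omega>. of_nat (njumps i u v \<omega>) \<partial>M)"
    by (intro nn_integral_add) measurable
  also have "(\<integral>\<^sup>+ \<omega>. of_nat (njumps i 0 u \<omega>) \<partial>M) = ennreal u * emeasure \<nu> {x i}"
    using assms by (intro nn_integral_njumps_0) auto
  finally have eq: "ennreal v * emeasure \<nu> {x i} = ennreal u * emeasure \<nu> {x i} + (\<integral>\<^sup>+ \<omega>. of_nat (njumps i u v \<omega>) \<partial>M)" .
  have "ennreal v * emeasure \<nu> {x i} = ennreal u * emeasure \<nu> {x i} + ennreal (v - u) * emeasure \<nu> {x i}"
    using assms by (simp add: distrib_right[symmetric] ennreal_plus[symmetric] del: ennreal_plus)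
  then show ?thesis using eq by (simp add: emeasure_nu ennreal_mult[symmetric] assms ennreal_add_left_cancel)
qed

text \<open>Expanding the count over its values reduces the formula to \<open>njumps_indep\<close>
  for each value; the same expansion with \<open>B = space M\<close> reassembles the
  expectation.\<close>

lemma nn_integral_njumps_indep:
  assumes uv: "0 \<le> u" "u < v" "v \<le> Tst" and A: "A \<in> sets (F u)"
  shows "(\<integral>\<^sup>+ \<omega>. indicator A \<omega> * of_nat (njumps i u v \<omega>) \<partial>M) = emeasure M A * (ennreal (v - u) * emeasure \<nu> {x i})"
proof -
  define C where "C m = {\<omega> \<in> space M. njumps i u v \<omega> = m}" for m
  have C [measurable]: "C m \<in> events" for m using sets_F_sub[OF njumps_event[OF uv]] by (simp add: C_def)
  have [measurable]: "A \<in> events" using sets_F_sub[OF A] .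
  have expand: "(of_nat (njumps i u v \<omega>) :: ennreal) = (\<Sum>m. of_nat m * indicator (C m) \<omega>)" if "\<omega> \<in> space M" for \<omega>
  proof -
    have "(\<lambda>m. of_nat m * indicator (C m) \<omega>) = (\<lambda>m. if m = njumps i u v \<omega> then of_nat m else (0 :: ennreal))"
      using that by (auto simp: C_def fun_eq_iff indicator_def)
    then show ?thesis using sums_single[of "njumps i u v \<omega>" "\<lambda>m. of_nat m :: ennreal"] by (simp add: sums_iff)
  qed
  have *: "(\<integral>\<^sup>+ \<omega>. indicator B \<omega> * of_nat (njumps i u v \<omega>) \<partial>M) = (\<Sum>m. of_nat m * emeasure M (B \<inter> C m))"
    if [measurable]: "B \<in> events" for B
  proof -
    have "(\<integral>\<^sup>+ \<omega>. indicator B \<omega> * of_nat (njumps i u v \<omega>) \<partial>M) = (\<integral>\<^sup>+ \<omega>. (\<Sum>m. of_nat m * indicator (B \<inter> C m) \<omega>) \<partial>M)"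
    proof (intro nn_integral_cong)
      fix \<omega> assume "\<omega> \<in> space M"
      then have "indicator B \<omega> * of_nat (njumps i u v \<omega>) = (\<Sum>m. indicator B \<omega> * (of_nat m * indicator (C m) \<omega>) :: ennreal)"
        by (simp only: expand ennreal_suminf_cmult)
      also have "\<dots> = (\<Sum>m. of_nat m * indicator (B \<inter> C m) \<omega>)"
        by (intro suminf_cong) (auto simp: indicator_def)
      finally show "indicator B \<omega> * of_nat (njumps i u v \<omega>) = (\<Sum>m. of_nat m * indicator (B \<inter> C m) \<omega> :: ennreal)" .
    qed
    also have "\<dots> = (\<Sum>m. \<integral>\<^sup>+ \<omega>. of_nat m * indicator (B \<inter> C m) \<omega> \<partial>M)"
      by (intro nn_integral_suminf) measurable
    also have "\<dots> = (\<Sum>m. of_nat m * emeasure M (B \<inter> C m))"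
      by (intro suminf_cong nn_integral_cmult_indicator) measurable
    finally show ?thesis .
  qed
  have "(\<integral>\<^sup>+ \<omega>. indicator A \<omega> * of_nat (njumps i u v \<omega>) \<partial>M) = (\<Sum>m. of_nat m * emeasure M (A \<inter> C m))"
    by (rule *) measurable
  also have "\<dots> = (\<Sum>m. emeasure M A * (of_nat m * emeasure M (C m)))"
    using njumps_indep[OF uv A, of i, folded C_def]
    by (intro suminf_cong) (simp add: emeasure_eq_measure ennreal_mult mult_ac)
  also have "\<dots> = emeasure M A * (\<Sum>m. of_nat m * emeasure M (C m))"
    by (rule ennreal_suminf_cmult)
  also have "(\<Sum>m. of_nat m * emeasure M (C m)) = (\<integral>\<^sup>+ \<omega>. indicator (space M) \<omega> * of_nat (njumps i u v \<omega>) \<partial>M)"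
    by (subst *) (auto intro!: suminf_cong simp: C_def Int_def)
  also have "\<dots> = (\<integral>\<^sup>+ \<omega>. of_nat (njumps i u v \<omega>) \<partial>M)"
    by (intro nn_integral_cong) auto
  also have "\<dots> = ennreal (v - u) * emeasure \<nu> {x i}"
    using uv by (intro nn_integral_njumps) auto
  finally show ?thesis .
qed

end

section \<open>The compensator formula for predictable sets\<close>

context levy_noise
begin

definition pred_generator :: "('w \<times> real) set set" where
  "pred_generator = {A \<times> {0} | A. A \<in> sets (F 0)} \<union>
      {A \<times> {s<..t} | A s t. 0 \<le> s \<and> s < t \<and> t \<le> Tst \<and> A \<in> sets (F s)}"

lemma pred_generator_Pow: "pred_generator \<subseteq> Pow (space M \<times> {0..Tst})"
proof -
  have "A \<subseteq> space M" if "A \<in> sets (F s)" for A s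
    using sets.sets_into_space[OF that] by simp
  then show ?thesis using horizon_pos unfolding pred_generator_def by fastforce
qed

lemma sets_pred: "sets pred_alg = sigma_sets (space M \<times> {0..Tst}) pred_generator"
  unfolding predictable_sigma_def pred_generator_def[symmetric]
  by (rule sets_measure_of[OF pred_generator_Pow])

lemma space_pred [simp]: "space pred_alg = space M \<times> {0..Tst}"
  by (simp add: predictable_sigma_def space_measure_of_conv)

lemma Int_stable_pred_generator: "Int_stable pred_generator"
proof (rule Int_stableI)
  fix P Q assume P: "P \<in> pred_generator" and Q: "Q \<in> pred_generator"
  have empty: "{} \<in> pred_generator" unfolding pred_generator_def by blast
  have cases: thesis if "R \<in> pred_generator" "\<And>A. R = A \<times> {0} \<Longrightarrow> A \<in> sets (F 0) \<Longrightarrow> thesis"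
    "\<And>A s t. R = A \<times> {s<..t} \<Longrightarrow> 0 \<le> s \<Longrightarrow> s < t \<Longrightarrow> t \<le> Tst \<Longrightarrow> A \<in> sets (F s) \<Longrightarrow> thesis"
    for thesis and R :: "('w \<times> real) set"
    using that unfolding pred_generator_def by auto
  show "P \<inter> Q \<in> pred_generator"
  proof (rule cases[OF P]; rule cases[OF Q])
    fix A A' assume A: "P = A \<times> {0}" "A \<in> sets (F 0)" "Q = A' \<times> {0}" "A' \<in> sets (F 0)"
    then have "P \<inter> Q = (A \<inter> A') \<times> {0}" "A \<inter> A' \<in> sets (F 0)" by auto
    then show ?thesis unfolding pred_generator_def by blast
  next
    fix A A' s t assume "P = A \<times> {0}" "Q = A' \<times> {s<..t}" "0 \<le> s"
    then have "P \<inter> Q = {}" by auto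
    then show ?thesis using empty by simp
  next
    fix A A' s t assume "Q = A \<times> {0}" "P = A' \<times> {s<..t}" "0 \<le> s"
    then have "P \<inter> Q = {}" by auto
    then show ?thesis using empty by simp
  next
    fix A A' s t s' t' assume 4: "P = A \<times> {s<..t}" "0 \<le> s" "s < t" "t \<le> Tst" "A \<in> sets (F s)"
       "Q = A' \<times> {s'<..t'}" "0 \<le> s'" "s' < t'" "t' \<le> Tst" "A' \<in> sets (F s')"
    have eq: "P \<inter> Q = (A \<inter> A') \<times> {max s s'<..min t t'}" using 4 by auto
    show ?thesis
    proof (cases "max s s' < min t t'")
      case True
      have "A \<inter> A' \<in> sets (F (max s s'))"
        using sets_F_mono[OF max.cobounded1[of s s'] 4(5)] sets_F_mono[OF max.cobounded2[of s' s] 4(10)] by auto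
      moreover have "0 \<le> max s s'" "min t t' \<le> Tst" using 4 by auto
      ultimately show ?thesis unfolding eq pred_generator_def using True by blast
    next
      case False
      then have "P \<inter> Q = {}" unfolding eq by auto
      then show ?thesis using empty by simp
    qed
  qed
qed

lemma pred_rectangle:
  assumes "0 \<le> s" "s < t" "t \<le> Tst" "A \<in> sets (F s)"
  shows "A \<times> {s<..t} \<in> sets pred_alg"
  unfolding sets_pred using assms by (intro sigma_sets.Basic) (auto simp: pred_generator_def)

lemma sets_pred_sub: "sets pred_alg \<subseteq> sets (M \<Otimes>\<^sub>M lborel)"
proof -
  have "pred_generator \<subseteq> sets (M \<Otimes>\<^sub>M lborel)"
    unfolding pred_generator_def using sets_F_sub by (auto intro!: pair_measureI)
  moreover have "space M \<times> {0..Tst} \<in> sets (M \<Otimes>\<^sub>M lborel)" by (intro pair_measureI) auto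
  ultimately show ?thesis
    unfolding sets_pred by (intro sets.sigma_sets_subset') auto
qed

end

section \<open>Compensators of the jumps of a fixed size\<close>

context discrete_levy_noise
begin

text \<open>The mass of \<open>D\<close> under the random measure that counts the jumps of size
  \<open>x i\<close>. The counting measure supplies countable additivity in
  \<open>D\<close>.\<close>

definition hits :: "nat \<Rightarrow> ('w \<times> real) set \<Rightarrow> 'w \<Rightarrow> ennreal" where
  "hits i D \<omega> = emeasure (count_space UNIV) {s \<in> jumps_at i \<omega>. (\<omega>, s) \<in> D}"

lemma hits_card: "hits i D \<omega> = of_nat (card {s \<in> jumps_at i \<omega>. (\<omega>, s) \<in> D})"
  unfolding hits_def by (simp add: emeasure_count_space_finite)

lemma hits_rectangle: "hits i (A \<times> {s<..t}) \<omega> = indicator A \<omega> * of_nat (njumps i s t \<omega>)"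
proof -
  have "{r \<in> jumps_at i \<omega>. (\<omega>, r) \<in> A \<times> {s<..t}} = (if \<omega> \<in> A then jumps_at i \<omega> \<inter> {s<..t} else {})"
    by auto
  then show ?thesis unfolding hits_card njumps_def by (simp add: indicator_def)
qed

text \<open>A Dynkin argument over the generating rectangles, where independence of the past gives
  the formula. The rectangles at time 0 contribute nothing on either side, since no jump occurs at 0
  and a single time is a null set.\<close>

lemma compensator_aux:
  assumes "D \<in> sigma_sets (space M \<times> {0..Tst}) pred_generator"
  shows "hits i D \<in> borel_measurable M \<and> (\<integral>\<^sup>+ \<omega>. hits i D \<omega> \<partial>M) = emeasure \<nu> {x i} * emeasure (M \<Otimes>\<^sub>M lborel) D"
  using Int_stable_pred_generator pred_generator_Pow assms
proof (induction D rule: sigma_sets_induct_disjoint)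
  case (basic D)
  then consider A where "D = A \<times> {0}" "A \<in> sets (F 0)"
    | A s t where "D = A \<times> {s<..t}" "0 \<le> s" "s < t" "t \<le> Tst" "A \<in> sets (F s)"
    unfolding pred_generator_def by blast
  then show ?case
  proof cases
    case 1
    have A: "A \<in> sets M" using sets_F_sub[OF 1(2)] .
    have "{s \<in> jumps_at i \<omega>. (\<omega>, s) \<in> D} = {}" for \<omega>
      using jumps_at_subset[of i \<omega>] unfolding 1 by auto
    then have "hits i D = (\<lambda>_. 0)" by (simp add: hits_def fun_eq_iff)
    moreover have "emeasure (M \<Otimes>\<^sub>M lborel) D = 0"
      unfolding 1 using A by (subst lborel.emeasure_pair_measure_Times) auto
    ultimately show ?thesis by simp
  next
    case 2
    have A [measurable]: "A \<in> sets M" using sets_F_sub[OF 2(5)] .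
    have [measurable]: "njumps i s t \<in> measurable M (count_space UNIV)"
      using 2 by (intro njumps_measurable) auto
    have eq: "hits i D = (\<lambda>\<omega>. indicator A \<omega> * of_nat (njumps i s t \<omega>))"
      unfolding 2(1) by (rule ext) (rule hits_rectangle)
    have "emeasure (M \<Otimes>\<^sub>M lborel) D = emeasure M A * ennreal (t - s)"
      unfolding 2(1) using 2 A by (subst lborel.emeasure_pair_measure_Times) auto
    then have "(\<integral>\<^sup>+ \<omega>. hits i D \<omega> \<partial>M) = emeasure \<nu> {x i} * emeasure (M \<Otimes>\<^sub>M lborel) D"
      unfolding eq nn_integral_njumps_indep[OF 2(2-5)] by (simp add: mult_ac)
    moreover have "hits i D \<in> borel_measurable M" unfolding eq by measurable
    ultimately show ?thesis by blast
  qed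
next
  case empty
  then show ?case by (simp add: hits_def)
next
  case (compl D)
  define \<Omega> where "\<Omega> = space M \<times> {0..Tst}"
  have D: "D \<subseteq> \<Omega>" using sigma_sets_into_sp[OF pred_generator_Pow compl(1)] unfolding \<Omega>_def by blast
  have D_pred: "D \<in> sets (M \<Otimes>\<^sub>M lborel)" using compl(1) sets_pred_sub sets_pred by auto
  have \<Omega>_sets: "\<Omega> \<in> sets (M \<Otimes>\<^sub>M lborel)" unfolding \<Omega>_def by (intro pair_measureI) auto
  have [measurable]: "njumps i 0 Tst \<in> measurable M (count_space UNIV)"
    using horizon_pos by (intro njumps_measurable) auto
  have [measurable]: "hits i D \<in> borel_measurable M" using compl(2) by blast
  have jumps: "{s \<in> jumps_at i \<omega>. (\<omega>, s) \<in> \<Omega>} = jumps_at i \<omega> \<inter> {0<..Tst}" if "\<omega> \<in> space M" for \<omega>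
    using jumps_at_subset[of i \<omega>] that unfolding \<Omega>_def by auto
  have hits_\<Omega>: "hits i \<Omega> \<omega> = of_nat (njumps i 0 Tst \<omega>)" if "\<omega> \<in> space M" for \<omega>
    unfolding hits_card jumps[OF that] njumps_def ..
  have add: "hits i \<Omega> \<omega> = hits i D \<omega> + hits i (\<Omega> - D) \<omega>" for \<omega>
  proof -
    have "{s \<in> jumps_at i \<omega>. (\<omega>, s) \<in> \<Omega>} = {s \<in> jumps_at i \<omega>. (\<omega>, s) \<in> D} \<union> {s \<in> jumps_at i \<omega>. (\<omega>, s) \<in> \<Omega> - D}"
      using D by auto
    then show ?thesis unfolding hits_def by (subst plus_emeasure) auto
  qed
  have fin: "hits i D \<omega> < \<infinity>" for \<omega> by (simp add: hits_card of_nat_less_top)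
  have "hits i (\<Omega> - D) \<omega> = of_nat (njumps i 0 Tst \<omega>) - hits i D \<omega>" if "\<omega> \<in> space M" for \<omega>
    unfolding hits_\<Omega>[OF that, symmetric] add using fin[of \<omega>] by simp
  then have meas: "hits i (\<Omega> - D) \<in> borel_measurable M"
    by (subst measurable_cong) (assumption, measurable)
  have "(\<integral>\<^sup>+ \<omega>. hits i D \<omega> \<partial>M) + (\<integral>\<^sup>+ \<omega>. hits i (\<Omega> - D) \<omega> \<partial>M) = (\<integral>\<^sup>+ \<omega>. hits i D \<omega> + hits i (\<Omega> - D) \<omega> \<partial>M)"
    using meas by (intro nn_integral_add[symmetric]) measurable
  also have "\<dots> = (\<integral>\<^sup>+ \<omega>. of_nat (njumps i 0 Tst \<omega>) \<partial>M)"
    unfolding add[symmetric] by (intro nn_integral_cong hits_\<Omega>)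
  also have "\<dots> = ennreal (Tst - 0) * emeasure \<nu> {x i}"
    using horizon_pos by (intro nn_integral_njumps) auto
  also have "\<dots> = emeasure \<nu> {x i} * emeasure (M \<Otimes>\<^sub>M lborel) \<Omega>"
    unfolding \<Omega>_def using horizon_pos
    by (subst lborel.emeasure_pair_measure_Times) (auto simp: emeasure_space_1 mult_ac)
  also have "\<dots> = emeasure \<nu> {x i} * (emeasure (M \<Otimes>\<^sub>M lborel) D + emeasure (M \<Otimes>\<^sub>M lborel) (\<Omega> - D))"
    using D D_pred \<Omega>_sets by (subst plus_emeasure) (auto simp: Un_absorb1)
  also have "\<dots> = (\<integral>\<^sup>+ \<omega>. hits i D \<omega> \<partial>M) + emeasure \<nu> {x i} * emeasure (M \<Otimes>\<^sub>M lborel) (\<Omega> - D)"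
    using compl(2) by (simp add: distrib_left)
  finally have sum: "(\<integral>\<^sup>+ \<omega>. hits i D \<omega> \<partial>M) + (\<integral>\<^sup>+ \<omega>. hits i (\<Omega> - D) \<omega> \<partial>M)
     = (\<integral>\<^sup>+ \<omega>. hits i D \<omega> \<partial>M) + emeasure \<nu> {x i} * emeasure (M \<Otimes>\<^sub>M lborel) (\<Omega> - D)" .
  \<comment> \<open>The expectation has to be finite before it can be cancelled in
    \<open>sum\<close>.\<close>
  have "(\<integral>\<^sup>+ \<omega>. hits i D \<omega> \<partial>M) \<le> (\<integral>\<^sup>+ \<omega>. of_nat (njumps i 0 Tst \<omega>) \<partial>M)"
    using add hits_\<Omega> by (intro nn_integral_mono) (metis le_iff_add)
  also have "\<dots> = ennreal (Tst - 0) * emeasure \<nu> {x i}"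
    using horizon_pos by (intro nn_integral_njumps) auto
  also have "\<dots> < \<infinity>" by (simp add: emeasure_nu ennreal_mult_less_top)
  finally have "(\<integral>\<^sup>+ \<omega>. hits i D \<omega> \<partial>M) \<noteq> \<infinity>" by simp
  then have "(\<integral>\<^sup>+ \<omega>. hits i (\<Omega> - D) \<omega> \<partial>M) = emeasure \<nu> {x i} * emeasure (M \<Otimes>\<^sub>M lborel) (\<Omega> - D)"
    using sum by (simp add: ennreal_add_left_cancel)
  then show ?case using meas unfolding \<Omega>_def by blast
next
  case (union D)
  have D: "range D \<subseteq> sets (M \<Otimes>\<^sub>M lborel)" using union(2) sets_pred_sub sets_pred by auto
  have [measurable]: "hits i (D n) \<in> borel_measurable M" for n using union(3) by blast
  have eq: "hits i (\<Union>n. D n) \<omega> = (\<Sum>n. hits i (D n) \<omega>)" for \<omega>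
  proof -
    have "{s \<in> jumps_at i \<omega>. (\<omega>, s) \<in> (\<Union>n. D n)} = (\<Union>n. {s \<in> jumps_at i \<omega>. (\<omega>, s) \<in> D n})" by auto
    moreover have "disjoint_family (\<lambda>n. {s \<in> jumps_at i \<omega>. (\<omega>, s) \<in> D n})"
      using union(1) unfolding disjoint_family_on_def by blast
    ultimately show ?thesis unfolding hits_def by (simp only:) (rule suminf_emeasure[symmetric], auto)
  qed
  have "(\<integral>\<^sup>+ \<omega>. hits i (\<Union>n. D n) \<omega> \<partial>M) = (\<Sum>n. \<integral>\<^sup>+ \<omega>. hits i (D n) \<omega> \<partial>M)"
    unfolding eq by (intro nn_integral_suminf) measurable
  also have "\<dots> = (\<Sum>n. emeasure \<nu> {x i} * emeasure (M \<Otimes>\<^sub>M lborel) (D n))"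
    using union(3) by (intro suminf_cong) blast
  also have "\<dots> = emeasure \<nu> {x i} * (\<Sum>n. emeasure (M \<Otimes>\<^sub>M lborel) (D n))"
    by (rule ennreal_suminf_cmult)
  also have "(\<Sum>n. emeasure (M \<Otimes>\<^sub>M lborel) (D n)) = emeasure (M \<Otimes>\<^sub>M lborel) (\<Union>n. D n)"
    using D union(1) by (intro suminf_emeasure)
  finally have "(\<integral>\<^sup>+ \<omega>. hits i (\<Union>n. D n) \<omega> \<partial>M) = emeasure \<nu> {x i} * emeasure (M \<Otimes>\<^sub>M lborel) (\<Union>n. D n)" .
  moreover have "(\<lambda>\<omega>. \<Sum>n. hits i (D n) \<omega>) \<in> borel_measurable M" by measurable
  then have "hits i (\<Union>n. D n) \<in> borel_measurable M" unfolding eq[symmetric] .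
  ultimately show ?case by blast
qed

lemma compensator:
  assumes "D \<in> sets pred_alg"
  shows "hits i D \<in> borel_measurable M"
    and "(\<integral>\<^sup>+ \<omega>. hits i D \<omega> \<partial>M) = emeasure \<nu> {x i} * emeasure (M \<Otimes>\<^sub>M lborel) D"
  using compensator_aux assms unfolding sets_pred by blast+

text \<open>Since the atom has positive mass, the compensator formula forces a predictable set to be
  null if almost surely no jump of size \<open>x i\<close> falls into it. This is how a statement
  about jumps becomes one about almost every time.\<close>

lemma null_if_no_hits:
  assumes D: "D \<in> sets pred_alg" and none: "AE \<omega> in M. \<forall>s\<in>jumps_at i \<omega>. (\<omega>, s) \<notin> D"
  shows "D \<in> null_sets (M \<Otimes>\<^sub>M lborel)"
proof -
  have "AE \<omega> in M. hits i D \<omega> = 0"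
    using none
  proof eventually_elim
    case (elim \<omega>)
    then have "{s \<in> jumps_at i \<omega>. (\<omega>, s) \<in> D} = {}" by blast
    then show ?case by (simp add: hits_def)
  qed
  then have "(\<integral>\<^sup>+ \<omega>. hits i D \<omega> \<partial>M) = 0"
    using compensator(1)[OF D] by (subst nn_integral_0_iff_AE) auto
  then have "emeasure (M \<Otimes>\<^sub>M lborel) D = 0"
    using compensator(2)[OF D, of i] atom_pos[of i] by auto
  then show ?thesis using D sets_pred_sub by (intro null_setsI) blast+
qed

text \<open>
  Second moments of jump counts are bounded through ordered pairs of jumps: the number of earlier
  jumps is predictable, so the compensator formula applies to the later jump.
\<close>

definition npairs :: "nat \<Rightarrow> nat \<Rightarrow> 'w \<Rightarrow> nat" where
  "npairs i j \<omega> = (\<Sum>s\<in>jumps_at i \<omega>. card (jumps_at j \<omega> \<inter> {..<s}))"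

text \<open>The number of jumps strictly before \<open>s\<close> is left-continuous in
  \<open>s\<close>: it exceeds \<open>m\<close> exactly if more than \<open>m\<close> jumps have
  occurred up to some rational time before \<open>s\<close>. This gives a countable union of
  predictable rectangles.\<close>

lemma many_jumps_before_predictable:
  "{(\<omega>, s). \<omega> \<in> space M \<and> s \<in> {0..Tst} \<and> m < card (jumps_at j \<omega> \<inter> {..<s})} \<in> sets pred_alg" (is "?D \<in> _")
proof -
  define Q where "Q = \<rat> \<inter> {0..<Tst}"
  have "?D = (\<Union>q\<in>Q. {\<omega> \<in> space M. m < njumps j 0 q \<omega>} \<times> {q<..Tst})"
  proof (intro set_eqI iffI)
    fix p assume "p \<in> ?D"
    then obtain \<omega> s where p: "p = (\<omega>, s)" "\<omega> \<in> space M" "s \<in> {0..Tst}" "m < card (jumps_at j \<omega> \<inter> {..<s})"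
      by auto
    then have "jumps_at j \<omega> \<inter> {..<s} \<noteq> {}" by auto
    then have s: "0 < s" using jumps_at_subset[of j \<omega>] by force
    \<comment> \<open>The rational \<open>q\<close> will lie between the last jump before
      \<open>s\<close> and \<open>s\<close>, so that no jump is lost; inserting 0 keeps
      \<open>q\<close> in the horizon.\<close>
    define r where "r = Max (insert 0 (jumps_at j \<omega> \<inter> {..<s}))"
    have r: "0 \<le> r" "r < s" unfolding r_def using s by auto
    obtain q where q: "q \<in> \<rat>" "r < q" "q < s" using Rats_dense_in_real[OF r(2)] by auto
    have "jumps_at j \<omega> \<inter> {..<s} \<subseteq> jumps_at j \<omega> \<inter> {0<..q}"
    proof
      fix y assume y: "y \<in> jumps_at j \<omega> \<inter> {..<s}"
      then have "y \<le> r" unfolding r_def by (intro Max_ge) auto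
      then show "y \<in> jumps_at j \<omega> \<inter> {0<..q}" using y q jumps_at_subset[of j \<omega>] by auto
    qed
    then have "card (jumps_at j \<omega> \<inter> {..<s}) \<le> njumps j 0 q \<omega>"
      unfolding njumps_def by (intro card_mono) auto
    then show "p \<in> (\<Union>q\<in>Q. {\<omega> \<in> space M. m < njumps j 0 q \<omega>} \<times> {q<..Tst})"
      using p q r by (auto simp: Q_def intro!: bexI[of _ q])
  next
    fix p assume "p \<in> (\<Union>q\<in>Q. {\<omega> \<in> space M. m < njumps j 0 q \<omega>} \<times> {q<..Tst})"
    then obtain q \<omega> s where p: "p = (\<omega>, s)" "q \<in> Q" "\<omega> \<in> space M" "m < njumps j 0 q \<omega>" "s \<in> {q<..Tst}"
      by auto
    have "njumps j 0 q \<omega> \<le> card (jumps_at j \<omega> \<inter> {..<s})"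
      unfolding njumps_def using p(5) by (intro card_mono) auto
    then show "p \<in> ?D" using p by (auto simp: Q_def)
  qed
  also have "\<dots> \<in> sets pred_alg"
  proof (rule sets.countable_UN'')
    show "countable Q" unfolding Q_def by (rule countable_subset[OF _ countable_rat]) auto
    fix q assume q: "q \<in> Q"
    have [measurable]: "njumps j 0 q \<in> measurable (F q) (count_space UNIV)"
      using q by (intro njumps_measurable_F) (auto simp: Q_def)
    have "{\<omega> \<in> space (F q). m < njumps j 0 q \<omega>} \<in> sets (F q)" by measurable
    then show "{\<omega> \<in> space M. m < njumps j 0 q \<omega>} \<times> {q<..Tst} \<in> sets pred_alg"
      using q by (intro pred_rectangle) (auto simp: Q_def)
  qed
  finally show ?thesis .
qed

lemma of_nat_eq_suminf: "(of_nat n :: ennreal) = (\<Sum>m. if m < n then 1 else 0)"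
proof -
  have "(\<lambda>m. if m < n then 1 else 0 :: ennreal) sums (\<Sum>m\<in>{..<n}. if m < n then 1 else 0)"
    by (rule sums_finite) auto
  then show ?thesis by (simp add: sums_iff)
qed

text \<open>The number of earlier jumps is the sum over \<open>m\<close> of the indicators of
  \<open>D m\<close>. The compensator formula replaces the later jump by an integral over time, and
  enlarging each \<open>D m\<close> to the whole horizon leaves \<open>Tst\<close> times the
  expected number of all jumps of size \<open>x j\<close>, which contributes the second factor
  \<open>Tst\<close>.\<close>

lemma npairs_expectation:
  "npairs i j \<in> measurable M (count_space UNIV)"
  "(\<integral>\<^sup>+ \<omega>. of_nat (npairs i j \<omega>) \<partial>M) \<le> ennreal (Tst\<^sup>2) * emeasure \<nu> {x i} * emeasure \<nu> {x j}"
proof -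
  define D where "D m = {(\<omega>, s). \<omega> \<in> space M \<and> s \<in> {0..Tst} \<and> m < card (jumps_at j \<omega> \<inter> {..<s})}" for m
  have D: "D m \<in> sets pred_alg" for m unfolding D_def by (rule many_jumps_before_predictable)
  note [measurable] = compensator(1)[OF D]
  have [measurable]: "njumps j 0 Tst \<in> measurable M (count_space UNIV)"
    using horizon_pos by (intro njumps_measurable) auto
  have eq: "of_nat (npairs i j \<omega>) = (\<Sum>m. hits i (D m) \<omega>)" if \<omega>: "\<omega> \<in> space M" for \<omega>
  proof -
    have "of_nat (npairs i j \<omega>) = (\<Sum>s\<in>jumps_at i \<omega>. \<Sum>m. if m < card (jumps_at j \<omega> \<inter> {..<s}) then 1 else 0 :: ennreal)"
      unfolding npairs_def of_nat_sum by (intro sum.cong of_nat_eq_suminf refl)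
    also have "\<dots> = (\<Sum>m. \<Sum>s\<in>jumps_at i \<omega>. if m < card (jumps_at j \<omega> \<inter> {..<s}) then 1 else 0 :: ennreal)"
      by (rule suminf_sum[symmetric]) simp
    also have "\<dots> = (\<Sum>m. hits i (D m) \<omega>)"
    proof (rule suminf_cong)
      fix m
      have "{s \<in> jumps_at i \<omega>. (\<omega>, s) \<in> D m} = {s \<in> jumps_at i \<omega>. m < card (jumps_at j \<omega> \<inter> {..<s})}"
        using \<omega> jumps_at_subset[of i \<omega>] unfolding D_def by auto
      then show "(\<Sum>s\<in>jumps_at i \<omega>. if m < card (jumps_at j \<omega> \<inter> {..<s}) then 1 else 0 :: ennreal) = hits i (D m) \<omega>"
        unfolding hits_card by (simp add: sum.If_cases Int_def)
    qed
    finally show ?thesis .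
  qed
  have "(\<lambda>\<omega>. of_nat (npairs i j \<omega>) :: ennreal) \<in> borel_measurable M"
    by (subst measurable_cong[OF eq]) (assumption, measurable)
  then have "(\<lambda>\<omega>. of_nat (npairs i j \<omega>) :: ennreal) -` {of_nat n} \<inter> space M \<in> sets M" for n
    by (rule measurable_sets) simp
  then show "npairs i j \<in> measurable M (count_space UNIV)"
    by (intro measurable_count_space_eq2_countable[THEN iffD2]) (auto simp: vimage_def)
  have bound: "emeasure (M \<Otimes>\<^sub>M lborel) (D m) \<le> ennreal Tst * emeasure M {\<omega> \<in> space M. m < njumps j 0 Tst \<omega>}" for m
  proof -
    have "D m \<subseteq> {\<omega> \<in> space M. m < njumps j 0 Tst \<omega>} \<times> {0..Tst}"
    proof
      fix p assume "p \<in> D m"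
      then obtain \<omega> s where p: "p = (\<omega>, s)" "\<omega> \<in> space M" "s \<in> {0..Tst}" "m < card (jumps_at j \<omega> \<inter> {..<s})"
        by (auto simp: D_def)
      have "card (jumps_at j \<omega> \<inter> {..<s}) \<le> njumps j 0 Tst \<omega>"
        unfolding njumps_def using jumps_at_subset[of j \<omega>] by (intro card_mono) auto
      then show "p \<in> {\<omega> \<in> space M. m < njumps j 0 Tst \<omega>} \<times> {0..Tst}" using p by auto
    qed
    then have "emeasure (M \<Otimes>\<^sub>M lborel) (D m) \<le> emeasure (M \<Otimes>\<^sub>M lborel) ({\<omega> \<in> space M. m < njumps j 0 Tst \<omega>} \<times> {0..Tst})"
      by (intro emeasure_mono pair_measureI) auto
    also have "\<dots> = ennreal Tst * emeasure M {\<omega> \<in> space M. m < njumps j 0 Tst \<omega>}"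
      using horizon_pos by (subst lborel.emeasure_pair_measure_Times) (auto simp: mult_ac)
    finally show ?thesis .
  qed
  have "(\<integral>\<^sup>+ \<omega>. of_nat (npairs i j \<omega>) \<partial>M) = (\<integral>\<^sup>+ \<omega>. (\<Sum>m. hits i (D m) \<omega>) \<partial>M)"
    by (intro nn_integral_cong eq)
  also have "\<dots> = (\<Sum>m. \<integral>\<^sup>+ \<omega>. hits i (D m) \<omega> \<partial>M)" by (intro nn_integral_suminf) measurable
  also have "\<dots> = (\<Sum>m. emeasure \<nu> {x i} * emeasure (M \<Otimes>\<^sub>M lborel) (D m))"
    by (intro suminf_cong compensator(2) D)
  also have "\<dots> \<le> (\<Sum>m. emeasure \<nu> {x i} * (ennreal Tst * emeasure M {\<omega> \<in> space M. m < njumps j 0 Tst \<omega>}))"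
    using bound by (intro suminf_le mult_left_mono) auto
  also have "\<dots> = emeasure \<nu> {x i} * (ennreal Tst * (\<Sum>m. emeasure M {\<omega> \<in> space M. m < njumps j 0 Tst \<omega>}))"
    by (simp add: ennreal_suminf_cmult)
  also have "(\<Sum>m. emeasure M {\<omega> \<in> space M. m < njumps j 0 Tst \<omega>}) = (\<Sum>m. \<integral>\<^sup>+ \<omega>. (if m < njumps j 0 Tst \<omega> then 1 else 0) \<partial>M)"
  proof (rule suminf_cong)
    fix m
    have "(\<integral>\<^sup>+ \<omega>. (if m < njumps j 0 Tst \<omega> then 1 else 0) \<partial>M) = (\<integral>\<^sup>+ \<omega>. indicator {\<omega> \<in> space M. m < njumps j 0 Tst \<omega>} \<omega> \<partial>M)"
      by (intro nn_integral_cong) (auto simp: indicator_def)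
    also have "\<dots> = emeasure M {\<omega> \<in> space M. m < njumps j 0 Tst \<omega>}" by (rule nn_integral_indicator) measurable
    finally show "emeasure M {\<omega> \<in> space M. m < njumps j 0 Tst \<omega>} = (\<integral>\<^sup>+ \<omega>. (if m < njumps j 0 Tst \<omega> then 1 else 0) \<partial>M)" ..
  qed
  also have "\<dots> = (\<integral>\<^sup>+ \<omega>. (\<Sum>m. if m < njumps j 0 Tst \<omega> then 1 else 0) \<partial>M)"
    by (intro nn_integral_suminf[symmetric]) measurable
  also have "\<dots> = ennreal (Tst - 0) * emeasure \<nu> {x j}"
    unfolding of_nat_eq_suminf[symmetric] using horizon_pos by (intro nn_integral_njumps) auto
  finally show "(\<integral>\<^sup>+ \<omega>. of_nat (npairs i j \<omega>) \<partial>M) \<le> ennreal (Tst\<^sup>2) * emeasure \<nu> {x i} * emeasure \<nu> {x j}"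
    using horizon_pos by (simp add: power2_eq_square ennreal_mult mult_ac)
qed

text \<open>A pair of jump times is ordered one way, ordered the other way, or lies on the diagonal.
  The diagonal occurs only for \<open>i = j\<close>, as a jump has just one size.\<close>

lemma njumps_mult_le:
  "njumps i 0 Tst \<omega> * njumps j 0 Tst \<omega> \<le> npairs i j \<omega> + npairs j i \<omega> + (if i = j then njumps i 0 Tst \<omega> else 0)"
proof -
  let ?I = "jumps_at i \<omega>" and ?J = "jumps_at j \<omega>"
  have N: "njumps k 0 Tst \<omega> = card (jumps_at k \<omega>)" for k
    unfolding njumps_def using jumps_at_subset[of k \<omega>] by (simp add: Int_absorb2)
  have P: "npairs k l \<omega> = card (SIGMA s:jumps_at k \<omega>. jumps_at l \<omega> \<inter> {..<s})" for k l
    unfolding npairs_def by (simp add: card_SigmaI)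
  have "?I \<times> ?J \<subseteq> (SIGMA s:?I. ?J \<inter> {..<s}) \<union> prod.swap ` (SIGMA s:?J. ?I \<inter> {..<s}) \<union> (\<lambda>s. (s, s)) ` (?I \<inter> ?J)"
  proof
    fix p assume "p \<in> ?I \<times> ?J"
    then obtain s r where p: "p = (s, r)" "s \<in> ?I" "r \<in> ?J" by auto
    consider "r < s" | "s < r" | "r = s" by linarith
    then show "p \<in> (SIGMA s:?I. ?J \<inter> {..<s}) \<union> prod.swap ` (SIGMA s:?J. ?I \<inter> {..<s}) \<union> (\<lambda>s. (s, s)) ` (?I \<inter> ?J)"
      using p by cases (auto simp: image_iff)
  qed
  then have "card (?I \<times> ?J) \<le> card ((SIGMA s:?I. ?J \<inter> {..<s}) \<union> prod.swap ` (SIGMA s:?J. ?I \<inter> {..<s}) \<union> (\<lambda>s. (s, s)) ` (?I \<inter> ?J))"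
    by (rule card_mono[rotated]) auto
  also have "\<dots> \<le> card (SIGMA s:?I. ?J \<inter> {..<s}) + card (prod.swap ` (SIGMA s:?J. ?I \<inter> {..<s})) + card ((\<lambda>s. (s, s)) ` (?I \<inter> ?J))"
    by (meson add_le_mono card_Un_le le_refl order_trans)
  also have "\<dots> \<le> npairs i j \<omega> + npairs j i \<omega> + card (?I \<inter> ?J)"
    unfolding P by (intro add_mono card_image_le) auto
  also have "card (?I \<inter> ?J) = (if i = j then njumps i 0 Tst \<omega> else 0)"
  proof (cases "i = j")
    case False
    then have "x i \<noteq> x j" using inj_x by (auto dest: injD)
    then have "?I \<inter> ?J = {}" by (auto simp: jumps_at_def split: if_splits)
    then show ?thesis using False by simp
  qed (simp add: N)
  finally show ?thesis by (simp add: N card_cartesian_product)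
qed

end

section \<open>A square-integrable martingale with unbounded jumps\<close>

context discrete_levy_noise
begin

definition jump_set :: "'w \<Rightarrow> real set" where
  "jump_set \<omega> = (if \<omega> \<in> regular then {s \<in> {0..Tst}. jump Z s \<omega> \<noteq> 0} else {})"

lemma finite_jump_set [simp]: "finite (jump_set \<omega>)"
  using finite_jumps_regular by (simp add: jump_set_def)

end

locale weighted_jumps = discrete_levy_noise M Tst Z a b W \<nu> x
  for M :: "'w measure" and Tst :: real and Z :: "real \<Rightarrow> 'w \<Rightarrow> real" and a b :: real
    and W :: "real \<Rightarrow> 'w \<Rightarrow> real" and \<nu> :: "real measure" and x :: "nat \<Rightarrow> real" +
  fixes c :: "nat \<Rightarrow> real"
  assumes c_nonneg: "\<And>i. 0 \<le> c i"
    and c_integrable: "(\<Sum>i. ennreal (c i) * emeasure \<nu> {x i}) < \<infinity>"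
    and c_square_integrable: "(\<Sum>i. ennreal ((c i)\<^sup>2) * emeasure \<nu> {x i}) < \<infinity>"
begin

definition weight :: "real \<Rightarrow> real" where
  "weight z = (if z \<in> range x then c (inv x z) else 0)"

definition jump_sum :: "real \<Rightarrow> 'w \<Rightarrow> real" where
  "jump_sum t \<omega> = (\<Sum>s\<in>jump_set \<omega> \<inter> {..t}. weight (jump Z s \<omega>))"

text \<open>An extended nonnegative series over the atoms, so that measurability and expectations
  can be computed term by term; \<open>ennreal_jump_sum\<close> identifies it with the finite sum
  over jump times.\<close>

definition jump_sum_between :: "real \<Rightarrow> real \<Rightarrow> 'w \<Rightarrow> ennreal" where
  "jump_sum_between u v \<omega> = (\<Sum>i. ennreal (c i) * of_nat (njumps i u v \<omega>))"

text \<open>The integral of the weights for \<nu>, i.e. the mean growth of \<open>jump_sum\<close>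
  per unit of time.\<close>

definition rate :: ennreal where
  "rate = (\<Sum>i. ennreal (c i) * emeasure \<nu> {x i})"

definition jump_martingale :: "real \<Rightarrow> 'w \<Rightarrow> real" where
  "jump_martingale t \<omega> = jump_sum t \<omega> - t * enn2real rate"

lemma weight_x [simp]: "weight (x i) = c i"
  using inj_x by (simp add: weight_def)

lemma weight_nonneg: "0 \<le> weight z"
  using c_nonneg by (simp add: weight_def)

lemma jump_sum_nonneg: "0 \<le> jump_sum t \<omega>"
  unfolding jump_sum_def by (intro sum_nonneg weight_nonneg)

lemma rate_finite: "rate < \<infinity>"
  using c_integrable by (simp add: rate_def)

lemma ennreal_weight:
  assumes "z \<in> range x"
  shows "ennreal (weight z) = (\<Sum>i. ennreal (c i) * indicator {x i} z)"
proof -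
  obtain k where k: "z = x k" using assms by blast
  have "(\<lambda>i. ennreal (c i) * indicator {x i} z) = (\<lambda>i. if i = k then ennreal (c i) else 0)"
    using inj_x by (auto simp: k fun_eq_iff indicator_def dest: injD)
  then show ?thesis using sums_single[of k "\<lambda>i. ennreal (c i)"] by (simp add: sums_iff k)
qed

text \<open>Each jump size is exactly one atom, so that the finite sum over jumps and the series
  over atoms can be exchanged; at an outcome off \<open>regular\<close> both sides are
  empty.\<close>

lemma ennreal_jump_sum: "ennreal (jump_sum t \<omega>) = jump_sum_between 0 t \<omega>"
proof (cases "\<omega> \<in> regular")
  case False
  then show ?thesis by (simp add: jump_sum_def jump_sum_between_def jump_set_def njumps_def jumps_at_def)
next
  case True
  let ?J = "jump_set \<omega> \<inter> {..t}"
  have in_range: "jump Z s \<omega> \<in> range x" if "s \<in> ?J" for s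
    using regular(3)[OF True, of s] that True by (auto simp: jump_set_def)
  have "ennreal (jump_sum t \<omega>) = (\<Sum>s\<in>?J. ennreal (weight (jump Z s \<omega>)))"
    unfolding jump_sum_def by (rule sum_ennreal[symmetric]) (rule weight_nonneg)
  also have "\<dots> = (\<Sum>s\<in>?J. \<Sum>i. ennreal (c i) * indicator {x i} (jump Z s \<omega>))"
    by (intro sum.cong refl ennreal_weight in_range)
  also have "\<dots> = (\<Sum>i. \<Sum>s\<in>?J. ennreal (c i) * indicator {x i} (jump Z s \<omega>))"
    by (rule suminf_sum[symmetric]) simp
  also have "\<dots> = (\<Sum>i. ennreal (c i) * of_nat (njumps i 0 t \<omega>))"
  proof (rule suminf_cong)
    fix i
    have "jumps_at i \<omega> \<inter> {0<..t} = {s \<in> ?J. jump Z s \<omega> = x i}"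
    proof (rule set_eqI)
      fix s
      show "s \<in> jumps_at i \<omega> \<inter> {0<..t} \<longleftrightarrow> s \<in> {s \<in> ?J. jump Z s \<omega> = x i}"
        using True x_nonzero[of i] by (cases "s = 0") (auto simp: jump_set_def jumps_at_def)
    qed
    then have "of_nat (njumps i 0 t \<omega>) = (\<Sum>s\<in>?J. indicator {x i} (jump Z s \<omega>) :: ennreal)"
      unfolding njumps_def by (simp add: indicator_def sum.If_cases Int_def)
    then show "(\<Sum>s\<in>?J. ennreal (c i) * indicator {x i} (jump Z s \<omega>)) = ennreal (c i) * of_nat (njumps i 0 t \<omega>)"
      by (simp add: sum_distrib_left)
  qed
  finally show ?thesis unfolding jump_sum_between_def .
qed

lemma jump_sum_eq: "jump_sum t = (\<lambda>\<omega>. enn2real (jump_sum_between 0 t \<omega>))"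
  by (rule ext) (simp add: ennreal_jump_sum[symmetric] jump_sum_nonneg)

lemma jump_sum_between_add:
  assumes "0 \<le> u" "u \<le> v"
  shows "jump_sum_between 0 v \<omega> = jump_sum_between 0 u \<omega> + jump_sum_between u v \<omega>"
  unfolding jump_sum_between_def
  by (subst suminf_add) (auto simp: njumps_add[OF assms] distrib_left)

lemma jump_sum_between_measurable:
  assumes "0 \<le> u" "u \<le> v" "v \<le> Tst"
  shows "jump_sum_between u v \<in> borel_measurable (F v)"
proof -
  have [measurable]: "njumps i u v \<in> measurable (F v) (count_space UNIV)" for i
    using assms by (rule njumps_measurable_F)
  show ?thesis unfolding jump_sum_between_def by measurable
qed

lemma jump_sum_measurable_F:
  assumes "0 \<le> t" "t \<le> Tst"
  shows "jump_sum t \<in> borel_measurable (F t)"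
proof -
  have [measurable]: "jump_sum_between 0 t \<in> borel_measurable (F t)"
    using assms by (intro jump_sum_between_measurable) auto
  show ?thesis unfolding jump_sum_eq by measurable
qed

lemma nn_integral_jump_sum_between:
  assumes uv: "0 \<le> u" "u < v" "v \<le> Tst" and A: "A \<in> sets (F u)"
  shows "(\<integral>\<^sup>+ \<omega>. indicator A \<omega> * jump_sum_between u v \<omega> \<partial>M) = emeasure M A * (ennreal (v - u) * rate)"
proof -
  have [measurable]: "A \<in> sets M" using sets_F_sub[OF A] .
  have [measurable]: "njumps i u v \<in> measurable M (count_space UNIV)" for i
    using uv by (intro njumps_measurable) auto
  have "(\<integral>\<^sup>+ \<omega>. indicator A \<omega> * jump_sum_between u v \<omega> \<partial>M)
      = (\<integral>\<^sup>+ \<omega>. (\<Sum>i. ennreal (c i) * (indicator A \<omega> * of_nat (njumps i u v \<omega>))) \<partial>M)"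
    unfolding jump_sum_between_def by (subst ennreal_suminf_cmult[symmetric]) (simp add: mult_ac)
  also have "\<dots> = (\<Sum>i. \<integral>\<^sup>+ \<omega>. ennreal (c i) * (indicator A \<omega> * of_nat (njumps i u v \<omega>)) \<partial>M)"
    by (intro nn_integral_suminf) measurable
  also have "\<dots> = (\<Sum>i. ennreal (c i) * (emeasure M A * (ennreal (v - u) * emeasure \<nu> {x i})))"
    by (subst nn_integral_cmult) (auto simp: nn_integral_njumps_indep[OF uv A])
  also have "\<dots> = (\<Sum>i. (emeasure M A * ennreal (v - u)) * (ennreal (c i) * emeasure \<nu> {x i}))"
    by (simp add: mult_ac)
  also have "\<dots> = (emeasure M A * ennreal (v - u)) * rate"
    unfolding rate_def by (rule ennreal_suminf_cmult)
  finally show ?thesis by (simp add: mult_ac)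
qed

lemma jump_sum_increment:
  assumes "0 \<le> u" "u \<le> v"
  shows "ennreal (jump_sum v \<omega> - jump_sum u \<omega>) = jump_sum_between u v \<omega>" "jump_sum u \<omega> \<le> jump_sum v \<omega>"
proof -
  have eq: "ennreal (jump_sum v \<omega>) = ennreal (jump_sum u \<omega>) + jump_sum_between u v \<omega>"
    unfolding ennreal_jump_sum by (rule jump_sum_between_add[OF assms])
  then have "ennreal (jump_sum u \<omega>) \<le> ennreal (jump_sum v \<omega>)" by simp
  then show le: "jump_sum u \<omega> \<le> jump_sum v \<omega>" by (simp add: jump_sum_nonneg)
  have "ennreal (jump_sum v \<omega> - jump_sum u \<omega>) = ennreal (jump_sum v \<omega>) - ennreal (jump_sum u \<omega>)"
    by (rule ennreal_minus[symmetric]) (rule jump_sum_nonneg)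
  then show "ennreal (jump_sum v \<omega> - jump_sum u \<omega>) = jump_sum_between u v \<omega>"
    unfolding eq by simp
qed

lemma integrable_jump_sum:
  assumes "0 \<le> t" "t \<le> Tst"
  shows "integrable M (jump_sum t)"
proof (cases "t = 0")
  case True
  have "njumps i 0 0 \<omega> = 0" for i \<omega> by (simp add: njumps_def)
  then have "jump_sum 0 = (\<lambda>_. 0)" unfolding jump_sum_eq by (simp add: jump_sum_between_def)
  then show ?thesis using True by simp
next
  case False
  have "space M \<in> sets (F 0)" using sets.top[of "F 0"] by simp
  then have "(\<integral>\<^sup>+ \<omega>. indicator (space M) \<omega> * jump_sum_between 0 t \<omega> \<partial>M) = emeasure M (space M) * (ennreal (t - 0) * rate)"
    using False assms by (intro nn_integral_jump_sum_between) auto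
  also have "(\<integral>\<^sup>+ \<omega>. indicator (space M) \<omega> * jump_sum_between 0 t \<omega> \<partial>M) = (\<integral>\<^sup>+ \<omega>. ennreal (jump_sum t \<omega>) \<partial>M)"
    unfolding ennreal_jump_sum by (intro nn_integral_cong) auto
  finally have "(\<integral>\<^sup>+ \<omega>. ennreal (jump_sum t \<omega>) \<partial>M) < \<infinity>"
    using rate_finite by (simp add: emeasure_space_1 ennreal_mult_less_top)
  then show ?thesis
    using measurable_F_sub[OF jump_sum_measurable_F[OF assms]] jump_sum_nonneg
    by (intro integrableI_nonneg) auto
qed

lemma integral_jump_martingale_increment:
  assumes uv: "0 \<le> u" "u < v" "v \<le> Tst" and A: "A \<in> sets (F u)"
  shows "(\<integral>\<omega>. indicator A \<omega> * (jump_sum v \<omega> - jump_sum u \<omega>) \<partial>M) = prob A * ((v - u) * enn2real rate)"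
proof -
  have [measurable]: "A \<in> sets M" using sets_F_sub[OF A] .
  have [measurable]: "jump_sum u \<in> borel_measurable M" "jump_sum v \<in> borel_measurable M"
    using uv by (auto intro!: borel_measurable_integrable integrable_jump_sum)
  have "(\<integral>\<omega>. indicator A \<omega> * (jump_sum v \<omega> - jump_sum u \<omega>) \<partial>M)
     = enn2real (\<integral>\<^sup>+\<omega>. ennreal (indicator A \<omega> * (jump_sum v \<omega> - jump_sum u \<omega>)) \<partial>M)"
    using jump_sum_increment(2)[of u v] uv by (intro integral_eq_nn_integral) (auto simp: indicator_def)
  also have "(\<integral>\<^sup>+\<omega>. ennreal (indicator A \<omega> * (jump_sum v \<omega> - jump_sum u \<omega>)) \<partial>M)
     = (\<integral>\<^sup>+\<omega>. indicator A \<omega> * jump_sum_between u v \<omega> \<partial>M)"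
    using jump_sum_increment(1)[of u v] uv by (intro nn_integral_cong) (auto simp: indicator_def)
  also have "\<dots> = emeasure M A * (ennreal (v - u) * rate)" by (rule nn_integral_jump_sum_between[OF uv A])
  finally show ?thesis using uv by (simp add: enn2real_mult emeasure_eq_measure)
qed

lemma sigma_finite_F: "sigma_finite_subalgebra M (F t)"
proof -
  interpret finite_measure_subalgebra M "F t"
    by unfold_locales (rule subalgebra_F)
  show ?thesis by (rule sigma_finite_subalgebra_axioms)
qed

text \<open>By \<open>integral_jump_martingale_increment\<close>, the subtracted drift is the mean
  increment on every event of the past. The shift \<open>d\<close> will be the initial capital of a
  replicating strategy.\<close>

lemma cond_exp_jump_martingale:
  assumes uv: "0 \<le> u" "u \<le> v" "v \<le> Tst"
  shows "AE \<omega> in M. real_cond_exp M (F u) (\<lambda>\<omega>. jump_martingale v \<omega> - d) \<omega> = jump_martingale u \<omega> - d"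
proof -
  interpret S: sigma_finite_subalgebra M "F u" by (rule sigma_finite_F)
  have int: "integrable M (jump_sum u)" "integrable M (jump_sum v)"
    using uv by (auto intro!: integrable_jump_sum)
  have int': "integrable M (\<lambda>\<omega>. jump_martingale v \<omega> - d)" "integrable M (\<lambda>\<omega>. jump_martingale u \<omega> - d)"
    unfolding jump_martingale_def using int by auto
  have [measurable]: "jump_sum u \<in> borel_measurable (F u)"
    using uv by (intro jump_sum_measurable_F) auto
  show ?thesis
  proof (rule S.real_cond_exp_charact)
    show "(\<lambda>\<omega>. jump_martingale u \<omega> - d) \<in> borel_measurable (F u)"
      unfolding jump_martingale_def by measurable
    fix A assume A: "A \<in> sets (F u)"
    then have A': "A \<in> sets M" by (rule sets_F_sub)
    show "(\<integral>\<omega>\<in>A. (jump_martingale v \<omega> - d) \<partial>M) = (\<integral>\<omega>\<in>A. (jump_martingale u \<omega> - d) \<partial>M)"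
    proof (cases "u = v")
      case False
      have int_A: "integrable M (\<lambda>\<omega>. indicator A \<omega> * h \<omega>)" if "integrable M h" for h :: "'w \<Rightarrow> real"
        using integrable_mult_indicator[OF A' that] by simp
      have "(\<integral>\<omega>\<in>A. (jump_martingale v \<omega> - d) \<partial>M) - (\<integral>\<omega>\<in>A. (jump_martingale u \<omega> - d) \<partial>M)
        = (\<integral>\<omega>. indicator A \<omega> * (jump_martingale v \<omega> - d) - indicator A \<omega> * (jump_martingale u \<omega> - d) \<partial>M)"
        unfolding set_lebesgue_integral_def using int_A[OF int'(1)] int_A[OF int'(2)] by simp
      also have "\<dots> = (\<integral>\<omega>. indicator A \<omega> * (jump_sum v \<omega> - jump_sum u \<omega>) - indicator A \<omega> * ((v - u) * enn2real rate) \<partial>M)"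
        by (intro Bochner_Integration.integral_cong) (auto simp: jump_martingale_def algebra_simps)
      also have "\<dots> = (\<integral>\<omega>. indicator A \<omega> * (jump_sum v \<omega> - jump_sum u \<omega>) \<partial>M) - (\<integral>\<omega>. indicator A \<omega> * ((v - u) * enn2real rate) \<partial>M)"
        using int by (intro Bochner_Integration.integral_diff int_A) auto
      also have "\<dots> = 0"
        using integral_jump_martingale_increment[of u v A] uv False A A' by simp
      finally show ?thesis by simp
    qed simp
  qed (use int' in auto)
qed

text \<open>Expanding the square gives a double series over the atoms. Pairs of distinct jumps
  contribute at most a multiple of the square of \<open>rate\<close>, coinciding jumps at most a
  multiple of the series in \<open>c_square_integrable\<close>; here both summability conditions on
  the weights enter.\<close>

lemma jump_sum_square_integrable: "integrable M (\<lambda>\<omega>. (jump_sum Tst \<omega>)\<^sup>2)"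
proof -
  have T: "0 \<le> Tst" using horizon_pos by simp
  define N where "N i \<omega> = njumps i 0 Tst \<omega>" for i \<omega>
  define p where "p i = emeasure \<nu> {x i}" for i
  have [measurable]: "N i \<in> measurable M (count_space UNIV)" for i
    unfolding N_def using T by (intro njumps_measurable) auto
  note [measurable] = npairs_expectation(1)
  \<comment> \<open>The two orders of a pair account for the factor 2, coinciding jumps for the last
    term.\<close>
  have cc: "(\<integral>\<^sup>+ \<omega>. of_nat (N i \<omega> * N j \<omega>) \<partial>M) \<le> 2 * ennreal (Tst\<^sup>2) * (p i * p j) + (if i = j then ennreal Tst * p i else 0)" for i j
  proof -
    have "(\<integral>\<^sup>+ \<omega>. of_nat (N i \<omega> * N j \<omega>) \<partial>M)
      \<le> (\<integral>\<^sup>+ \<omega>. of_nat (npairs i j \<omega>) + of_nat (npairs j i \<omega>) + of_nat (if i = j then N i \<omega> else 0) \<partial>M)"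
      unfolding of_nat_add[symmetric] N_def by (intro nn_integral_mono of_nat_mono njumps_mult_le)
    also have "\<dots> = (\<integral>\<^sup>+ \<omega>. of_nat (npairs i j \<omega>) \<partial>M) + (\<integral>\<^sup>+ \<omega>. of_nat (npairs j i \<omega>) \<partial>M)
        + (\<integral>\<^sup>+ \<omega>. of_nat (if i = j then N i \<omega> else 0) \<partial>M)"
      by (subst nn_integral_add; (subst nn_integral_add)?; measurable)
    also have "(\<integral>\<^sup>+ \<omega>. of_nat (if i = j then N i \<omega> else 0) \<partial>M) = (if i = j then ennreal (Tst - 0) * p i else 0)"
      using nn_integral_njumps[of 0 Tst i] T by (cases "i = j") (auto simp: N_def p_def)
    also have "(\<integral>\<^sup>+ \<omega>. of_nat (npairs i j \<omega>) \<partial>M) + (\<integral>\<^sup>+ \<omega>. of_nat (npairs j i \<omega>) \<partial>M) + (if i = j then ennreal (Tst - 0) * p i else 0)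
       \<le> ennreal (Tst\<^sup>2) * p i * p j + ennreal (Tst\<^sup>2) * p j * p i + (if i = j then ennreal (Tst - 0) * p i else 0)"
      unfolding p_def by (intro add_mono npairs_expectation order_refl)
    also have "ennreal (Tst\<^sup>2) * p i * p j + ennreal (Tst\<^sup>2) * p j * p i = 2 * ennreal (Tst\<^sup>2) * (p i * p j)"
      by (simp add: mult_2 mult_ac distrib_left distrib_right flip: mult_2)
    finally show ?thesis by (simp only: diff_zero)
  qed
  have "(\<integral>\<^sup>+ \<omega>. ennreal ((jump_sum Tst \<omega>)\<^sup>2) \<partial>M) = (\<integral>\<^sup>+ \<omega>. jump_sum_between 0 Tst \<omega> * jump_sum_between 0 Tst \<omega> \<partial>M)"
    by (simp add: ennreal_jump_sum[symmetric] power2_eq_square ennreal_mult jump_sum_nonneg)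
  also have "\<dots> = (\<integral>\<^sup>+ \<omega>. (\<Sum>i. \<Sum>j. ennreal (c i) * (ennreal (c j) * of_nat (N i \<omega> * N j \<omega>))) \<partial>M)"
  proof (intro nn_integral_cong)
    fix \<omega>
    have "jump_sum_between 0 Tst \<omega> * jump_sum_between 0 Tst \<omega>
      = (\<Sum>i. ennreal (c i) * of_nat (N i \<omega>) * jump_sum_between 0 Tst \<omega>)"
      unfolding N_def by (subst (1) jump_sum_between_def) (rule ennreal_suminf_multc[symmetric])
    also have "\<dots> = (\<Sum>i. \<Sum>j. ennreal (c i) * of_nat (N i \<omega>) * (ennreal (c j) * of_nat (N j \<omega>)))"
      unfolding jump_sum_between_def N_def ennreal_suminf_cmult ..
    finally show "jump_sum_between 0 Tst \<omega> * jump_sum_between 0 Tst \<omega>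
      = (\<Sum>i. \<Sum>j. ennreal (c i) * (ennreal (c j) * of_nat (N i \<omega> * N j \<omega>)))"
      by (simp add: mult_ac)
  qed
  also have "\<dots> = (\<Sum>i. \<Sum>j. ennreal (c i) * (ennreal (c j) * (\<integral>\<^sup>+ \<omega>. of_nat (N i \<omega> * N j \<omega>) \<partial>M)))"
  proof (subst nn_integral_suminf)
    show "(\<Sum>i. \<integral>\<^sup>+ \<omega>. (\<Sum>j. ennreal (c i) * (ennreal (c j) * of_nat (N i \<omega> * N j \<omega>))) \<partial>M)
      = (\<Sum>i. \<Sum>j. ennreal (c i) * (ennreal (c j) * (\<integral>\<^sup>+ \<omega>. of_nat (N i \<omega> * N j \<omega>) \<partial>M)))"
      by (intro suminf_cong, subst nn_integral_suminf, measurable) (simp add: nn_integral_cmult)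
  qed measurable
  also have "\<dots> \<le> (\<Sum>i. \<Sum>j. ennreal (c i) * (ennreal (c j) * (2 * ennreal (Tst\<^sup>2) * (p i * p j) + (if i = j then ennreal Tst * p i else 0))))"
    by (intro suminf_le mult_left_mono cc) auto
  also have "\<dots> = (\<Sum>i. 2 * ennreal (Tst\<^sup>2) * rate * (ennreal (c i) * p i) + ennreal Tst * (ennreal ((c i)\<^sup>2) * p i))"
  proof (rule suminf_cong)
    fix i
    have diag: "(\<Sum>j. ennreal (c i) * (ennreal (c j) * (if i = j then ennreal Tst * p i else 0))) = ennreal Tst * (ennreal ((c i)\<^sup>2) * p i)"
    proof -
      have "(\<lambda>j. ennreal (c i) * (ennreal (c j) * (if i = j then ennreal Tst * p i else 0)))
        = (\<lambda>j. if j = i then ennreal Tst * (ennreal ((c j)\<^sup>2) * p j) else 0)"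
        by (auto simp: fun_eq_iff power2_eq_square ennreal_mult c_nonneg mult_ac)
      then show ?thesis using sums_single[of i "\<lambda>j. ennreal Tst * (ennreal ((c j)\<^sup>2) * p j)"] by (simp add: sums_iff)
    qed
    have "(\<Sum>j. ennreal (c i) * (ennreal (c j) * (2 * ennreal (Tst\<^sup>2) * (p i * p j) + (if i = j then ennreal Tst * p i else 0))))
      = (\<Sum>j. 2 * ennreal (Tst\<^sup>2) * (ennreal (c i) * p i) * (ennreal (c j) * p j) + ennreal (c i) * (ennreal (c j) * (if i = j then ennreal Tst * p i else 0)))"
      by (intro suminf_cong) (simp add: distrib_left mult_ac)
    also have "\<dots> = (\<Sum>j. 2 * ennreal (Tst\<^sup>2) * (ennreal (c i) * p i) * (ennreal (c j) * p j)) + ennreal Tst * (ennreal ((c i)\<^sup>2) * p i)"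
      unfolding diag[symmetric] by (rule suminf_add[symmetric]) auto
    also have "(\<Sum>j. 2 * ennreal (Tst\<^sup>2) * (ennreal (c i) * p i) * (ennreal (c j) * p j)) = 2 * ennreal (Tst\<^sup>2) * (ennreal (c i) * p i) * rate"
      unfolding rate_def p_def by (rule ennreal_suminf_cmult)
    finally show "(\<Sum>j. ennreal (c i) * (ennreal (c j) * (2 * ennreal (Tst\<^sup>2) * (p i * p j) + (if i = j then ennreal Tst * p i else 0))))
      = 2 * ennreal (Tst\<^sup>2) * rate * (ennreal (c i) * p i) + ennreal Tst * (ennreal ((c i)\<^sup>2) * p i)"
      by (simp add: mult_ac)
  qed
  also have "\<dots> = (\<Sum>i. 2 * ennreal (Tst\<^sup>2) * rate * (ennreal (c i) * p i)) + (\<Sum>i. ennreal Tst * (ennreal ((c i)\<^sup>2) * p i))"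
    by (rule suminf_add[symmetric]) auto
  also have "\<dots> = 2 * ennreal (Tst\<^sup>2) * rate * rate + ennreal Tst * (\<Sum>i. ennreal ((c i)\<^sup>2) * p i)"
    unfolding ennreal_suminf_cmult by (simp add: rate_def p_def)
  also have "\<dots> < \<infinity>"
    using rate_finite c_square_integrable by (simp add: p_def ennreal_mult_less_top)
  finally have "(\<integral>\<^sup>+ \<omega>. ennreal ((jump_sum Tst \<omega>)\<^sup>2) \<partial>M) < \<infinity>" .
  moreover have "jump_sum Tst \<in> borel_measurable M"
    using T by (intro borel_measurable_integrable integrable_jump_sum) auto
  ultimately show ?thesis by (intro integrableI_nonneg) auto
qed

lemma jump_martingale_square_integrable: "integrable M (\<lambda>\<omega>. (jump_martingale Tst \<omega>)\<^sup>2)"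
  unfolding jump_martingale_def power2_diff
  using jump_sum_square_integrable integrable_jump_sum[of Tst] horizon_pos by simp

lemma jump_martingale_measurable_F:
  assumes "0 \<le> t" "t \<le> Tst"
  shows "jump_martingale t \<in> borel_measurable (F t)"
  using jump_sum_measurable_F[OF assms] unfolding jump_martingale_def by measurable

lemma jump_martingale_left_limit:
  "((\<lambda>t. jump_martingale t \<omega>) \<longlongrightarrow>
     jump_martingale s \<omega> - (if s \<in> jump_set \<omega> then weight (jump Z s \<omega>) else 0)) (at_left s)"
proof -
  have "((\<lambda>t. jump_martingale t \<omega>) \<longlongrightarrow> (\<Sum>r\<in>jump_set \<omega> \<inter> {..<s}. weight (jump Z r \<omega>)) - s * enn2real rate) (at_left s)"
    unfolding jump_martingale_def jump_sum_def by (intro tendsto_intros step_function_at_left) simp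
  moreover have "(\<Sum>r\<in>jump_set \<omega> \<inter> {..<s}. weight (jump Z r \<omega>)) = jump_sum s \<omega> - (if s \<in> jump_set \<omega> then weight (jump Z s \<omega>) else 0)"
    using step_function_jump[OF finite_jump_set, of "\<lambda>s. weight (jump Z s \<omega>)" \<omega> s] unfolding jump_sum_def by linarith
  ultimately show ?thesis by (simp add: jump_martingale_def algebra_simps)
qed

lemma jump_martingale_right_continuous:
  "((\<lambda>t. jump_martingale t \<omega>) \<longlongrightarrow> jump_martingale s \<omega>) (at_right s)"
  unfolding jump_martingale_def jump_sum_def by (intro tendsto_intros step_function_at_right) simp

end

section \<open>Integrals of simple processes over a grid\<close>

context levy_noise
begin

lemma W_measurable_F:
  assumes W: "wiener_process M Tst F W" and t: "0 \<le> s" "s \<le> t" "s \<le> Tst"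
  shows "W s \<in> borel_measurable (F t)"
  using W t unfolding wiener_process_def adapted_def by (auto intro: measurable_F_mono[OF t(2)])

lemma wiener_increment:
  assumes W: "wiener_process M Tst F W" and st: "0 \<le> s" "s < t" "t \<le> Tst"
  shows "integrable M (\<lambda>\<omega>. W t \<omega> - W s \<omega>)" "expectation (\<lambda>\<omega>. W t \<omega> - W s \<omega>) = 0"
    "integrable M (\<lambda>\<omega>. (W t \<omega> - W s \<omega>)\<^sup>2)" "expectation (\<lambda>\<omega>. (W t \<omega> - W s \<omega>)\<^sup>2) = t - s"
proof -
  let ?\<sigma> = "sqrt (t - s)"
  have \<sigma>: "0 < ?\<sigma>" using st by simp
  have D: "distributed M lborel (\<lambda>\<omega>. W t \<omega> - W s \<omega>) (normal_density 0 ?\<sigma>)"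
    using W st unfolding wiener_process_def by auto
  have int: "integrable M (\<lambda>\<omega>. (W t \<omega> - W s \<omega>) ^ k)" for k
  proof -
    have "integrable lborel (\<lambda>x. normal_density 0 ?\<sigma> x * x ^ k)"
      using integrable_normal_moment[where \<mu> = 0, OF \<sigma>, of k] by (simp only: diff_zero)
    then show ?thesis using distributed_integrable[OF D, of "\<lambda>x. x ^ k"] by simp
  qed
  show "integrable M (\<lambda>\<omega>. W t \<omega> - W s \<omega>)" using int[of 1] by simp
  show "integrable M (\<lambda>\<omega>. (W t \<omega> - W s \<omega>)\<^sup>2)" by (rule int)
  show E: "expectation (\<lambda>\<omega>. W t \<omega> - W s \<omega>) = 0" by (rule normal_distributed_expectation[OF \<sigma> D])
  show "expectation (\<lambda>\<omega>. (W t \<omega> - W s \<omega>)\<^sup>2) = t - s"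
    using normal_distributed_variance[OF \<sigma> D] st unfolding E by simp
qed

text \<open>The independence in \<open>wiener_process\<close> concerns families of preimages. They
  are intersection stable, so that it extends to the sigma-algebras they generate.\<close>

lemma wiener_increment_indep:
  assumes W: "wiener_process M Tst F W" and st: "0 \<le> s" "s < t" "t \<le> Tst"
    and g: "g \<in> borel_measurable (F s)"
  shows "indep_var borel g borel (\<lambda>\<omega>. W t \<omega> - W s \<omega>)"
proof -
  let ?D = "\<lambda>\<omega>. W t \<omega> - W s \<omega>"
  have ind: "indep_set (sets (F s)) {?D -` A \<inter> space M | A. A \<in> sets borel}"
    using W st unfolding wiener_process_def indep_of_def by auto
  have D: "?D \<in> borel_measurable M"
    using wiener_increment(1)[OF W st] by (rule borel_measurable_integrable)
  have g': "g \<in> borel_measurable M" using g by (rule measurable_F_sub)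
  have "indep_set {g -` A \<inter> space M | A. A \<in> sets borel} {?D -` A \<inter> space M | A. A \<in> sets borel}"
  proof (rule indep_setI)
    show "{g -` A \<inter> space M | A. A \<in> sets borel} \<subseteq> events" using measurable_sets[OF g'] by auto
    show "{?D -` A \<inter> space M | A. A \<in> sets borel} \<subseteq> events" using measurable_sets[OF D] by auto
    fix A B assume A: "A \<in> {g -` A \<inter> space M | A. A \<in> sets borel}" and B: "B \<in> {?D -` A \<inter> space M | A. A \<in> sets borel}"
    have "A \<in> sets (F s)" using A measurable_sets[OF g] by auto
    then show "prob (A \<inter> B) = prob A * prob B" using B by (rule indep_setD[OF ind])
  qed
  moreover have "Int_stable {h -` A \<inter> space M | A. A \<in> sets borel}" for h :: "'w \<Rightarrow> real"
  proof (rule Int_stableI)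
    fix P Q assume "P \<in> {h -` A \<inter> space M | A. A \<in> sets borel}" "Q \<in> {h -` A \<inter> space M | A. A \<in> sets borel}"
    then obtain A B where "P = h -` A \<inter> space M" "A \<in> sets borel" "Q = h -` B \<inter> space M" "B \<in> sets borel" by auto
    then have "P \<inter> Q = h -` (A \<inter> B) \<inter> space M" "A \<inter> B \<in> sets borel" by auto
    then show "P \<inter> Q \<in> {h -` A \<inter> space M | A. A \<in> sets borel}" by blast
  qed
  ultimately show ?thesis
    unfolding indep_var_eq using g' D by (auto intro: indep_set_sigma_sets)
qed

lemma wiener_increment_mult:
  assumes W: "wiener_process M Tst F W" and st: "0 \<le> s" "s < t" "t \<le> Tst"
    and g: "g \<in> borel_measurable (F s)" "integrable M g"
  shows "integrable M (\<lambda>\<omega>. g \<omega> * (W t \<omega> - W s \<omega>))" "expectation (\<lambda>\<omega>. g \<omega> * (W t \<omega> - W s \<omega>)) = 0"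
    "integrable M (\<lambda>\<omega>. g \<omega> * (W t \<omega> - W s \<omega>)\<^sup>2)"
    "expectation (\<lambda>\<omega>. g \<omega> * (W t \<omega> - W s \<omega>)\<^sup>2) = expectation g * (t - s)"
proof -
  have ind: "indep_var borel g borel (\<lambda>\<omega>. W t \<omega> - W s \<omega>)"
    by (rule wiener_increment_indep[OF W st g(1)])
  have "indep_var borel ((\<lambda>y. y) \<circ> g) borel ((\<lambda>y. y\<^sup>2) \<circ> (\<lambda>\<omega>. W t \<omega> - W s \<omega>))"
    by (rule indep_var_compose[OF ind]) measurable
  then have ind2: "indep_var borel g borel (\<lambda>\<omega>. (W t \<omega> - W s \<omega>)\<^sup>2)" by (simp add: comp_def)
  note w = wiener_increment[OF W st]
  show "integrable M (\<lambda>\<omega>. g \<omega> * (W t \<omega> - W s \<omega>))"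
    using indep_var_integrable[OF ind g(2) w(1)] .
  show "expectation (\<lambda>\<omega>. g \<omega> * (W t \<omega> - W s \<omega>)) = 0"
    using indep_var_lebesgue_integral[OF ind g(2) w(1)] w(2) by simp
  show "integrable M (\<lambda>\<omega>. g \<omega> * (W t \<omega> - W s \<omega>)\<^sup>2)"
    using indep_var_integrable[OF ind2 g(2) w(3)] .
  show "expectation (\<lambda>\<omega>. g \<omega> * (W t \<omega> - W s \<omega>)\<^sup>2) = expectation g * (t - s)"
    using indep_var_lebesgue_integral[OF ind2 g(2) w(3)] w(4) by simp
qed

definition grid_integral :: "(nat \<Rightarrow> real) \<Rightarrow> (nat \<Rightarrow> 'w \<Rightarrow> real) \<Rightarrow> nat \<Rightarrow> 'w \<Rightarrow> real" where
  "grid_integral \<rho> h k \<omega> = (\<Sum>l<k. h l \<omega> * (W (\<rho> (Suc l)) \<omega> - W (\<rho> l) \<omega>))"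

text \<open>The cross term vanishes: the integral so far times the next coefficient is known at the
  left grid point, and the Wiener increment is centred and independent of it. Boundedness of the
  coefficients supplies the integrability.\<close>

lemma grid_ito_isometry:
  assumes W: "wiener_process M Tst F W"
    and \<rho>: "0 \<le> \<rho> 0" "\<And>l. l < N \<Longrightarrow> \<rho> l < \<rho> (Suc l)" "\<And>l. l \<le> N \<Longrightarrow> \<rho> l \<le> Tst"
    and h: "\<And>l. l < N \<Longrightarrow> h l \<in> borel_measurable (F (\<rho> l))"
      "\<And>l. l < N \<Longrightarrow> \<exists>C. \<forall>\<omega>\<in>space M. \<bar>h l \<omega>\<bar> \<le> C"
    and k: "k \<le> N"
  shows "0 \<le> \<rho> k \<and> grid_integral \<rho> h k \<in> borel_measurable (F (\<rho> k)) \<and>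
    integrable M (\<lambda>\<omega>. (grid_integral \<rho> h k \<omega>)\<^sup>2) \<and>
    expectation (\<lambda>\<omega>. (grid_integral \<rho> h k \<omega>)\<^sup>2) = (\<Sum>l<k. expectation (\<lambda>\<omega>. (h l \<omega>)\<^sup>2) * (\<rho> (Suc l) - \<rho> l))"
  using k
proof (induction k)
  case 0
  then show ?case using \<rho>(1) by (simp add: grid_integral_def)
next
  case (Suc k)
  then have k: "k < N" and IH: "0 \<le> \<rho> k" "grid_integral \<rho> h k \<in> borel_measurable (F (\<rho> k))"
    "integrable M (\<lambda>\<omega>. (grid_integral \<rho> h k \<omega>)\<^sup>2)"
    "expectation (\<lambda>\<omega>. (grid_integral \<rho> h k \<omega>)\<^sup>2) = (\<Sum>l<k. expectation (\<lambda>\<omega>. (h l \<omega>)\<^sup>2) * (\<rho> (Suc l) - \<rho> l))"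
    by auto
  note st = IH(1) \<rho>(2)[OF k] \<rho>(3)[OF Suc.prems]
  define I where "I = grid_integral \<rho> h k"
  define D where "D \<omega> = W (\<rho> (Suc k)) \<omega> - W (\<rho> k) \<omega>" for \<omega>
  have I_Suc: "grid_integral \<rho> h (Suc k) \<omega> = I \<omega> + h k \<omega> * D \<omega>" for \<omega>
    by (simp add: grid_integral_def I_def D_def)
  have I_k [measurable]: "I \<in> borel_measurable (F (\<rho> k))" using IH(2) by (simp add: I_def)
  have h_k [measurable]: "h k \<in> borel_measurable (F (\<rho> k))" by (rule h(1)[OF k])
  have I_sq: "integrable M (\<lambda>\<omega>. (I \<omega>)\<^sup>2)" using IH(3) by (simp add: I_def)
  have [measurable]: "I \<in> borel_measurable M" "h k \<in> borel_measurable M"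
    using measurable_F_sub[OF I_k] measurable_F_sub[OF h_k] by auto
  obtain C where C: "\<And>\<omega>. \<omega> \<in> space M \<Longrightarrow> \<bar>h k \<omega>\<bar> \<le> C" using h(2)[OF k] by blast
  have I_int: "integrable M I" by (rule square_integrable_imp_integrable) (use I_sq in auto)
  have h_sq: "integrable M (\<lambda>\<omega>. (h k \<omega>)\<^sup>2)"
  proof (rule integrable_const_bound[where B = "C\<^sup>2"])
    show "AE \<omega> in M. norm ((h k \<omega>)\<^sup>2) \<le> C\<^sup>2"
      using C by (intro AE_I2) (metis norm_power power_mono real_norm_def abs_ge_zero power_abs abs_power2)
  qed measurable
  have Ih: "integrable M (\<lambda>\<omega>. I \<omega> * h k \<omega>)"
  proof (rule Bochner_Integration.integrable_bound[OF integrable_mult_right[OF I_int, of C]])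
    show "AE \<omega> in M. norm (I \<omega> * h k \<omega>) \<le> norm (C * I \<omega>)"
    proof (rule AE_I2)
      fix \<omega> assume "\<omega> \<in> space M"
      from C[OF this] have "\<bar>h k \<omega>\<bar> \<le> \<bar>C\<bar>" by linarith
      then show "norm (I \<omega> * h k \<omega>) \<le> norm (C * I \<omega>)"
        by (simp add: abs_mult mult.commute[of "\<bar>C\<bar>"] mult_left_mono)
    qed
  qed measurable
  have "(\<lambda>\<omega>. I \<omega> * h k \<omega>) \<in> borel_measurable (F (\<rho> k))" by measurable
  note cross = wiener_increment_mult[OF W st this Ih, folded D_def]
  have "(\<lambda>\<omega>. (h k \<omega>)\<^sup>2) \<in> borel_measurable (F (\<rho> k))" by measurable
  note quad = wiener_increment_mult[OF W st this h_sq, folded D_def]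
  have expand: "(grid_integral \<rho> h (Suc k) \<omega>)\<^sup>2 = (I \<omega>)\<^sup>2 + 2 * (I \<omega> * h k \<omega> * D \<omega>) + (h k \<omega>)\<^sup>2 * (D \<omega>)\<^sup>2" for \<omega>
    unfolding I_Suc by (simp add: power2_eq_square algebra_simps)
  have "integrable M (\<lambda>\<omega>. (grid_integral \<rho> h (Suc k) \<omega>)\<^sup>2)"
    unfolding expand using I_sq cross(1) quad(3) by auto
  moreover have "expectation (\<lambda>\<omega>. (grid_integral \<rho> h (Suc k) \<omega>)\<^sup>2)
      = expectation (\<lambda>\<omega>. (I \<omega>)\<^sup>2) + expectation (\<lambda>\<omega>. (h k \<omega>)\<^sup>2) * (\<rho> (Suc k) - \<rho> k)"
    unfolding expand using I_sq cross(1,2) quad(3,4) by simp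
  moreover have "(\<lambda>\<omega>. I \<omega> + h k \<omega> * D \<omega>) \<in> borel_measurable (F (\<rho> (Suc k)))"
  proof -
    have [measurable]: "W (\<rho> (Suc k)) \<in> borel_measurable (F (\<rho> (Suc k)))" "W (\<rho> k) \<in> borel_measurable (F (\<rho> (Suc k)))"
      using st by (auto intro!: W_measurable_F[OF W])
    have [measurable]: "I \<in> borel_measurable (F (\<rho> (Suc k)))" "h k \<in> borel_measurable (F (\<rho> (Suc k)))"
      using measurable_F_mono[OF less_imp_le[OF st(2)] I_k] measurable_F_mono[OF less_imp_le[OF st(2)] h_k] by auto
    show ?thesis unfolding D_def by measurable
  qed
  ultimately show ?case using st IH(4) unfolding I_Suc[abs_def, symmetric] by (simp add: I_def)
qed

text \<open>
  Stopping the integrand as soon as its accumulated square exceeds \<open>\<delta>\<close> gives an integral with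
  second moment at most \<open>\<delta>\<close>.
\<close>

lemma grid_integral_small:
  assumes W: "wiener_process M Tst F W"
    and \<rho>: "0 \<le> \<rho> 0" "\<And>l. l < N \<Longrightarrow> \<rho> l < \<rho> (Suc l)" "\<And>l. l \<le> N \<Longrightarrow> \<rho> l \<le> Tst"
    and h: "\<And>l. l < N \<Longrightarrow> h l \<in> borel_measurable (F (\<rho> l))"
      "\<And>l. l < N \<Longrightarrow> \<exists>C. \<forall>\<omega>\<in>space M. \<bar>h l \<omega>\<bar> \<le> C"
    and \<epsilon>: "\<epsilon> > 0" and \<delta>: "\<delta> > 0"
    and B: "B \<in> events" "\<And>\<omega>. \<omega> \<in> space M \<Longrightarrow> \<delta> < (\<Sum>l<N. (h l \<omega>)\<^sup>2 * (\<rho> (Suc l) - \<rho> l)) \<Longrightarrow> \<omega> \<in> B"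
  shows "{\<omega> \<in> space M. \<epsilon> < \<bar>grid_integral \<rho> h N \<omega>\<bar>} \<in> events"
    "prob {\<omega> \<in> space M. \<epsilon> < \<bar>grid_integral \<rho> h N \<omega>\<bar>} \<le> prob B + \<delta> / \<epsilon>\<^sup>2"
proof -
  define Q where "Q k \<omega> = (\<Sum>l<k. (h l \<omega>)\<^sup>2 * (\<rho> (Suc l) - \<rho> l))" for k \<omega>
  \<comment> \<open>The accumulated square up to and including index \<open>l\<close> involves only
    coefficients known at \<open>\<rho> l\<close>. The stopped coefficient is therefore still known
    at the left grid point, and the term that would exceed \<delta> is itself excluded.\<close>
  define h' where "h' l \<omega> = (if Q (Suc l) \<omega> \<le> \<delta> then h l \<omega> else 0)" for l \<omega>
  have \<rho>_mono: "\<rho> j \<le> \<rho> l" if "j \<le> l" "l \<le> N" for j l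
    using that
  proof (induction l)
    case (Suc l)
    then show ?case using \<rho>(2)[of l] by (cases "j = Suc l") auto
  qed simp
  have h_F: "h j \<in> borel_measurable (F (\<rho> l))" if "j \<le> l" "l < N" for j l
    using that by (intro measurable_F_mono[OF \<rho>_mono[of j l]] h(1)) auto
  have h'_F: "h' l \<in> borel_measurable (F (\<rho> l))" if l: "l < N" for l
  proof -
    have [measurable]: "Q (Suc l) \<in> borel_measurable (F (\<rho> l))"
      unfolding Q_def using h_F[OF _ l] by (intro borel_measurable_sum borel_measurable_times borel_measurable_power) auto
    have [measurable]: "h l \<in> borel_measurable (F (\<rho> l))" by (rule h(1)[OF l])
    show ?thesis unfolding h'_def by measurable
  qed
  have h'_bdd: "\<exists>C. \<forall>\<omega>\<in>space M. \<bar>h' l \<omega>\<bar> \<le> C" if l: "l < N" for l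
  proof -
    obtain C where "\<forall>\<omega>\<in>space M. \<bar>h l \<omega>\<bar> \<le> C" using h(2)[OF l] by blast
    then have "\<forall>\<omega>\<in>space M. \<bar>h' l \<omega>\<bar> \<le> \<bar>C\<bar>" unfolding h'_def by auto
    then show ?thesis by blast
  qed
  note iso = grid_ito_isometry[OF W \<rho> h'_F h'_bdd order_refl]
  have Q_incr: "Q l \<omega> \<le> Q (Suc l) \<omega>" if "l < N" for l \<omega>
    unfolding Q_def using \<rho>(2)[OF that] by simp
  have Q_mono: "Q j \<omega> \<le> Q l \<omega>" if "j \<le> l" "l \<le> N" for j l \<omega>
    using that
  proof (induction l)
    case (Suc l)
    then show ?case using Q_incr[of l \<omega>] by (cases "j = Suc l") auto
  qed simp
  \<comment> \<open>Since \<open>Q\<close> increases, stopping is permanent, so that the stopped sum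
    stays below \<delta> after the crossing.\<close>
  have Q': "(\<Sum>l<k. (h' l \<omega>)\<^sup>2 * (\<rho> (Suc l) - \<rho> l)) \<le> min (Q k \<omega>) \<delta>" if "k \<le> N" for k \<omega>
    using that
  proof (induction k)
    case 0 then show ?case using \<delta> by (simp add: Q_def)
  next
    case (Suc k)
    then have IH: "(\<Sum>l<k. (h' l \<omega>)\<^sup>2 * (\<rho> (Suc l) - \<rho> l)) \<le> min (Q k \<omega>) \<delta>" by simp
    show ?case
    proof (cases "Q (Suc k) \<omega> \<le> \<delta>")
      case True
      have "Q (Suc k) \<omega> = Q k \<omega> + (h k \<omega>)\<^sup>2 * (\<rho> (Suc k) - \<rho> k)" by (simp add: Q_def)
      then show ?thesis using IH True by (simp add: h'_def)
    next
      case False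
      then show ?thesis using IH Q_incr[of k \<omega>] Suc.prems by (simp add: h'_def)
    qed
  qed
  have h'_sq: "integrable M (\<lambda>\<omega>. (h' l \<omega>)\<^sup>2)" if l: "l < N" for l
  proof -
    obtain C where C: "\<And>\<omega>. \<omega> \<in> space M \<Longrightarrow> \<bar>h' l \<omega>\<bar> \<le> C" using h'_bdd[OF l] by blast
    have [measurable]: "h' l \<in> borel_measurable M" using h'_F[OF l] by (rule measurable_F_sub)
    show ?thesis
    proof (rule integrable_const_bound[where B = "C\<^sup>2"])
      show "AE \<omega> in M. norm ((h' l \<omega>)\<^sup>2) \<le> C\<^sup>2"
        using C by (intro AE_I2) (metis norm_power power_mono real_norm_def abs_ge_zero power_abs abs_power2)
    qed measurable
  qed
  let ?I' = "grid_integral \<rho> h' N"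
  have I': "?I' \<in> borel_measurable M" using iso measurable_F_sub by blast
  have "expectation (\<lambda>\<omega>. (?I' \<omega>)\<^sup>2) = (\<Sum>l<N. expectation (\<lambda>\<omega>. (h' l \<omega>)\<^sup>2) * (\<rho> (Suc l) - \<rho> l))"
    using iso by blast
  also have "\<dots> = expectation (\<lambda>\<omega>. \<Sum>l<N. (h' l \<omega>)\<^sup>2 * (\<rho> (Suc l) - \<rho> l))"
    using h'_sq by (subst Bochner_Integration.integral_sum) auto
  also have "\<dots> \<le> expectation (\<lambda>\<omega>. \<delta>)"
    using h'_sq Q'[OF order_refl] by (intro integral_mono Bochner_Integration.integrable_sum) auto
  finally have second_moment: "expectation (\<lambda>\<omega>. (?I' \<omega>)\<^sup>2) \<le> \<delta>" by (simp add: prob_space)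
  have "prob {\<omega> \<in> space M. \<epsilon>\<^sup>2 \<le> (?I' \<omega>)\<^sup>2} \<le> expectation (\<lambda>\<omega>. (?I' \<omega>)\<^sup>2) / \<epsilon>\<^sup>2"
    using iso \<epsilon> by (intro integral_Markov_inequality_measure[where A = "{}"]) auto
  also have "\<dots> \<le> \<delta> / \<epsilon>\<^sup>2" using second_moment \<epsilon> by (intro divide_right_mono) auto
  finally have markov: "prob {\<omega> \<in> space M. \<epsilon>\<^sup>2 \<le> (?I' \<omega>)\<^sup>2} \<le> \<delta> / \<epsilon>\<^sup>2" .
  have I_meas: "grid_integral \<rho> h N \<in> borel_measurable M"
    using grid_ito_isometry[OF W \<rho> h order_refl] measurable_F_sub by blast
  then show "{\<omega> \<in> space M. \<epsilon> < \<bar>grid_integral \<rho> h N \<omega>\<bar>} \<in> events" by measurable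
  \<comment> \<open>Outside \<open>B\<close> nothing is stopped, so that the stopped and the
    original integral agree there.\<close>
  have sub: "{\<omega> \<in> space M. \<epsilon> < \<bar>grid_integral \<rho> h N \<omega>\<bar>} \<subseteq> B \<union> {\<omega> \<in> space M. \<epsilon>\<^sup>2 \<le> (?I' \<omega>)\<^sup>2}"
  proof
    fix \<omega> assume \<omega>: "\<omega> \<in> {\<omega> \<in> space M. \<epsilon> < \<bar>grid_integral \<rho> h N \<omega>\<bar>}"
    show "\<omega> \<in> B \<union> {\<omega> \<in> space M. \<epsilon>\<^sup>2 \<le> (?I' \<omega>)\<^sup>2}"
    proof (cases "Q N \<omega> \<le> \<delta>")
      case True
      have "h' l \<omega> = h l \<omega>" if "l < N" for l
        using Q_mono[of "Suc l" N \<omega>] that True by (simp add: h'_def)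
      then have "?I' \<omega> = grid_integral \<rho> h N \<omega>" unfolding grid_integral_def by (intro sum.cong) auto
      then have "\<epsilon> \<le> \<bar>?I' \<omega>\<bar>" using \<omega> by simp
      then have "\<epsilon>\<^sup>2 \<le> \<bar>?I' \<omega>\<bar>\<^sup>2" using \<epsilon> by (intro power_mono) auto
      then show ?thesis using \<omega> by simp
    next
      case False
      then show ?thesis using B(2)[of \<omega>] \<omega> by (simp add: Q_def)
    qed
  qed
  have ev: "{\<omega> \<in> space M. \<epsilon>\<^sup>2 \<le> (?I' \<omega>)\<^sup>2} \<in> events" using I' by measurable
  have "prob {\<omega> \<in> space M. \<epsilon> < \<bar>grid_integral \<rho> h N \<omega>\<bar>} \<le> prob (B \<union> {\<omega> \<in> space M. \<epsilon>\<^sup>2 \<le> (?I' \<omega>)\<^sup>2})"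
    using sub B(1) ev by (intro finite_measure_mono) auto
  also have "\<dots> \<le> prob B + prob {\<omega> \<in> space M. \<epsilon>\<^sup>2 \<le> (?I' \<omega>)\<^sup>2}"
    using B(1) ev by (rule measure_Un_le)
  finally show "prob {\<omega> \<in> space M. \<epsilon> < \<bar>grid_integral \<rho> h N \<omega>\<bar>} \<le> prob B + \<delta> / \<epsilon>\<^sup>2"
    using markov by simp
qed

end

section \<open>Simple processes on a common grid\<close>

lemma indicator_grid_cell:
  fixes \<rho> :: "nat \<Rightarrow> real"
  assumes \<rho>: "\<And>i j. i < j \<Longrightarrow> j \<le> N \<Longrightarrow> \<rho> i < \<rho> j"
    and u: "u = \<rho> p" "p \<le> N" and v: "v = \<rho> q" "q \<le> N" and l: "l < N" and s: "s \<in> {\<rho> l<..\<rho> (Suc l)}"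
  shows "(indicator {u<..v} s :: real) = indicator {p..<q} l"
proof -
  have "u < s \<longleftrightarrow> p \<le> l"
    using \<rho>[of p l] \<rho>[of "Suc l" p] s u l by (cases "p \<le> l"; cases "p = l"; cases "p = Suc l") auto
  moreover have "s \<le> v \<longleftrightarrow> l < q"
    using \<rho>[of q l] \<rho>[of "Suc l" q] s v l by (cases "q \<le> l"; cases "q = l"; cases "q = Suc l") auto
  ultimately show ?thesis by (auto simp: indicator_def)
qed

text \<open>Interval endpoints lie on the grid, so that a cell is inside or outside each interval as
  a whole. The cell is open on the left, so its right endpoint represents it.\<close>

lemma simple_process_grid_cell:
  fixes \<rho> :: "nat \<Rightarrow> real"
  assumes \<rho>: "\<And>i j. i < j \<Longrightarrow> j \<le> N \<Longrightarrow> \<rho> i < \<rho> j"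
    and \<tau>: "\<And>k. k \<le> n \<Longrightarrow> \<tau> k \<in> \<rho> ` {..N}"
    and l: "l < N" and s: "s \<in> {\<rho> l<..\<rho> (Suc l)}"
  shows "simple_process n \<tau> h s \<omega> = simple_process n \<tau> h (\<rho> (Suc l)) \<omega>"
  unfolding simple_process_def
proof (rule sum.cong)
  fix k assume "k \<in> {..<n}"
  then obtain p q where p: "\<tau> k = \<rho> p" "p \<le> N" and q: "\<tau> (Suc k) = \<rho> q" "q \<le> N"
    using \<tau>[of k] \<tau>[of "Suc k"] by auto
  have "\<rho> (Suc l) \<in> {\<rho> l<..\<rho> (Suc l)}" using \<rho>[of l "Suc l"] l by auto
  then show "h k \<omega> * indicator {\<tau> k<..\<tau> (Suc k)} s = h k \<omega> * indicator {\<tau> k<..\<tau> (Suc k)} (\<rho> (Suc l))"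
    using indicator_grid_cell[OF \<rho> p q l s] indicator_grid_cell[OF \<rho> p q l] by simp
qed simp

text \<open>Each increment between partition points telescopes over the grid cells in between, and
  exchanging the sums collects the coefficients by cells.\<close>

lemma simple_process_step:
  fixes \<rho> :: "nat \<Rightarrow> real"
  assumes \<rho>: "\<And>i j. i < j \<Longrightarrow> j \<le> N \<Longrightarrow> \<rho> i < \<rho> j"
    and \<tau>: "\<And>k. k \<le> n \<Longrightarrow> \<tau> k \<in> \<rho> ` {..N}" and mono: "\<And>k. k < n \<Longrightarrow> \<tau> k \<le> \<tau> (Suc k)"
    and T: "\<And>k. k \<le> n \<Longrightarrow> \<tau> k \<le> T"
  shows "simple_integral W n \<tau> h T \<omega> =
    (\<Sum>l<N. simple_process n \<tau> h (\<rho> (Suc l)) \<omega> * (W (\<rho> (Suc l)) \<omega> - W (\<rho> l) \<omega>))"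
proof -
  have step: "W (\<tau> (Suc k)) \<omega> - W (\<tau> k) \<omega> =
     (\<Sum>l<N. indicator {\<tau> k<..\<tau> (Suc k)} (\<rho> (Suc l)) * (W (\<rho> (Suc l)) \<omega> - W (\<rho> l) \<omega>))" if k: "k < n" for k
  proof -
    obtain p q where p: "\<tau> k = \<rho> p" "p \<le> N" and q: "\<tau> (Suc k) = \<rho> q" "q \<le> N"
      using \<tau>[of k] \<tau>[of "Suc k"] k by auto
    have "p \<le> q" using mono[OF k] \<rho>[of q p] p q by (cases "q < p") auto
    have "(\<Sum>l<N. indicator {\<tau> k<..\<tau> (Suc k)} (\<rho> (Suc l)) * (W (\<rho> (Suc l)) \<omega> - W (\<rho> l) \<omega>))
      = (\<Sum>l<N. indicator {p..<q} l * (W (\<rho> (Suc l)) \<omega> - W (\<rho> l) \<omega>))"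
    proof (rule sum.cong)
      fix l assume "l \<in> {..<N}"
      then have l: "l < N" by simp
      have "\<rho> (Suc l) \<in> {\<rho> l<..\<rho> (Suc l)}" using \<rho>[of l "Suc l"] l by auto
      from indicator_grid_cell[OF \<rho> p q l this]
      show "indicator {\<tau> k<..\<tau> (Suc k)} (\<rho> (Suc l)) * (W (\<rho> (Suc l)) \<omega> - W (\<rho> l) \<omega>)
        = indicator {p..<q} l * (W (\<rho> (Suc l)) \<omega> - W (\<rho> l) \<omega>)" by simp
    qed simp
    also have "\<dots> = (\<Sum>l\<in>{p..<q}. W (\<rho> (Suc l)) \<omega> - W (\<rho> l) \<omega>)"
      using q(2) by (intro sum.mono_neutral_cong_right) (auto simp: indicator_def)
    also have "\<dots> = W (\<rho> q) \<omega> - W (\<rho> p) \<omega>"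
      by (rule sum_Suc_diff'[OF \<open>p \<le> q\<close>, of "\<lambda>l. W (\<rho> l) \<omega>"])
    finally show ?thesis using p q by simp
  qed
  have "simple_integral W n \<tau> h T \<omega> = (\<Sum>k<n. h k \<omega> * (W (\<tau> (Suc k)) \<omega> - W (\<tau> k) \<omega>))"
    unfolding simple_integral_def using T by (intro sum.cong) (auto simp: min_absorb1)
  also have "\<dots> = (\<Sum>k<n. \<Sum>l<N. h k \<omega> * indicator {\<tau> k<..\<tau> (Suc k)} (\<rho> (Suc l)) * (W (\<rho> (Suc l)) \<omega> - W (\<rho> l) \<omega>))"
    by (intro sum.cong refl) (simp only: lessThan_iff step sum_distrib_left mult.assoc)
  also have "\<dots> = (\<Sum>l<N. \<Sum>k<n. h k \<omega> * indicator {\<tau> k<..\<tau> (Suc k)} (\<rho> (Suc l)) * (W (\<rho> (Suc l)) \<omega> - W (\<rho> l) \<omega>))"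
    by (rule sum.swap)
  finally show ?thesis by (simp only: simple_process_def sum_distrib_right)
qed

text \<open>Partitions may repeat points. Enumerating the set of their points strictly removes the
  repetitions, since \<open>grid_ito_isometry\<close> works with cells of positive length.\<close>

lemma strict_enumeration:
  fixes P :: "real set"
  assumes "finite P" "P \<noteq> {}"
  shows "\<exists>\<rho> N. (\<forall>i j. i < j \<longrightarrow> j \<le> N \<longrightarrow> \<rho> i < \<rho> j) \<and> P = \<rho> ` {..N::nat}"
proof -
  define ps where "ps = sorted_list_of_set P"
  have ps: "set ps = P" "sorted_wrt (<) ps" using assms by (simp_all add: ps_def)
  then have "ps \<noteq> []" using assms by auto
  then have len: "{..length ps - 1} = {..<length ps}" by (cases ps) (auto simp: less_Suc_eq_le)
  have "ps ! i < ps ! j" if "i < j" "j \<le> length ps - 1" for i j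
    using that sorted_wrt_nth_less[OF ps(2) that(1)] \<open>ps \<noteq> []\<close> by (cases ps) auto
  moreover have "P = (\<lambda>i. ps ! i) ` {..length ps - 1}"
    unfolding len ps(1)[symmetric] by (auto simp: set_conv_nth)
  ultimately show ?thesis by blast
qed

text \<open>The cells are disjoint, so that at most one summand survives.\<close>

lemma sum_indicator_cells_le:
  fixes \<rho> :: "nat \<Rightarrow> real" and a :: "nat \<Rightarrow> ennreal"
  assumes \<rho>: "\<And>i j. i < j \<Longrightarrow> j \<le> N \<Longrightarrow> \<rho> i < \<rho> j"
    and f: "\<And>l. l < N \<Longrightarrow> s \<in> {\<rho> l<..\<rho> (Suc l)} \<Longrightarrow> a l \<le> f"
  shows "(\<Sum>l<N. a l * indicator {\<rho> l<..\<rho> (Suc l)} s) \<le> f"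
proof (cases "\<exists>l<N. s \<in> {\<rho> l<..\<rho> (Suc l)}")
  case True
  then obtain l where l: "l < N" "s \<in> {\<rho> l<..\<rho> (Suc l)}" by blast
  have "s \<notin> {\<rho> k<..\<rho> (Suc k)}" if "k < N" "k \<noteq> l" for k
  proof
    assume s: "s \<in> {\<rho> k<..\<rho> (Suc k)}"
    have "\<not> (indicator {\<rho> k<..\<rho> (Suc k)} s :: real) = 0" using s by simp
    moreover have "(indicator {\<rho> k<..\<rho> (Suc k)} s :: real) = indicator {k..<Suc k} l"
      using indicator_grid_cell[OF \<rho> refl _ refl _ l, of k "Suc k"] that by auto
    ultimately show False using that by (auto simp: indicator_def)
  qed
  then have "(\<Sum>l<N. a l * indicator {\<rho> l<..\<rho> (Suc l)} s) = (\<Sum>k\<in>{l}. a k * indicator {\<rho> k<..\<rho> (Suc k)} s)"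
    using l by (intro sum.mono_neutral_right) (auto simp: indicator_def)
  also have "\<dots> \<le> f" using f[OF l] l by simp
  finally show ?thesis .
next
  case False
  then have "(\<Sum>l<N. a l * indicator {\<rho> l<..\<rho> (Suc l)} s) = 0"
    by (intro sum.neutral) (auto simp: indicator_def)
  then show ?thesis by simp
qed

context levy_noise
begin

lemma simple_integrand_bounds:
  assumes H: "simple_integrand M Tst F n \<tau> h" and k: "k \<le> n"
  shows "0 \<le> \<tau> k" "\<tau> k \<le> Tst"
proof -
  have mono: "\<tau> i \<le> \<tau> j" if "i \<le> j" "j \<le> n" for i j
    using that
  proof (induction j)
    case (Suc j)
    have "\<tau> j \<le> \<tau> (Suc j)" using H Suc.prems unfolding simple_integrand_def by auto
    then show ?case using Suc by (cases "i = Suc j") auto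
  qed simp
  show "0 \<le> \<tau> k" using mono[of 0 k] k H unfolding simple_integrand_def by auto
  show "\<tau> k \<le> Tst" using mono[of k n] k H unfolding simple_integrand_def by auto
qed

text \<open>Only the intervals that begin before \<open>v\<close> contribute to the value at
  \<open>v\<close>. In the application, \<open>u\<close> and \<open>v\<close> are neighbouring grid
  points, so that the value at the right end is known at the left end.\<close>

lemma simple_process_coefficient:
  assumes H: "simple_integrand M Tst F n \<tau> h"
    and u: "\<And>k. k < n \<Longrightarrow> \<tau> k < v \<Longrightarrow> \<tau> k \<le> u"
  shows "simple_process n \<tau> h v \<in> borel_measurable (F u)"
    "\<exists>C. \<forall>\<omega>\<in>space M. \<bar>simple_process n \<tau> h v \<omega>\<bar> \<le> C"
proof -
  show "simple_process n \<tau> h v \<in> borel_measurable (F u)"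
    unfolding simple_process_def
  proof (rule borel_measurable_sum)
    fix k assume k: "k \<in> {..<n}"
    show "(\<lambda>\<omega>. h k \<omega> * indicator {\<tau> k<..\<tau> (Suc k)} v) \<in> borel_measurable (F u)"
    proof (cases "\<tau> k < v")
      case True
      have "h k \<in> borel_measurable (F (\<tau> k))" using H k unfolding simple_integrand_def by auto
      then have [measurable]: "h k \<in> borel_measurable (F u)"
        using measurable_F_mono[OF u[of k]] k True by auto
      show ?thesis by measurable
    qed simp
  qed
  have "\<forall>k<n. \<exists>C. \<forall>\<omega>\<in>space M. \<bar>h k \<omega>\<bar> \<le> C" using H unfolding simple_integrand_def by auto
  then obtain C where C: "\<And>k \<omega>. k < n \<Longrightarrow> \<omega> \<in> space M \<Longrightarrow> \<bar>h k \<omega>\<bar> \<le> C k" by metis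
  have "\<bar>simple_process n \<tau> h v \<omega>\<bar> \<le> (\<Sum>k<n. C k)" if "\<omega> \<in> space M" for \<omega>
  proof -
    have "\<bar>simple_process n \<tau> h v \<omega>\<bar> \<le> (\<Sum>k<n. \<bar>h k \<omega> * indicator {\<tau> k<..\<tau> (Suc k)} v\<bar>)"
      unfolding simple_process_def by (rule sum_abs)
    also have "\<dots> \<le> (\<Sum>k<n. C k)"
    proof (rule sum_mono)
      fix k assume "k \<in> {..<n}"
      then have "\<bar>h k \<omega>\<bar> \<le> C k" using C that by auto
      then show "\<bar>h k \<omega> * indicator {\<tau> k<..\<tau> (Suc k)} v\<bar> \<le> C k"
        by (auto simp: indicator_def)
    qed
    finally show ?thesis .
  qed
  then show "\<exists>C. \<forall>\<omega>\<in>space M. \<bar>simple_process n \<tau> h v \<omega>\<bar> \<le> C" by blast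
qed

text \<open>On the union of both partitions, the difference of the two integrals is a single grid
  integral. The event \<open>B\<close> covers the outcomes with a large time integral, in accordance
  with the covers in \<open>tends_to_0_in_prob\<close>.\<close>

lemma simple_integral_difference_small:
  assumes W: "wiener_process M Tst F W"
    and H: "simple_integrand M Tst F n \<tau> h" and H': "simple_integrand M Tst F n' \<tau>' h'"
    and \<epsilon>: "\<epsilon> > 0" and \<delta>: "\<delta> > 0"
    and B: "B \<in> events" "\<And>\<omega>. \<omega> \<in> space M \<Longrightarrow> ennreal \<delta> <
      (\<integral>\<^sup>+ s\<in>{0..Tst}. ennreal (\<bar>simple_process n \<tau> h s \<omega> - simple_process n' \<tau>' h' s \<omega>\<bar>\<^sup>2) \<partial>lborel) \<Longrightarrow> \<omega> \<in> B"
  shows "{\<omega> \<in> space M. \<epsilon> < \<bar>simple_integral W n \<tau> h Tst \<omega> - simple_integral W n' \<tau>' h' Tst \<omega>\<bar>} \<in> events"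
    "prob {\<omega> \<in> space M. \<epsilon> < \<bar>simple_integral W n \<tau> h Tst \<omega> - simple_integral W n' \<tau>' h' Tst \<omega>\<bar>} \<le> prob B + \<delta> / \<epsilon>\<^sup>2"
proof -
  define P where "P = \<tau> ` {..n} \<union> \<tau>' ` {..n'}"
  have "finite P" "P \<noteq> {}" by (auto simp: P_def)
  from strict_enumeration[OF this] obtain \<rho> N
    where \<rho>': "\<forall>i j. i < j \<longrightarrow> j \<le> N \<longrightarrow> \<rho> i < \<rho> j" and P: "P = \<rho> ` {..N::nat}" by blast
  have \<rho>: "\<rho> i < \<rho> j" if "i < j" "j \<le> N" for i j using \<rho>' that by blast
  have \<tau>: "\<tau> k \<in> \<rho> ` {..N}" if "k \<le> n" for k using that unfolding P[symmetric] P_def by auto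
  have \<tau>': "\<tau>' k \<in> \<rho> ` {..N}" if "k \<le> n'" for k using that unfolding P[symmetric] P_def by auto
  have \<rho>_bounds: "0 \<le> \<rho> l" "\<rho> l \<le> Tst" if "l \<le> N" for l
  proof -
    have "\<rho> l \<in> P" using that P by auto
    then show "0 \<le> \<rho> l" "\<rho> l \<le> Tst"
      using simple_integrand_bounds[OF H] simple_integrand_bounds[OF H'] unfolding P_def by auto
  qed
  define g where "g l \<omega> = simple_process n \<tau> h (\<rho> (Suc l)) \<omega> - simple_process n' \<tau>' h' (\<rho> (Suc l)) \<omega>" for l \<omega>
  \<comment> \<open>No partition point lies strictly between neighbouring grid points.\<close>
  have before: "\<theta> k \<le> \<rho> l" if "\<theta> k \<in> \<rho> ` {..N}" "\<theta> k < \<rho> (Suc l)" "l < N" for \<theta> :: "nat \<Rightarrow> real" and k l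
  proof -
    obtain p where p: "\<theta> k = \<rho> p" "p \<le> N" using \<open>\<theta> k \<in> \<rho> ` {..N}\<close> by auto
    have "p \<le> l" using \<rho>[of "Suc l" p] that p by (cases "p \<le> l"; cases "p = Suc l") auto
    then show ?thesis using \<rho>[of p l] p that by (cases "p = l") auto
  qed
  have g: "g l \<in> borel_measurable (F (\<rho> l))" "\<exists>C. \<forall>\<omega>\<in>space M. \<bar>g l \<omega>\<bar> \<le> C" if l: "l < N" for l
  proof -
    note c = simple_process_coefficient[OF H, of "\<rho> (Suc l)" "\<rho> l"]
    note c' = simple_process_coefficient[OF H', of "\<rho> (Suc l)" "\<rho> l"]
    have b: "\<tau> k \<le> \<rho> l" if "k < n" "\<tau> k < \<rho> (Suc l)" for k using before[of \<tau> k l] \<tau>[of k] that l by auto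
    have b': "\<tau>' k \<le> \<rho> l" if "k < n'" "\<tau>' k < \<rho> (Suc l)" for k using before[of \<tau>' k l] \<tau>'[of k] that l by auto
    show "g l \<in> borel_measurable (F (\<rho> l))"
      unfolding g_def[abs_def] using c(1)[OF b] c'(1)[OF b'] by (intro borel_measurable_diff) auto
    obtain C where C: "\<And>\<omega>. \<omega> \<in> space M \<Longrightarrow> \<bar>simple_process n \<tau> h (\<rho> (Suc l)) \<omega>\<bar> \<le> C" using c(2)[OF b] by blast
    obtain C' where C': "\<And>\<omega>. \<omega> \<in> space M \<Longrightarrow> \<bar>simple_process n' \<tau>' h' (\<rho> (Suc l)) \<omega>\<bar> \<le> C'" using c'(2)[OF b'] by blast
    have "\<bar>g l \<omega>\<bar> \<le> C + C'" if "\<omega> \<in> space M" for \<omega>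
      using C[OF that] C'[OF that] unfolding g_def by linarith
    then show "\<exists>C. \<forall>\<omega>\<in>space M. \<bar>g l \<omega>\<bar> \<le> C" by blast
  qed
  have eq: "simple_integral W n \<tau> h Tst \<omega> - simple_integral W n' \<tau>' h' Tst \<omega> = grid_integral \<rho> g N \<omega>" for \<omega>
  proof -
    have "simple_integral W n \<tau> h Tst \<omega> =
      (\<Sum>l<N. simple_process n \<tau> h (\<rho> (Suc l)) \<omega> * (W (\<rho> (Suc l)) \<omega> - W (\<rho> l) \<omega>))"
      using H simple_integrand_bounds[OF H] by (intro simple_process_step \<rho> \<tau>) (auto simp: simple_integrand_def)
    moreover have "simple_integral W n' \<tau>' h' Tst \<omega> =
      (\<Sum>l<N. simple_process n' \<tau>' h' (\<rho> (Suc l)) \<omega> * (W (\<rho> (Suc l)) \<omega> - W (\<rho> l) \<omega>))"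
      using H' simple_integrand_bounds[OF H'] by (intro simple_process_step \<rho> \<tau>') (auto simp: simple_integrand_def)
    ultimately show ?thesis
      unfolding grid_integral_def g_def by (simp add: sum_subtractf[symmetric] left_diff_distrib)
  qed
  have B': "\<omega> \<in> B" if \<omega>: "\<omega> \<in> space M" "\<delta> < (\<Sum>l<N. (g l \<omega>)\<^sup>2 * (\<rho> (Suc l) - \<rho> l))" for \<omega>
  proof (rule B(2)[OF \<omega>(1)])
    \<comment> \<open>The sum of squares over the cells is the time integral of a step function,
      which the given time integral dominates cell by cell.\<close>
    have "ennreal \<delta> < ennreal (\<Sum>l<N. (g l \<omega>)\<^sup>2 * (\<rho> (Suc l) - \<rho> l))"
      using \<omega>(2) \<delta> by (intro ennreal_lessI) auto
    also have "\<dots> = (\<Sum>l<N. ennreal ((g l \<omega>)\<^sup>2) * ennreal (\<rho> (Suc l) - \<rho> l))"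
    proof -
      have "ennreal (\<Sum>l<N. (g l \<omega>)\<^sup>2 * (\<rho> (Suc l) - \<rho> l)) = (\<Sum>l<N. ennreal ((g l \<omega>)\<^sup>2 * (\<rho> (Suc l) - \<rho> l)))"
        using \<rho>[OF lessI] by (intro sum_ennreal[symmetric] mult_nonneg_nonneg) (auto simp: less_imp_le)
      then show ?thesis using \<rho>[OF lessI] by (simp add: ennreal_mult less_imp_le)
    qed
    also have "\<dots> = (\<Sum>l<N. \<integral>\<^sup>+ s. ennreal ((g l \<omega>)\<^sup>2) * indicator {\<rho> l<..\<rho> (Suc l)} s \<partial>lborel)"
      using \<rho>[OF lessI] by (intro sum.cong) (auto simp: nn_integral_cmult_indicator less_imp_le)
    also have "\<dots> = (\<integral>\<^sup>+ s. (\<Sum>l<N. ennreal ((g l \<omega>)\<^sup>2) * indicator {\<rho> l<..\<rho> (Suc l)} s) \<partial>lborel)"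
      by (rule nn_integral_sum[symmetric]) measurable
    also have "\<dots> \<le> (\<integral>\<^sup>+ s\<in>{0..Tst}. ennreal (\<bar>simple_process n \<tau> h s \<omega> - simple_process n' \<tau>' h' s \<omega>\<bar>\<^sup>2) \<partial>lborel)"
    proof (intro nn_integral_mono sum_indicator_cells_le[OF \<rho>])
      fix s l assume l: "l < N" and s: "s \<in> {\<rho> l<..\<rho> (Suc l)}"
      have "s \<in> {0..Tst}" using \<rho>_bounds(1)[of l] \<rho>_bounds(2)[of "Suc l"] l s by auto
      moreover have "simple_process n \<tau> h s \<omega> - simple_process n' \<tau>' h' s \<omega> = g l \<omega>"
        using simple_process_grid_cell[where h = h and \<omega> = \<omega>, OF \<rho> \<tau> l s]
          simple_process_grid_cell[where h = h' and \<omega> = \<omega>, OF \<rho> \<tau>' l s] by (simp only: g_def)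
      ultimately show "ennreal ((g l \<omega>)\<^sup>2) \<le> ennreal (\<bar>simple_process n \<tau> h s \<omega> - simple_process n' \<tau>' h' s \<omega>\<bar>\<^sup>2) * indicator {0..Tst} s"
        by simp
    qed auto
    finally show "ennreal \<delta> < (\<integral>\<^sup>+ s\<in>{0..Tst}. ennreal (\<bar>simple_process n \<tau> h s \<omega> - simple_process n' \<tau>' h' s \<omega>\<bar>\<^sup>2) \<partial>lborel)" .
  qed
  have \<rho>0: "0 \<le> \<rho> 0" using \<rho>_bounds(1)[of 0] by simp
  have \<rho>S: "\<rho> l < \<rho> (Suc l)" if "l < N" for l using \<rho>[of l "Suc l"] that by simp
  note small = grid_integral_small[OF W \<rho>0 \<rho>S \<rho>_bounds(2) g \<epsilon> \<delta> B(1) B']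
  show "{\<omega> \<in> space M. \<epsilon> < \<bar>simple_integral W n \<tau> h Tst \<omega> - simple_integral W n' \<tau>' h' Tst \<omega>\<bar>} \<in> events"
    "prob {\<omega> \<in> space M. \<epsilon> < \<bar>simple_integral W n \<tau> h Tst \<omega> - simple_integral W n' \<tau>' h' Tst \<omega>\<bar>} \<le> prob B + \<delta> / \<epsilon>\<^sup>2"
    unfolding eq using small by auto
qed

end

section \<open>Convergence in probability and uniqueness of the integrals\<close>

context prob_space
begin

lemma tends_to_0_in_probE:
  assumes "tends_to_0_in_prob M Y" "\<epsilon> > 0"
  obtains A where "\<And>n. A n \<in> sets M" "\<And>n. {\<omega> \<in> space M. Y n \<omega> > ennreal \<epsilon>} \<subseteq> A n"
    "(\<lambda>n. measure M (A n)) \<longlonglongrightarrow> 0"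
proof -
  have "\<exists>A. (\<forall>n. A n \<in> sets M \<and> {\<omega> \<in> space M. Y n \<omega> > ennreal \<epsilon>} \<subseteq> A n) \<and> (\<lambda>n. measure M (A n)) \<longlonglongrightarrow> 0"
    using assms by (simp add: tends_to_0_in_prob_def)
  then obtain A where A: "\<forall>n. A n \<in> sets M \<and> {\<omega> \<in> space M. Y n \<omega> > ennreal \<epsilon>} \<subseteq> A n"
    "(\<lambda>n. measure M (A n)) \<longlonglongrightarrow> 0" by (elim exE conjE)
  show ?thesis by (rule that[of A]) (use A in auto)
qed

lemma tends_to_0_in_prob_AE_le:
  assumes Y: "tends_to_0_in_prob M Y" and le: "AE \<omega> in M. \<forall>n. Y' n \<omega> \<le> Y n \<omega>"
  shows "tends_to_0_in_prob M Y'"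
  unfolding tends_to_0_in_prob_def
proof (intro allI impI)
  fix \<epsilon> :: real assume e: "\<epsilon> > 0"
  obtain A where A: "\<And>n. A n \<in> sets M" "\<And>n. {\<omega> \<in> space M. Y n \<omega> > ennreal \<epsilon>} \<subseteq> A n"
    "(\<lambda>n. measure M (A n)) \<longlonglongrightarrow> 0"
    by (fact tends_to_0_in_probE[OF Y e])
  obtain N where N: "N \<in> null_sets M" "{\<omega> \<in> space M. \<not> (\<forall>n. Y' n \<omega> \<le> Y n \<omega>)} \<subseteq> N"
    using le by (auto elim!: AE_E simp: null_sets_def)
  have "{\<omega> \<in> space M. Y' n \<omega> > ennreal \<epsilon>} \<subseteq> A n \<union> N" for n
  proof
    fix \<omega> assume \<omega>: "\<omega> \<in> {\<omega> \<in> space M. Y' n \<omega> > ennreal \<epsilon>}"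
    show "\<omega> \<in> A n \<union> N"
    proof (cases "\<omega> \<in> N")
      case False
      then have "Y' n \<omega> \<le> Y n \<omega>" using N(2) \<omega> by auto
      then have "\<omega> \<in> A n" using A(2)[of n] \<omega> by (auto intro: less_le_trans)
      then show ?thesis by simp
    qed simp
  qed
  moreover have "A n \<union> N \<in> sets M" for n using A(1) N(1) by auto
  moreover have "measure M (A n \<union> N) = measure M (A n)" for n
    using A(1) N(1) by (rule measure_Un_null_set)
  ultimately show "\<exists>A. (\<forall>n. A n \<in> sets M \<and> {\<omega> \<in> space M. Y' n \<omega> > ennreal \<epsilon>} \<subseteq> A n) \<and> (\<lambda>n. measure M (A n)) \<longlonglongrightarrow> 0"
    using A(3) by (intro exI[of _ "\<lambda>n. A n \<union> N"]) auto
qed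

lemma tends_to_0_in_prob_add:
  assumes "tends_to_0_in_prob M Y" "tends_to_0_in_prob M Y'"
  shows "tends_to_0_in_prob M (\<lambda>n \<omega>. Y n \<omega> + Y' n \<omega>)"
  unfolding tends_to_0_in_prob_def
proof (intro allI impI)
  fix \<epsilon> :: real assume e: "\<epsilon> > 0"
  then have e2: "\<epsilon> / 2 > 0" by simp
  obtain A where A: "\<And>n. A n \<in> sets M" "\<And>n. {\<omega> \<in> space M. Y n \<omega> > ennreal (\<epsilon> / 2)} \<subseteq> A n"
    "(\<lambda>n. measure M (A n)) \<longlonglongrightarrow> 0"
    by (fact tends_to_0_in_probE[OF assms(1) e2])
  obtain A' where A': "\<And>n. A' n \<in> sets M" "\<And>n. {\<omega> \<in> space M. Y' n \<omega> > ennreal (\<epsilon> / 2)} \<subseteq> A' n"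
    "(\<lambda>n. measure M (A' n)) \<longlonglongrightarrow> 0"
    by (fact tends_to_0_in_probE[OF assms(2) e2])
  have "{\<omega> \<in> space M. Y n \<omega> + Y' n \<omega> > ennreal \<epsilon>} \<subseteq> A n \<union> A' n" for n
  proof
    fix \<omega> assume \<omega>: "\<omega> \<in> {\<omega> \<in> space M. Y n \<omega> + Y' n \<omega> > ennreal \<epsilon>}"
    have "Y n \<omega> > ennreal (\<epsilon> / 2) \<or> Y' n \<omega> > ennreal (\<epsilon> / 2)"
    proof (rule ccontr)
      assume "\<not> ?thesis"
      then have "Y n \<omega> + Y' n \<omega> \<le> ennreal (\<epsilon> / 2) + ennreal (\<epsilon> / 2)"
        by (intro add_mono) (auto simp: not_less)
      also have "\<dots> = ennreal \<epsilon>" using e by (simp flip: ennreal_plus)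
      finally show False using \<omega> by auto
    qed
    then show "\<omega> \<in> A n \<union> A' n" using A(2)[of n] A'(2)[of n] \<omega> by blast
  qed
  moreover have "(\<lambda>n. measure M (A n \<union> A' n)) \<longlonglongrightarrow> 0"
  proof (rule tendsto_sandwich[OF _ _ tendsto_const])
    show "(\<lambda>n. measure M (A n) + measure M (A' n)) \<longlonglongrightarrow> 0"
      using tendsto_add[OF A(3) A'(3)] by simp
    show "\<forall>\<^sub>F n in sequentially. measure M (A n \<union> A' n) \<le> measure M (A n) + measure M (A' n)"
      using A(1) A'(1) by (intro always_eventually allI measure_Un_le) auto
  qed simp
  ultimately show "\<exists>A. (\<forall>n. A n \<in> sets M \<and> {\<omega> \<in> space M. Y n \<omega> + Y' n \<omega> > ennreal \<epsilon>} \<subseteq> A n) \<and> (\<lambda>n. measure M (A n)) \<longlonglongrightarrow> 0"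
    using A(1) A'(1) by (intro exI[of _ "\<lambda>n. A n \<union> A' n"]) auto
qed

text \<open>Along a constant sequence, each event where \<open>\<bar>D \<omega>\<bar>\<close>
  exceeds \<open>1 / real (Suc k)\<close> is covered by events of arbitrarily small
  probability.\<close>

lemma AE_eq_0_if_tends_to_0_in_prob:
  fixes D :: "'a \<Rightarrow> real"
  assumes D: "D \<in> borel_measurable M" and lim: "tends_to_0_in_prob M (\<lambda>n \<omega>. ennreal \<bar>D \<omega>\<bar>)"
  shows "AE \<omega> in M. D \<omega> = 0"
proof -
  have [measurable]: "D \<in> borel_measurable M" by (rule D)
  have null: "prob {\<omega> \<in> space M. 1 / real (Suc k) < \<bar>D \<omega>\<bar>} = 0" for k
  proof -
    have k: "0 < 1 / real (Suc k)" by simp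
    obtain A where A: "\<And>n::nat. A n \<in> sets M" "\<And>n. {\<omega> \<in> space M. ennreal \<bar>D \<omega>\<bar> > ennreal (1 / real (Suc k))} \<subseteq> A n"
      "(\<lambda>n. measure M (A n)) \<longlonglongrightarrow> 0"
      by (fact tends_to_0_in_probE[OF lim k])
    have "{\<omega> \<in> space M. 1 / real (Suc k) < \<bar>D \<omega>\<bar>} \<subseteq> A n" for n
      using A(2)[of n] by (auto simp: ennreal_less_iff)
    then have "prob {\<omega> \<in> space M. 1 / real (Suc k) < \<bar>D \<omega>\<bar>} \<le> prob (A n)" for n
      using A(1) by (intro finite_measure_mono) auto
    then have "prob {\<omega> \<in> space M. 1 / real (Suc k) < \<bar>D \<omega>\<bar>} \<le> 0"
      using A(3) by (intro LIMSEQ_le_const) auto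
    then show ?thesis by (simp add: measure_le_0_iff)
  qed
  have "AE \<omega> in M. \<forall>k. \<not> 1 / real (Suc k) < \<bar>D \<omega>\<bar>"
  proof (subst AE_all_countable, rule allI)
    fix k
    have "{\<omega> \<in> space M. 1 / real (Suc k) < \<bar>D \<omega>\<bar>} \<in> null_sets M"
      using null[of k] by (simp add: null_sets_def emeasure_eq_measure)
    then show "AE \<omega> in M. \<not> 1 / real (Suc k) < \<bar>D \<omega>\<bar>"
      by (rule AE_I') auto
  qed
  then show ?thesis
  proof eventually_elim
    case (elim \<omega>)
    show "D \<omega> = 0"
    proof (rule ccontr)
      assume "D \<omega> \<noteq> 0"
      then obtain k where "1 / real (Suc k) < \<bar>D \<omega>\<bar>" using nat_approx_posE[of "\<bar>D \<omega>\<bar>"] by auto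
      then show False using elim by blast
    qed
  qed
qed

text \<open>Covers are chosen with probabilities below a geometric sequence, so that by
  Borel-Cantelli almost every outcome eventually stays outside them. The same sequence
  \<open>e\<close> serves as the threshold, which gives convergence to 0.\<close>

lemma AE_subsequence_if_tends_to_0_in_prob:
  assumes "tends_to_0_in_prob M Y"
  obtains r where "strict_mono (r :: nat \<Rightarrow> nat)" "AE \<omega> in M. (\<lambda>k. Y (r k) \<omega>) \<longlonglongrightarrow> 0"
proof -
  define e where "e k = (1 / 2 :: real) ^ k" for k
  define P where "P k A \<longleftrightarrow> (\<forall>n. A n \<in> sets M \<and> {\<omega> \<in> space M. Y n \<omega> > ennreal (e k)} \<subseteq> A n) \<and> (\<lambda>n. measure M (A n)) \<longlonglongrightarrow> 0" for k A
  have "\<exists>A. P k A" for k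
  proof -
    have "e k > 0" by (simp add: e_def)
    then show ?thesis using assms unfolding tends_to_0_in_prob_def P_def by simp
  qed
  then obtain A where "\<And>k. P k (A k)" by metis
  then have A: "A k n \<in> sets M" "{\<omega> \<in> space M. Y n \<omega> > ennreal (e k)} \<subseteq> A k n"
    "(\<lambda>n. measure M (A k n)) \<longlonglongrightarrow> 0" for k n unfolding P_def by auto
  have ex: "\<exists>n. n > m \<and> measure M (A k n) < e k" for m k
  proof -
    have "\<forall>\<^sub>F n in sequentially. measure M (A k n) < e k"
      by (rule order_tendstoD(2)[OF A(3)]) (simp add: e_def)
    moreover have "\<forall>\<^sub>F n in sequentially. n > m" by (rule eventually_gt_at_top)
    ultimately have "\<forall>\<^sub>F n in sequentially. n > m \<and> measure M (A k n) < e k" by eventually_elim auto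
    then show ?thesis by (rule eventually_happens'[OF sequentially_bot])
  qed
  have "\<exists>r. \<forall>k. measure M (A k (r k)) < e k \<and> r k < r (Suc k)"
  proof (rule dependent_nat_choice)
    show "\<exists>n. measure M (A 0 n) < e 0" using ex[of 0 0] by (elim exE conjE) (rule exI)
    show "\<exists>n. measure M (A (Suc k) n) < e (Suc k) \<and> m < n" for m k
      using ex[of m "Suc k"] by (elim exE conjE) (intro exI conjI)
  qed
  then obtain r where "\<forall>k. measure M (A k (r k)) < e k \<and> r k < r (Suc k)" ..
  then have r: "measure M (A k (r k)) < e k" "r k < r (Suc k)" for k by auto
  have "summable e" unfolding e_def by (intro summable_geometric) simp
  then have "summable (\<lambda>k. measure M (A k (r k)))"
    by (rule summable_comparison_test'[where N = 0]) (use r(1) in \<open>simp add: less_imp_le\<close>)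
  then have "AE \<omega> in M. \<forall>\<^sub>F k in sequentially. \<omega> \<in> space M - A k (r k)"
    by (rule borel_cantelli_AE1[rotated 2]) (simp_all add: A(1) emeasure_eq_measure)
  then have "AE \<omega> in M. (\<lambda>k. Y (r k) \<omega>) \<longlonglongrightarrow> 0"
  proof eventually_elim
    case (elim \<omega>)
    then have "\<forall>\<^sub>F k in sequentially. Y (r k) \<omega> \<le> ennreal (e k)"
    proof eventually_elim
      case (elim k)
      then have "\<not> ennreal (e k) < Y (r k) \<omega>" using A(2)[of k "r k"] by blast
      then show ?case by (rule leI)
    qed
    moreover have "(\<lambda>k. ennreal (e k)) \<longlonglongrightarrow> ennreal 0"
      unfolding e_def by (intro tendsto_ennrealI LIMSEQ_realpow_zero) auto
    then have "(\<lambda>k. ennreal (e k)) \<longlonglongrightarrow> 0" by simp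
    ultimately show ?case by (rule tendsto_sandwich[OF _ _ tendsto_const, rotated]) simp
  qed
  moreover have "strict_mono r" using r(2) by (simp add: strict_mono_Suc_iff)
  ultimately show ?thesis using that[of r] by simp
qed

end

section \<open>Uniqueness of the stochastic integrals at the terminal time\<close>

context levy_noise
begin

lemma pred_section: "\<omega> \<in> space M \<Longrightarrow> (\<lambda>s. (\<omega>, s)) \<in> measurable (restrict_space lborel {0..Tst}) pred_alg"
proof (rule measurableI)
  fix D assume \<omega>: "\<omega> \<in> space M" and "D \<in> sets pred_alg"
  then have "D \<in> sets (M \<Otimes>\<^sub>M lborel)" using sets_pred_sub by blast
  then have "Pair \<omega> -` D \<in> sets lborel" by (rule sets_Pair1)
  then show "(\<lambda>s. (\<omega>, s)) -` D \<inter> space (restrict_space lborel {0..Tst}) \<in> sets (restrict_space lborel {0..Tst})"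
    by (auto simp: sets_restrict_space_iff space_restrict_space)
qed (simp add: space_restrict_space)

lemma Phi_class_section:
  assumes "\<phi> \<in> Phi_class M Tst F"
  shows "AE \<omega> in M. (\<lambda>s. indicator {0..Tst} s * \<phi> s \<omega>) \<in> borel_measurable borel"
proof -
  obtain \<phi>' where \<phi>': "(\<lambda>(\<omega>, s). \<phi>' s \<omega>) \<in> borel_measurable pred_alg"
    "AE \<omega> in M. \<forall>s\<in>{0..Tst}. \<phi> s \<omega> = \<phi>' s \<omega>"
    using assms unfolding Phi_class_def by (elim CollectE conjE exE) (rule that)
  show ?thesis
    using \<phi>'(2) AE_space
  proof eventually_elim
    case (elim \<omega>)
    have "(\<lambda>s. \<phi>' s \<omega>) \<in> borel_measurable (restrict_space lborel {0..Tst})"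
      using measurable_compose[OF pred_section[OF elim(2)] \<phi>'(1)] by simp
    then have "(\<lambda>s. indicator {0..Tst} s *\<^sub>R \<phi>' s \<omega>) \<in> borel_measurable lborel"
      by (subst (asm) borel_measurable_restrict_space_iff) auto
    moreover have "(\<lambda>s. indicator {0..Tst} s *\<^sub>R \<phi>' s \<omega>) = (\<lambda>s. indicator {0..Tst} s * \<phi> s \<omega>)"
      using elim(1) by (auto simp: fun_eq_iff indicator_def)
    ultimately show ?case by simp
  qed
qed

text \<open>Two approximations of \<phi> are close to each other, and by
  \<open>simple_integral_difference_small\<close> so are their integrals.\<close>

lemma simple_integral_difference_tends_to_0:
  assumes W: "wiener_process M Tst F W" and \<phi>: "\<phi> \<in> Phi_class M Tst F"
    and H: "\<And>m. simple_integrand M Tst F (n m) (\<tau> m) (h m)" and H': "\<And>m. simple_integrand M Tst F (n' m) (\<tau>' m) (h' m)"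
    and lim: "tends_to_0_in_prob M (\<lambda>m \<omega>. \<integral>\<^sup>+ s\<in>{0..Tst}. ennreal (\<bar>\<phi> s \<omega> - simple_process (n m) (\<tau> m) (h m) s \<omega>\<bar>\<^sup>2) \<partial>lborel)"
      "tends_to_0_in_prob M (\<lambda>m \<omega>. \<integral>\<^sup>+ s\<in>{0..Tst}. ennreal (\<bar>\<phi> s \<omega> - simple_process (n' m) (\<tau>' m) (h' m) s \<omega>\<bar>\<^sup>2) \<partial>lborel)"
  shows "tends_to_0_in_prob M (\<lambda>m \<omega>. ennreal \<bar>simple_integral W (n m) (\<tau> m) (h m) Tst \<omega> - simple_integral W (n' m) (\<tau>' m) (h' m) Tst \<omega>\<bar>)"
proof -
  define a where "a m s \<omega> = simple_process (n m) (\<tau> m) (h m) s \<omega>" for m s \<omega>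
  define a' where "a' m s \<omega> = simple_process (n' m) (\<tau>' m) (h' m) s \<omega>" for m s \<omega>
  define R where "R m \<omega> = (\<integral>\<^sup>+ s\<in>{0..Tst}. ennreal (\<bar>\<phi> s \<omega> - a m s \<omega>\<bar>\<^sup>2) \<partial>lborel)" for m \<omega>
  define R' where "R' m \<omega> = (\<integral>\<^sup>+ s\<in>{0..Tst}. ennreal (\<bar>\<phi> s \<omega> - a' m s \<omega>\<bar>\<^sup>2) \<partial>lborel)" for m \<omega>
  define Q where "Q m \<omega> = (\<integral>\<^sup>+ s\<in>{0..Tst}. ennreal (\<bar>a m s \<omega> - a' m s \<omega>\<bar>\<^sup>2) \<partial>lborel)" for m \<omega>
  have R: "tends_to_0_in_prob M R" "tends_to_0_in_prob M R'"
    using lim unfolding R_def[abs_def] R'_def[abs_def] a_def a'_def by auto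
  \<comment> \<open>The square of a sum is at most twice the sum of the squares. The doubled terms
    are written as sums to fit \<open>tends_to_0_in_prob_add\<close>.\<close>
  have "AE \<omega> in M. \<forall>m. Q m \<omega> \<le> (R m \<omega> + R m \<omega>) + (R' m \<omega> + R' m \<omega>)"
    using Phi_class_section[OF \<phi>]
  proof eventually_elim
    case (elim \<omega>)
    show ?case
    proof
      fix m
      define f where "f s = indicator {0..Tst} s * \<phi> s \<omega>" for s
      have [measurable]: "f \<in> borel_measurable borel" using elim unfolding f_def[abs_def] .
      have [measurable]: "(\<lambda>s. a m s \<omega>) \<in> borel_measurable borel" "(\<lambda>s. a' m s \<omega>) \<in> borel_measurable borel"
        unfolding a_def a'_def simple_process_def by measurable
      have Rf: "R m \<omega> = (\<integral>\<^sup>+ s. ennreal (\<bar>f s - a m s \<omega>\<bar>\<^sup>2) * indicator {0..Tst} s \<partial>lborel)"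
        unfolding R_def by (intro nn_integral_cong) (auto simp: f_def indicator_def)
      have Rf': "R' m \<omega> = (\<integral>\<^sup>+ s. ennreal (\<bar>f s - a' m s \<omega>\<bar>\<^sup>2) * indicator {0..Tst} s \<partial>lborel)"
        unfolding R'_def by (intro nn_integral_cong) (auto simp: f_def indicator_def)
      have "Q m \<omega> \<le> (\<integral>\<^sup>+ s. (ennreal (\<bar>f s - a m s \<omega>\<bar>\<^sup>2) * indicator {0..Tst} s + ennreal (\<bar>f s - a m s \<omega>\<bar>\<^sup>2) * indicator {0..Tst} s)
         + (ennreal (\<bar>f s - a' m s \<omega>\<bar>\<^sup>2) * indicator {0..Tst} s + ennreal (\<bar>f s - a' m s \<omega>\<bar>\<^sup>2) * indicator {0..Tst} s) \<partial>lborel)"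
        unfolding Q_def
      proof (rule nn_integral_mono)
        fix s
        have "(a m s \<omega> - a' m s \<omega>)\<^sup>2 \<le> ((f s - a m s \<omega>)\<^sup>2 + (f s - a m s \<omega>)\<^sup>2) + ((f s - a' m s \<omega>)\<^sup>2 + (f s - a' m s \<omega>)\<^sup>2)"
          using zero_le_power2[of "(f s - a m s \<omega>) + (f s - a' m s \<omega>)"] by (simp add: power2_eq_square algebra_simps)
        then show "ennreal (\<bar>a m s \<omega> - a' m s \<omega>\<bar>\<^sup>2) * indicator {0..Tst} s \<le> (ennreal (\<bar>f s - a m s \<omega>\<bar>\<^sup>2) * indicator {0..Tst} s + ennreal (\<bar>f s - a m s \<omega>\<bar>\<^sup>2) * indicator {0..Tst} s)
         + (ennreal (\<bar>f s - a' m s \<omega>\<bar>\<^sup>2) * indicator {0..Tst} s + ennreal (\<bar>f s - a' m s \<omega>\<bar>\<^sup>2) * indicator {0..Tst} s)"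
          by (cases "s \<in> {0..Tst}") (auto simp: ennreal_plus[symmetric] simp del: ennreal_plus intro!: ennreal_leI)
      qed
      also have "\<dots> = (R m \<omega> + R m \<omega>) + (R' m \<omega> + R' m \<omega>)"
        unfolding Rf Rf' by (subst nn_integral_add; (subst nn_integral_add)?; (subst nn_integral_add)?; measurable)
      finally show "Q m \<omega> \<le> (R m \<omega> + R m \<omega>) + (R' m \<omega> + R' m \<omega>)" .
    qed
  qed
  then have Q: "tends_to_0_in_prob M Q"
    by (rule tends_to_0_in_prob_AE_le[rotated]) (intro tends_to_0_in_prob_add R)
  show ?thesis
    unfolding tends_to_0_in_prob_def
  proof (intro allI impI)
    fix \<epsilon> :: real assume e: "\<epsilon> > 0"
    define A where "A m = {\<omega> \<in> space M. \<epsilon> < \<bar>simple_integral W (n m) (\<tau> m) (h m) Tst \<omega> - simple_integral W (n' m) (\<tau>' m) (h' m) Tst \<omega>\<bar>}" for m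
    have small: "A m \<in> events \<and> prob (A m) \<le> prob B + \<delta> / \<epsilon>\<^sup>2"
      if "\<delta> > 0" "B \<in> events" "{\<omega> \<in> space M. Q m \<omega> > ennreal \<delta>} \<subseteq> B" for m \<delta> B
    proof -
      have hit: "\<omega> \<in> B" if "\<omega> \<in> space M" "ennreal \<delta> < (\<integral>\<^sup>+ s\<in>{0..Tst}. ennreal
        (\<bar>simple_process (n m) (\<tau> m) (h m) s \<omega> - simple_process (n' m) (\<tau>' m) (h' m) s \<omega>\<bar>\<^sup>2) \<partial>lborel)" for \<omega>
        using that \<open>{\<omega> \<in> space M. Q m \<omega> > ennreal \<delta>} \<subseteq> B\<close> unfolding Q_def a_def a'_def by auto
      show ?thesis
        unfolding A_def using simple_integral_difference_small[OF W H[of m] H'[of m] e that(1,2) hit] by simp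
    qed
    have "A m \<in> events" for m using small[of 1 "space M" m] by auto
    moreover have "{\<omega> \<in> space M. ennreal \<bar>simple_integral W (n m) (\<tau> m) (h m) Tst \<omega> - simple_integral W (n' m) (\<tau>' m) (h' m) Tst \<omega>\<bar> > ennreal \<epsilon>} \<subseteq> A m" for m
    proof
      fix \<omega> assume "\<omega> \<in> {\<omega> \<in> space M. ennreal \<bar>simple_integral W (n m) (\<tau> m) (h m) Tst \<omega> - simple_integral W (n' m) (\<tau>' m) (h' m) Tst \<omega>\<bar> > ennreal \<epsilon>}"
      then show "\<omega> \<in> A m" unfolding A_def using ennreal_less_iff[of \<epsilon>] e by simp
    qed
    moreover have "(\<lambda>m. prob (A m)) \<longlonglongrightarrow> 0"
    proof (rule order_tendstoI)
      fix y :: real assume y: "0 < y"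
      \<comment> \<open>With this \<delta>, the Chebyshev term
        \<open>\<delta> / \<epsilon>\<^sup>2\<close> equals \<open>y / 2\<close>, and a cover of
        probability below \<open>y / 2\<close> is left for the rest.\<close>
      define \<delta> where "\<delta> = y * \<epsilon>\<^sup>2 / 2"
      have \<delta>: "\<delta> > 0" using y e by (simp add: \<delta>_def)
      obtain B where B: "\<And>m. B m \<in> sets M" "\<And>m. {\<omega> \<in> space M. Q m \<omega> > ennreal \<delta>} \<subseteq> B m"
        "(\<lambda>m. measure M (B m)) \<longlonglongrightarrow> 0"
        by (fact tends_to_0_in_probE[OF Q \<delta>])
      have "\<forall>\<^sub>F m in sequentially. prob (B m) < y / 2"
        by (rule order_tendstoD(2)[OF B(3)]) (use y in simp)
      then show "\<forall>\<^sub>F m in sequentially. prob (A m) < y"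
      proof eventually_elim
        case (elim m)
        have "\<delta> / \<epsilon>\<^sup>2 = y / 2" using e by (simp add: \<delta>_def)
        then show ?case using small[OF \<delta> B(1) B(2), of m] elim by auto
      qed
    qed (intro always_eventually allI, rule less_le_trans[OF _ measure_nonneg])
    ultimately show "\<exists>A. (\<forall>m. A m \<in> sets M \<and> {\<omega> \<in> space M. ennreal \<bar>simple_integral W (n m) (\<tau> m) (h m) Tst \<omega> - simple_integral W (n' m) (\<tau>' m) (h' m) Tst \<omega>\<bar> > ennreal \<epsilon>} \<subseteq> A m)
        \<and> (\<lambda>m. measure M (A m)) \<longlonglongrightarrow> 0"
      by blast
  qed
qed

text \<open>Each version is a limit of its own simple integrals at the terminal time, and the two
  sequences of simple integrals merge because they approximate the same integrand.\<close>

lemma ito_integral_unique: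
  assumes \<phi>: "\<phi> \<in> Phi_class M Tst F" and X: "is_ito_integral M Tst F W \<phi> X" and X': "is_ito_integral M Tst F W \<phi> X'"
  shows "AE \<omega> in M. X Tst \<omega> = X' Tst \<omega>"
proof -
  have T: "Tst \<in> {0..Tst}" using horizon_pos by simp
  obtain n \<tau> h where H: "\<And>m. simple_integrand M Tst F (n m) (\<tau> m) (h m)"
    "tends_to_0_in_prob M (\<lambda>m \<omega>. \<integral>\<^sup>+ s\<in>{0..Tst}. ennreal (\<bar>\<phi> s \<omega> - simple_process (n m) (\<tau> m) (h m) s \<omega>\<bar>\<^sup>2) \<partial>lborel)"
    "tends_to_0_in_prob M (\<lambda>m \<omega>. SUP t\<in>{0..Tst}. ennreal \<bar>X t \<omega> - simple_integral W (n m) (\<tau> m) (h m) t \<omega>\<bar>)"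
    using X unfolding is_ito_integral_def by (elim conjE exE) (rule that, simp_all)
  obtain n' \<tau>' h' where H': "\<And>m. simple_integrand M Tst F (n' m) (\<tau>' m) (h' m)"
    "tends_to_0_in_prob M (\<lambda>m \<omega>. \<integral>\<^sup>+ s\<in>{0..Tst}. ennreal (\<bar>\<phi> s \<omega> - simple_process (n' m) (\<tau>' m) (h' m) s \<omega>\<bar>\<^sup>2) \<partial>lborel)"
    "tends_to_0_in_prob M (\<lambda>m \<omega>. SUP t\<in>{0..Tst}. ennreal \<bar>X' t \<omega> - simple_integral W (n' m) (\<tau>' m) (h' m) t \<omega>\<bar>)"
    using X' unfolding is_ito_integral_def by (elim conjE exE) (rule that, simp_all)
  define I where "I m \<omega> = simple_integral W (n m) (\<tau> m) (h m) Tst \<omega>" for m \<omega>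
  define I' where "I' m \<omega> = simple_integral W (n' m) (\<tau>' m) (h' m) Tst \<omega>" for m \<omega>
  have diff: "tends_to_0_in_prob M (\<lambda>m \<omega>. ennreal \<bar>I m \<omega> - I' m \<omega>\<bar>)"
  proof (cases "b = 0")
    \<comment> \<open>Without a Gaussian part, \<open>W\<close> vanishes by convention, so that all
      simple integrals are 0.\<close>
    case True
    have zero: "simple_integral W n \<tau> h Tst \<omega> = 0"
      if "\<omega> \<in> space M" "simple_integrand M Tst F n \<tau> h" for n \<tau> h \<omega>
      unfolding simple_integral_def
    proof (intro sum.neutral ballI)
      fix k assume k: "k \<in> {..<n}"
      have "W (min (\<tau> k) Tst) \<omega> = 0" "W (min (\<tau> (Suc k)) Tst) \<omega> = 0"
        using W_absent[OF True] that(1) simple_integrand_bounds[OF that(2), of k]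
          simple_integrand_bounds[OF that(2), of "Suc k"] k by auto
      then show "h k \<omega> * (W (min (\<tau> (Suc k)) Tst) \<omega> - W (min (\<tau> k) Tst) \<omega>) = 0" by simp
    qed
    show ?thesis
      unfolding tends_to_0_in_prob_def I_def I'_def
      using zero[OF _ H(1)] zero[OF _ H'(1)] by (intro allI impI exI[of _ "\<lambda>_. {}"]) auto
  next
    case False
    then have "wiener_process M Tst F W" using W_wiener b_nonneg by simp
    from simple_integral_difference_tends_to_0[OF this \<phi> H(1) H'(1) H(2) H'(2)]
    show ?thesis unfolding I_def I'_def .
  qed
  have "tends_to_0_in_prob M (\<lambda>m \<omega>. ((SUP t\<in>{0..Tst}. ennreal \<bar>X t \<omega> - simple_integral W (n m) (\<tau> m) (h m) t \<omega>\<bar>)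
     + (SUP t\<in>{0..Tst}. ennreal \<bar>X' t \<omega> - simple_integral W (n' m) (\<tau>' m) (h' m) t \<omega>\<bar>)) + ennreal \<bar>I m \<omega> - I' m \<omega>\<bar>)"
    using H(3) H'(3) diff by (intro tends_to_0_in_prob_add)
  then have "tends_to_0_in_prob M (\<lambda>m \<omega>. ennreal \<bar>X Tst \<omega> - X' Tst \<omega>\<bar>)"
  proof (rule tends_to_0_in_prob_AE_le, intro AE_I2 allI)
    fix \<omega> m
    have "ennreal \<bar>X Tst \<omega> - X' Tst \<omega>\<bar> \<le> ennreal (\<bar>X Tst \<omega> - I m \<omega>\<bar> + \<bar>X' Tst \<omega> - I' m \<omega>\<bar> + \<bar>I m \<omega> - I' m \<omega>\<bar>)"
      by (intro ennreal_leI) linarith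
    also have "\<dots> = ennreal \<bar>X Tst \<omega> - I m \<omega>\<bar> + ennreal \<bar>X' Tst \<omega> - I' m \<omega>\<bar> + ennreal \<bar>I m \<omega> - I' m \<omega>\<bar>" by simp
    also have "\<dots> \<le> ((SUP t\<in>{0..Tst}. ennreal \<bar>X t \<omega> - simple_integral W (n m) (\<tau> m) (h m) t \<omega>\<bar>)
     + (SUP t\<in>{0..Tst}. ennreal \<bar>X' t \<omega> - simple_integral W (n' m) (\<tau>' m) (h' m) t \<omega>\<bar>)) + ennreal \<bar>I m \<omega> - I' m \<omega>\<bar>"
      unfolding I_def I'_def by (intro add_mono SUP_upper T order_refl)
    finally show "ennreal \<bar>X Tst \<omega> - X' Tst \<omega>\<bar> \<le> \<dots>" .
  qed
  moreover have "(\<lambda>\<omega>. X Tst \<omega> - X' Tst \<omega>) \<in> borel_measurable M"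
    using X X' T unfolding is_ito_integral_def adapted_def by (intro borel_measurable_diff) (auto intro: measurable_F_sub)
  ultimately have "AE \<omega> in M. X Tst \<omega> - X' Tst \<omega> = 0" by (rule AE_eq_0_if_tends_to_0_in_prob[rotated])
  then show ?thesis by eventually_elim simp
qed

text \<open>Both versions approach the same truncated integrals.\<close>

lemma compensated_integral_unique:
  assumes Y: "is_compensated_integral M Tst F Z \<nu> \<psi> Y" and Y': "is_compensated_integral M Tst F Z \<nu> \<psi> Y'"
  shows "AE \<omega> in M. Y Tst \<omega> = Y' Tst \<omega>"
proof -
  have T: "Tst \<in> {0..Tst}" using horizon_pos by simp
  define C where "C n t \<omega> = compensated_jump_integral Z \<nu> (truncate (1 / real (Suc n)) \<psi>) t \<omega>" for n t \<omega>
  have "tends_to_0_in_prob M (\<lambda>n \<omega>. (SUP t\<in>{0..Tst}. ennreal \<bar>Y t \<omega> - C n t \<omega>\<bar>) + (SUP t\<in>{0..Tst}. ennreal \<bar>Y' t \<omega> - C n t \<omega>\<bar>))"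
    using Y Y' unfolding is_compensated_integral_def C_def by (intro tends_to_0_in_prob_add) auto
  then have "tends_to_0_in_prob M (\<lambda>n \<omega>. ennreal \<bar>Y Tst \<omega> - Y' Tst \<omega>\<bar>)"
  proof (rule tends_to_0_in_prob_AE_le, intro AE_I2 allI)
    fix \<omega> n
    have "ennreal \<bar>Y Tst \<omega> - Y' Tst \<omega>\<bar> \<le> ennreal (\<bar>Y Tst \<omega> - C n Tst \<omega>\<bar> + \<bar>Y' Tst \<omega> - C n Tst \<omega>\<bar>)"
      by (intro ennreal_leI) linarith
    also have "\<dots> = ennreal \<bar>Y Tst \<omega> - C n Tst \<omega>\<bar> + ennreal \<bar>Y' Tst \<omega> - C n Tst \<omega>\<bar>" by simp
    also have "\<dots> \<le> (SUP t\<in>{0..Tst}. ennreal \<bar>Y t \<omega> - C n t \<omega>\<bar>) + (SUP t\<in>{0..Tst}. ennreal \<bar>Y' t \<omega> - C n t \<omega>\<bar>)"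
      by (intro add_mono SUP_upper T)
    finally show "ennreal \<bar>Y Tst \<omega> - Y' Tst \<omega>\<bar> \<le> \<dots>" .
  qed
  moreover have "(\<lambda>\<omega>. Y Tst \<omega> - Y' Tst \<omega>) \<in> borel_measurable M"
    using Y Y' T unfolding is_compensated_integral_def adapted_def by (intro borel_measurable_diff) (auto intro: measurable_F_sub)
  ultimately have "AE \<omega> in M. Y Tst \<omega> - Y' Tst \<omega> = 0" by (rule AE_eq_0_if_tends_to_0_in_prob[rotated])
  then show ?thesis by eventually_elim simp
qed

end

section \<open>Jumps of compensated integrals\<close>

text \<open>Uniform closeness passes to the left limits, so that the jump of \<open>g\<close> at
  \<open>s\<close> is close to the jump \<open>d k\<close> of \<open>C k\<close>, which is
  eventually \<open>D\<close>.\<close>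

lemma jump_of_uniform_limit:
  fixes g :: "real \<Rightarrow> real" and C :: "nat \<Rightarrow> real \<Rightarrow> real"
  assumes s: "0 < s" "s \<le> T" and g: "(g \<longlongrightarrow> l) (at_left s)"
    and C: "\<And>k. (C k \<longlongrightarrow> C k s - d k) (at_left s)"
    and unif: "(\<lambda>k. SUP t\<in>{0..T}. ennreal \<bar>g t - C k t\<bar>) \<longlonglongrightarrow> 0"
    and d: "\<forall>\<^sub>F k in sequentially. d k = D"
  shows "g s - l = D"
proof (rule ccontr)
  assume neq: "g s - l \<noteq> D"
  \<comment> \<open>A third of the discrepancy leaves room for one error at \<open>s\<close> and one
    in the left limit.\<close>
  define e where "e = \<bar>g s - l - D\<bar> / 3"
  have e: "e > 0" using neq by (simp add: e_def)
  then have "\<forall>\<^sub>F k in sequentially. (SUP t\<in>{0..T}. ennreal \<bar>g t - C k t\<bar>) < ennreal e"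
    by (intro order_tendstoD(2)[OF unif]) simp
  with d have "\<forall>\<^sub>F k in sequentially. d k = D \<and> (SUP t\<in>{0..T}. ennreal \<bar>g t - C k t\<bar>) < ennreal e"
    by eventually_elim simp
  then obtain k where k: "d k = D" "(SUP t\<in>{0..T}. ennreal \<bar>g t - C k t\<bar>) < ennreal e"
    using eventually_happens'[OF sequentially_bot] by blast
  have close: "\<bar>g t - C k t\<bar> < e" if "t \<in> {0..T}" for t
  proof -
    have "ennreal \<bar>g t - C k t\<bar> \<le> (SUP t\<in>{0..T}. ennreal \<bar>g t - C k t\<bar>)" by (rule SUP_upper[OF that])
    then have "ennreal \<bar>g t - C k t\<bar> < ennreal e" using k(2) by (rule le_less_trans)
    then show ?thesis by (simp add: ennreal_less_iff)
  qed
  have "((\<lambda>t. \<bar>g t - C k t\<bar>) \<longlongrightarrow> \<bar>l - (C k s - d k)\<bar>) (at_left s)"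
    by (intro tendsto_intros g C)
  moreover have "\<forall>\<^sub>F t in at_left s. \<bar>g t - C k t\<bar> \<le> e"
    unfolding eventually_at_left_field
  proof (intro exI[of _ 0] conjI allI impI s(1))
    fix t assume "0 < t" "t < s"
    then show "\<bar>g t - C k t\<bar> \<le> e" using close[of t] s(2) by auto
  qed
  ultimately have "\<bar>l - (C k s - d k)\<bar> \<le> e" by (rule tendsto_upperbound) simp
  moreover have "\<bar>g s - C k s\<bar> < e" using close[of s] s by auto
  moreover have "\<bar>g s - l - D\<bar> \<le> \<bar>g s - C k s\<bar> + \<bar>l - (C k s - d k)\<bar>" using k(1) by linarith
  moreover have "\<bar>g s - l - D\<bar> = 3 * e" by (simp add: e_def)
  ultimately show False using e by linarith
qed

lemma continuous_on_at_left_right: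
  fixes g :: "real \<Rightarrow> real"
  assumes g: "continuous_on {0..T} g"
  shows "0 < s \<Longrightarrow> s \<le> T \<Longrightarrow> (g \<longlongrightarrow> g s) (at_left s)"
    and "0 \<le> s \<Longrightarrow> s < T \<Longrightarrow> (g \<longlongrightarrow> g s) (at_right s)"
proof -
  assume s: "0 < s" "s \<le> T"
  have "continuous_on {0..s} g" using s by (intro continuous_on_subset[OF g]) auto
  then have "(g \<longlongrightarrow> g s) (at s within {0..s})" using s unfolding continuous_on_def by auto
  then show "(g \<longlongrightarrow> g s) (at_left s)" using s by (simp add: at_within_Icc_at_left)
next
  assume s: "0 \<le> s" "s < T"
  have "continuous_on {s..T} g" using s by (intro continuous_on_subset[OF g]) auto
  then have "(g \<longlongrightarrow> g s) (at s within {s..T})" using s unfolding continuous_on_def by auto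
  then show "(g \<longlongrightarrow> g s) (at_right s)" using s by (simp add: at_within_Icc_at_right)
qed

lemma limit_zero_if_zero_on_rationals:
  fixes E :: "real \<Rightarrow> real"
  assumes zero: "\<And>t. t \<in> \<rat> \<Longrightarrow> 0 \<le> t \<Longrightarrow> t \<le> T \<Longrightarrow> E t = 0"
  shows "(E \<longlongrightarrow> l) (at_left s) \<Longrightarrow> 0 < s \<Longrightarrow> s \<le> T \<Longrightarrow> l = 0"
    and "(E \<longlongrightarrow> l) (at_right s) \<Longrightarrow> 0 \<le> s \<Longrightarrow> s < T \<Longrightarrow> l = 0"
proof -
  assume lim: "(E \<longlongrightarrow> l) (at_left s)" and s: "0 < s" "s \<le> T"
  show "l = 0"
  proof (rule ccontr)
    assume "l \<noteq> 0"
    then have "\<forall>\<^sub>F t in at_left s. dist (E t) l < \<bar>l\<bar>" by (intro tendstoD[OF lim]) simp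
    then obtain b where b: "b < s" "\<And>t. b < t \<Longrightarrow> t < s \<Longrightarrow> dist (E t) l < \<bar>l\<bar>"
      unfolding eventually_at_left_field by blast
    obtain q where q: "q \<in> \<rat>" "max b 0 < q" "q < s"
      using Rats_dense_in_real[of "max b 0" s] b(1) s by auto
    then have "E q = 0" using zero[of q] s by auto
    then show False using b(2)[of q] q by (simp add: dist_real_def)
  qed
next
  assume lim: "(E \<longlongrightarrow> l) (at_right s)" and s: "0 \<le> s" "s < T"
  show "l = 0"
  proof (rule ccontr)
    assume "l \<noteq> 0"
    then have "\<forall>\<^sub>F t in at_right s. dist (E t) l < \<bar>l\<bar>" by (intro tendstoD[OF lim]) simp
    then obtain b where b: "s < b" "\<And>t. s < t \<Longrightarrow> t < b \<Longrightarrow> dist (E t) l < \<bar>l\<bar>"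
      unfolding eventually_at_right_field by blast
    obtain q where q: "q \<in> \<rat>" "s < q" "q < min b T"
      using Rats_dense_in_real[of s "min b T"] b(1) s by auto
    then have "E q = 0" using zero[of q] s by auto
    then show False using b(2)[of q] q by (simp add: dist_real_def)
  qed
qed

text \<open>Above the threshold, the factor \<open>real (Suc n)\<close> dominates in both branches
  of the minimum. This turns the mixed integrability in \<open>Psi12_class\<close> into
  integrability of the truncations.\<close>

lemma truncated_le_min:
  fixes y :: real
  shows "(if \<bar>y\<bar> > 1 / real (Suc n) then \<bar>y\<bar> else 0) \<le> real (Suc n) * min (\<bar>y\<bar>\<^sup>2) \<bar>y\<bar>"
proof (cases "\<bar>y\<bar> > 1 / real (Suc n)")
  case True
  then have "1 \<le> real (Suc n) * \<bar>y\<bar>" by (simp add: field_simps)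
  then have "1 * \<bar>y\<bar> \<le> real (Suc n) * \<bar>y\<bar> * \<bar>y\<bar>" by (intro mult_right_mono) auto
  moreover have "1 * \<bar>y\<bar> \<le> real (Suc n) * \<bar>y\<bar>" by (intro mult_right_mono) auto
  ultimately show ?thesis using True by (simp add: min_def power2_eq_square mult.assoc)
qed simp

context discrete_levy_noise
begin

lemma jump_integral_regular:
  assumes \<omega>: "\<omega> \<in> regular" and t: "t \<le> Tst"
  shows "jump_integral Z \<psi> t \<omega> = (\<Sum>s\<in>jump_set \<omega> \<inter> {..t}. \<psi> s (jump Z s \<omega>) \<omega>)"
proof -
  have "jump_times Z t \<omega> = jump_set \<omega> \<inter> {..t}"
    using \<omega> t by (auto simp: jump_times_def jump_set_def)
  then show ?thesis unfolding jump_integral_def by (simp add: infsum_finite)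
qed

text \<open>Integrability in time makes the compensator of a truncated integral continuous, so that
  it does not affect the jumps in \<open>compensated_integral_jumps\<close>.\<close>

lemma truncated_compensator_integrable:
  assumes \<psi>: "\<psi> \<in> Psi12_class M Tst F \<nu>"
  shows "AE \<omega> in M. \<forall>n. set_integrable lborel {0..Tst} (\<lambda>s. LINT x|\<nu>. truncate (1 / real (Suc n)) \<psi> s x \<omega>)"
proof -
  interpret nu: finite_measure \<nu> by (rule finite_nu)
  define R where "R = restrict_space lborel {0..Tst}"
  obtain \<psi>' where \<psi>': "(\<lambda>((\<omega>, s), x). \<psi>' s x \<omega>) \<in> borel_measurable (pred_alg \<Otimes>\<^sub>M borel)"
    "AE \<omega> in M. \<forall>s\<in>{0..Tst}. \<forall>x. \<psi> s x \<omega> = \<psi>' s x \<omega>"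
    using \<psi> unfolding Psi12_class_def by (elim CollectE conjE exE) (rule that)
  have fin: "AE \<omega> in M. (\<integral>\<^sup>+ s\<in>{0..Tst}. (\<integral>\<^sup>+ x. ennreal (min (\<bar>\<psi> s x \<omega>\<bar>\<^sup>2) \<bar>\<psi> s x \<omega>\<bar>) \<partial>\<nu>) \<partial>lborel) < \<infinity>"
    using \<psi> unfolding Psi12_class_def by blast
  show ?thesis
    using \<psi>'(2) fin AE_space
  proof eventually_elim
    case (elim \<omega>)
    have [measurable]: "(\<lambda>s. (\<omega>, s)) \<in> measurable R pred_alg" unfolding R_def by (rule pred_section[OF elim(3)])
    note [measurable] = \<psi>'(1)
    have "(\<lambda>(s, x). ((\<omega>, s), x)) \<in> measurable (R \<Otimes>\<^sub>M borel) (pred_alg \<Otimes>\<^sub>M borel)" by measurable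
    from measurable_compose[OF this \<psi>'(1)]
    have "(\<lambda>(s, x). \<psi>' s x \<omega>) \<in> borel_measurable (R \<Otimes>\<^sub>M borel)" by (simp add: split_beta)
    then have meas [measurable]: "(\<lambda>(s, x). \<psi>' s x \<omega>) \<in> borel_measurable (R \<Otimes>\<^sub>M \<nu>)"
      by (subst measurable_cong_sets[OF sets_pair_measure_cong[OF refl sets_nu] refl])
    define K where "K s = (\<integral>\<^sup>+ x. ennreal (min (\<bar>\<psi>' s x \<omega>\<bar>\<^sup>2) \<bar>\<psi>' s x \<omega>\<bar>) \<partial>\<nu>)" for s
    have [measurable]: "K \<in> borel_measurable R" unfolding K_def by measurable
    have "(\<integral>\<^sup>+ s. K s \<partial>R) = (\<integral>\<^sup>+ s\<in>{0..Tst}. K s \<partial>lborel)"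
      unfolding R_def by (rule nn_integral_restrict_space) simp
    also have "\<dots> = (\<integral>\<^sup>+ s\<in>{0..Tst}. (\<integral>\<^sup>+ x. ennreal (min (\<bar>\<psi> s x \<omega>\<bar>\<^sup>2) \<bar>\<psi> s x \<omega>\<bar>) \<partial>\<nu>) \<partial>lborel)"
      unfolding K_def using elim(1) by (intro nn_integral_cong) (auto simp: indicator_def)
    finally have K_fin: "(\<integral>\<^sup>+ s. K s \<partial>R) < \<infinity>" using elim(2) by simp
    show ?case
    proof
      fix n
      define h where "h s = (LINT x|\<nu>. truncate (1 / real (Suc n)) \<psi>' s x \<omega>)" for s
      have h_meas: "h \<in> borel_measurable R" unfolding h_def truncate_def by measurable
      have bound: "ennreal (norm (h s)) \<le> ennreal (real (Suc n)) * K s" if s: "s \<in> space R" for s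
      proof -
        have "(\<lambda>x. (s, x)) \<in> measurable \<nu> (R \<Otimes>\<^sub>M \<nu>)" using s by measurable
        from measurable_compose[OF this meas] have [measurable]: "(\<lambda>x. \<psi>' s x \<omega>) \<in> borel_measurable \<nu>" by simp
        have "ennreal (norm (h s)) \<le> (\<integral>\<^sup>+ x. ennreal (norm (truncate (1 / real (Suc n)) \<psi>' s x \<omega>)) \<partial>\<nu>)"
        proof (cases "integrable \<nu> (\<lambda>x. truncate (1 / real (Suc n)) \<psi>' s x \<omega>)")
          case True
          then show ?thesis unfolding h_def by (rule integral_norm_bound_ennreal)
        next
          \<comment> \<open>The Bochner integral is 0 by default here, so that the bound is
            trivial.\<close>
          case False
          then show ?thesis unfolding h_def by (simp add: not_integrable_integral_eq)
        qed
        also have "\<dots> \<le> (\<integral>\<^sup>+ x. ennreal (real (Suc n)) * ennreal (min (\<bar>\<psi>' s x \<omega>\<bar>\<^sup>2) \<bar>\<psi>' s x \<omega>\<bar>) \<partial>\<nu>)"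
        proof (rule nn_integral_mono)
          fix x
          have "norm (truncate (1 / real (Suc n)) \<psi>' s x \<omega>) = (if \<bar>\<psi>' s x \<omega>\<bar> > 1 / real (Suc n) then \<bar>\<psi>' s x \<omega>\<bar> else 0)"
            by (simp add: truncate_def)
          also have "\<dots> \<le> real (Suc n) * min (\<bar>\<psi>' s x \<omega>\<bar>\<^sup>2) \<bar>\<psi>' s x \<omega>\<bar>" by (rule truncated_le_min)
          finally show "ennreal (norm (truncate (1 / real (Suc n)) \<psi>' s x \<omega>)) \<le> ennreal (real (Suc n)) * ennreal (min (\<bar>\<psi>' s x \<omega>\<bar>\<^sup>2) \<bar>\<psi>' s x \<omega>\<bar>)"
            by (subst ennreal_mult[symmetric]) (auto intro!: ennreal_leI)
        qed
        also have "\<dots> = ennreal (real (Suc n)) * K s" unfolding K_def by (rule nn_integral_cmult) measurable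
        finally show ?thesis .
      qed
      have "(\<integral>\<^sup>+ s. ennreal (norm (h s)) \<partial>R) \<le> (\<integral>\<^sup>+ s. ennreal (real (Suc n)) * K s \<partial>R)"
        by (intro nn_integral_mono bound)
      also have "\<dots> = ennreal (real (Suc n)) * (\<integral>\<^sup>+ s. K s \<partial>R)" by (rule nn_integral_cmult) measurable
      also have "\<dots> < \<infinity>" using K_fin by (simp add: ennreal_mult_less_top)
      finally have "integrable R h" using h_meas by (intro integrableI_bounded)
      then have "set_integrable lborel {0..Tst} h"
        unfolding R_def set_integrable_def by (subst (asm) integrable_restrict_space) auto
      moreover have "(LINT x|\<nu>. truncate (1 / real (Suc n)) \<psi> s x \<omega>) = h s" if "s \<in> {0..Tst}" for s
        unfolding h_def truncate_def using elim(1) that by (intro Bochner_Integration.integral_cong) auto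
      ultimately show "set_integrable lborel {0..Tst} (\<lambda>s. LINT x|\<nu>. truncate (1 / real (Suc n)) \<psi> s x \<omega>)"
        by (subst set_integrable_cong[OF refl refl]) auto
    qed
  qed
qed

text \<open>At a jump time a truncated integral jumps by the truncated integrand, because its
  compensator is continuous. Along a subsequence the truncated integrals converge uniformly at
  almost every outcome, and at a fixed jump the truncation is eventually inactive.\<close>

lemma compensated_integral_jumps:
  assumes \<psi>: "\<psi> \<in> Psi12_class M Tst F \<nu>" and Y: "is_compensated_integral M Tst F Z \<nu> \<psi> Y"
  shows "AE \<omega> in M. \<forall>s\<in>jump_set \<omega>. Y s \<omega> - left_lim (\<lambda>t. Y t \<omega>) s = \<psi> s (jump Z s \<omega>) \<omega>"
proof -
  define C where "C n t \<omega> = compensated_jump_integral Z \<nu> (truncate (1 / real (Suc n)) \<psi>) t \<omega>" for n t \<omega>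
  have lim: "tends_to_0_in_prob M (\<lambda>n \<omega>. SUP t\<in>{0..Tst}. ennreal \<bar>Y t \<omega> - C n t \<omega>\<bar>)"
    using Y unfolding is_compensated_integral_def C_def by blast
  obtain r :: "nat \<Rightarrow> nat" where r: "strict_mono r"
    "AE \<omega> in M. (\<lambda>k. SUP t\<in>{0..Tst}. ennreal \<bar>Y t \<omega> - C (r k) t \<omega>\<bar>) \<longlonglongrightarrow> 0"
    by (fact AE_subsequence_if_tends_to_0_in_prob[OF lim])
  have "AE \<omega> in M. cadlag_on Tst (\<lambda>t. Y t \<omega>)" using Y unfolding is_compensated_integral_def by blast
  then show ?thesis
    using r(2) truncated_compensator_integrable[OF \<psi>] AE_regular
  proof eventually_elim
    case (elim \<omega>)
    show ?case
    proof
      fix s assume s: "s \<in> jump_set \<omega>"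
      then have s': "0 < s" "s \<le> Tst" "jump Z s \<omega> \<noteq> 0"
        using elim(4) by (auto simp: jump_set_def less_le)
      define z where "z = jump Z s \<omega>"
      define d where "d k = truncate (1 / real (Suc (r k))) \<psi> s z \<omega>" for k
      \<comment> \<open>A nonzero value lies above the threshold from some index on, and a zero
        value is its own truncation.\<close>
      have d: "\<forall>\<^sub>F k in sequentially. d k = \<psi> s z \<omega>"
      proof (cases "\<psi> s z \<omega> = 0")
        case True
        then show ?thesis by (simp add: d_def truncate_def)
      next
        case False
        then obtain n where n: "1 / real (Suc n) < \<bar>\<psi> s z \<omega>\<bar>" using nat_approx_posE[of "\<bar>\<psi> s z \<omega>\<bar>"] by auto
        have "d k = \<psi> s z \<omega>" if "n \<le> k" for k
        proof -
          have "n \<le> r k" using that seq_suble[OF r(1), of k] by simp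
          then have "1 / real (Suc (r k)) \<le> 1 / real (Suc n)" by (simp add: frac_le)
          then show ?thesis using n by (simp add: d_def truncate_def)
        qed
        then show ?thesis unfolding eventually_sequentially by blast
      qed
      have C_lim: "((\<lambda>t. C (r k) t \<omega>) \<longlongrightarrow> C (r k) s \<omega> - d k) (at_left s)" for k
      proof -
        define \<psi>k where "\<psi>k = truncate (1 / real (Suc (r k))) \<psi>"
        define step where "step t = (\<Sum>q\<in>jump_set \<omega> \<inter> {..t}. \<psi>k q (jump Z q \<omega>) \<omega>)" for t
        define G where "G t = (LINT q:{0..t}|lborel. (LINT x|\<nu>. \<psi>k q x \<omega>))" for t
        have C_eq: "C (r k) t \<omega> = step t - G t" if "t \<le> Tst" for t
          unfolding C_def compensated_jump_integral_def \<psi>k_def[symmetric] step_def G_def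
          using jump_integral_regular[OF elim(4) that] by simp
        have int: "set_integrable lborel {0..Tst} (\<lambda>q. LINT x|\<nu>. \<psi>k q x \<omega>)"
          using elim(3) unfolding \<psi>k_def by blast
        have G_eq: "G t = integral {0..t} (\<lambda>q. LINT x|\<nu>. \<psi>k q x \<omega>)" if "t \<in> {0..Tst}" for t
        proof -
          have "set_integrable lborel {0..t} (\<lambda>q. LINT x|\<nu>. \<psi>k q x \<omega>)"
            using that by (intro set_integrable_subset[OF int]) auto
          then show ?thesis unfolding G_def by (rule set_borel_integral_eq_integral(2))
        qed
        have "continuous_on {0..Tst} (\<lambda>t. integral {0..t} (\<lambda>q. LINT x|\<nu>. \<psi>k q x \<omega>))"
          by (rule indefinite_integral_continuous_1[OF set_borel_integral_eq_integral(1)[OF int]])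
        then have "continuous_on {0..Tst} G" by (subst continuous_on_cong[OF refl G_eq]) auto
        then have G_lim: "(G \<longlongrightarrow> G s) (at_left s)" using s' by (intro continuous_on_at_left_right)
        have "(step \<longlongrightarrow> (\<Sum>q\<in>jump_set \<omega> \<inter> {..<s}. \<psi>k q (jump Z q \<omega>) \<omega>)) (at_left s)"
          unfolding step_def by (rule step_function_at_left) simp
        moreover have "(\<Sum>q\<in>jump_set \<omega> \<inter> {..<s}. \<psi>k q (jump Z q \<omega>) \<omega>) = step s - d k"
          using step_function_jump[OF finite_jump_set, of "\<lambda>q. \<psi>k q (jump Z q \<omega>) \<omega>" \<omega> s] s
          unfolding step_def d_def \<psi>k_def z_def by simp
        ultimately have "((\<lambda>t. step t - G t) \<longlongrightarrow> (step s - d k) - G s) (at_left s)"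
          using G_lim by (intro tendsto_diff) simp_all
        moreover have "(step s - d k) - G s = C (r k) s \<omega> - d k" using C_eq[OF s'(2)] by simp
        moreover have "\<forall>\<^sub>F t in at_left s. step t - G t = C (r k) t \<omega>"
          unfolding eventually_at_left_field
          using C_eq s' by (intro exI[of _ 0]) auto
        ultimately show ?thesis by (simp add: tendsto_cong)
      qed
      have "((\<lambda>t. Y t \<omega>) \<longlongrightarrow> left_lim (\<lambda>t. Y t \<omega>) s) (at_left s)"
        by (rule cadlag_left_lim[OF elim(1) s'(1,2)])
      from jump_of_uniform_limit[OF s'(1,2) this, of "\<lambda>k t. C (r k) t \<omega>", OF C_lim elim(2) d]
      show "Y s \<omega> - left_lim (\<lambda>t. Y t \<omega>) s = \<psi> s (jump Z s \<omega>) \<omega>" unfolding z_def .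
    qed
  qed
qed

end

context weighted_jumps
begin

text \<open>Terminal values determine a martingale, so that both sides agree at each fixed time up
  to a null event. Agreement at countably many times forces equal one-sided limits at every jump
  time, and the continuous \<open>X\<close> cancels in the jump.\<close>

lemma integrand_eq_weight_at_jumps:
  assumes X: "AE \<omega> in M. continuous_on {0..Tst} (\<lambda>t. X t \<omega>)"
    and \<psi>: "\<psi> \<in> Psi12_class M Tst F \<nu>" and Y: "is_compensated_integral M Tst F Z \<nu> \<psi> Y"
    and V: "martingale_on M Tst F (\<lambda>t \<omega>. X t \<omega> + Y t \<omega>)"
    and terminal: "AE \<omega> in M. X Tst \<omega> + Y Tst \<omega> = jump_martingale Tst \<omega> - x0"
  shows "AE \<omega> in M. \<forall>s\<in>jump_set \<omega>. \<psi> s (jump Z s \<omega>) \<omega> = weight (jump Z s \<omega>)"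
proof -
  have V_int: "integrable M (\<lambda>\<omega>. X t \<omega> + Y t \<omega>)" if "t \<in> {0..Tst}" for t
    using V that unfolding martingale_on_def by blast
  have eq: "AE \<omega> in M. X t \<omega> + Y t \<omega> = jump_martingale t \<omega> - x0" if t: "t \<in> {0..Tst}" for t
  proof -
    interpret S: sigma_finite_subalgebra M "F t" by (rule sigma_finite_F)
    have "AE \<omega> in M. real_cond_exp M (F t) (\<lambda>\<omega>. X Tst \<omega> + Y Tst \<omega>) \<omega> = X t \<omega> + Y t \<omega>"
      using V t unfolding martingale_on_def by auto
    moreover have "AE \<omega> in M. real_cond_exp M (F t) (\<lambda>\<omega>. X Tst \<omega> + Y Tst \<omega>) \<omega> = real_cond_exp M (F t) (\<lambda>\<omega>. jump_martingale Tst \<omega> - x0) \<omega>"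
    proof (rule S.real_cond_exp_cong[OF terminal])
      show "(\<lambda>\<omega>. X Tst \<omega> + Y Tst \<omega>) \<in> borel_measurable M"
        using V_int[of Tst] horizon_pos by (intro borel_measurable_integrable) auto
      have "jump_martingale Tst \<in> borel_measurable M"
        using horizon_pos by (intro measurable_F_sub[OF jump_martingale_measurable_F]) auto
      then show "(\<lambda>\<omega>. jump_martingale Tst \<omega> - x0) \<in> borel_measurable M" by simp
    qed
    moreover have "AE \<omega> in M. real_cond_exp M (F t) (\<lambda>\<omega>. jump_martingale Tst \<omega> - x0) \<omega> = jump_martingale t \<omega> - x0"
      using t by (intro cond_exp_jump_martingale) auto
    ultimately show ?thesis by eventually_elim simp
  qed
  \<comment> \<open>The horizon is added to the rationals because a jump there cannot be approached
    from the right.\<close>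
  have "AE \<omega> in M. \<forall>t\<in>insert Tst (\<rat> \<inter> {0..Tst}). X t \<omega> + Y t \<omega> = jump_martingale t \<omega> - x0"
  proof (subst AE_ball_countable)
    show "countable (insert Tst (\<rat> \<inter> {0..Tst}))" by (auto intro: countable_subset[OF _ countable_rat])
    show "\<forall>t\<in>insert Tst (\<rat> \<inter> {0..Tst}). AE \<omega> in M. X t \<omega> + Y t \<omega> = jump_martingale t \<omega> - x0"
      using eq horizon_pos by auto
  qed
  moreover have "AE \<omega> in M. cadlag_on Tst (\<lambda>t. Y t \<omega>)" using Y unfolding is_compensated_integral_def by blast
  ultimately show ?thesis
    using X compensated_integral_jumps[OF \<psi> Y] AE_regular
  proof eventually_elim
    case (elim \<omega>)
    show ?case
    proof
      fix s assume s: "s \<in> jump_set \<omega>"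
      then have s': "0 < s" "s \<le> Tst" using elim(5) by (auto simp: jump_set_def less_le)
      define E where "E t = X t \<omega> + Y t \<omega> - jump_martingale t \<omega> + x0" for t
      have E0: "E t = 0" if "t \<in> \<rat>" "0 \<le> t" "t \<le> Tst" for t
        using elim(1) that unfolding E_def by auto
      have Y_left: "((\<lambda>t. Y t \<omega>) \<longlongrightarrow> left_lim (\<lambda>t. Y t \<omega>) s) (at_left s)"
        by (rule cadlag_left_lim[OF elim(2) s'])
      have U_left: "((\<lambda>t. jump_martingale t \<omega>) \<longlongrightarrow> jump_martingale s \<omega> - weight (jump Z s \<omega>)) (at_left s)"
        using jump_martingale_left_limit[of \<omega> s] s by simp
      have "(E \<longlongrightarrow> X s \<omega> + left_lim (\<lambda>t. Y t \<omega>) s - (jump_martingale s \<omega> - weight (jump Z s \<omega>)) + x0) (at_left s)"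
        unfolding E_def by (intro tendsto_intros Y_left U_left continuous_on_at_left_right(1)[OF elim(3) s'])
      then have left: "X s \<omega> + left_lim (\<lambda>t. Y t \<omega>) s - (jump_martingale s \<omega> - weight (jump Z s \<omega>)) + x0 = 0"
        using limit_zero_if_zero_on_rationals(1)[of Tst E, OF E0] s' by blast
      \<comment> \<open>Jump times need not be rational; before the horizon the value at
        \<open>s\<close> is recovered by right continuity.\<close>
      have "E s = 0"
      proof (cases "s = Tst")
        case True
        then show ?thesis using elim(1) unfolding E_def by auto
      next
        case False
        then have sT: "s < Tst" using s' by simp
        have "((\<lambda>t. Y t \<omega>) \<longlongrightarrow> Y s \<omega>) (at_right s)" using elim(2) s' sT unfolding cadlag_on_def by auto
        then have "(E \<longlongrightarrow> X s \<omega> + Y s \<omega> - jump_martingale s \<omega> + x0) (at_right s)"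
          unfolding E_def using s' sT
          by (intro tendsto_intros jump_martingale_right_continuous continuous_on_at_left_right(2)[OF elim(3)]) auto
        then show ?thesis
          using limit_zero_if_zero_on_rationals(2)[of Tst E, OF E0] s' sT unfolding E_def by auto
      qed
      then have "Y s \<omega> - left_lim (\<lambda>t. Y t \<omega>) s = weight (jump Z s \<omega>)" using left unfolding E_def by linarith
      then show "\<psi> s (jump Z s \<omega>) \<omega> = weight (jump Z s \<omega>)" using elim(4) s by simp
    qed
  qed
qed

end

section \<open>Incompleteness\<close>

lemma summable_sparse:
  fixes p :: "nat \<Rightarrow> real" and r :: "nat \<Rightarrow> nat" and g :: "nat \<Rightarrow> real"
  assumes r: "strict_mono r" and bound: "\<And>k. \<bar>g k * p (r k)\<bar> \<le> (1 / 2) ^ k"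
  shows "summable (\<lambda>i. (if i \<in> range r then g (inv r i) else 0) * p i)"
proof -
  have "summable (\<lambda>k. g k * p (r k))"
    by (rule summable_comparison_test'[of "\<lambda>k. (1 / 2) ^ k" 0]) (use bound in auto)
  then have "(\<lambda>k. g k * p (r k)) sums (\<Sum>k. g k * p (r k))" by (rule summable_sums)
  moreover have "(\<lambda>k. g k * p (r k)) = (\<lambda>k. (if r k \<in> range r then g (inv r (r k)) else 0) * p (r k))"
    using strict_mono_imp_inj_on[OF r] by (simp add: fun_eq_iff inv_f_f)
  ultimately have "(\<lambda>i. (if i \<in> range r then g (inv r i) else 0) * p i) sums (\<Sum>k. g k * p (r k))"
    using sums_mono_reindex[OF r, of "\<lambda>i. (if i \<in> range r then g (inv r i) else 0) * p i" "\<Sum>k. g k * p (r k)"] by simp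
  then show ?thesis by (rule sums_summable)
qed

lemma unbounded_square_summable_weights:
  fixes p :: "nat \<Rightarrow> real"
  assumes p: "\<And>i. 0 \<le> p i" "p \<longlonglongrightarrow> 0"
  shows "\<exists>c :: nat \<Rightarrow> real. (\<forall>i. 0 \<le> c i) \<and> summable (\<lambda>i. c i * p i) \<and> summable (\<lambda>i. (c i)\<^sup>2 * p i) \<and>
    (\<forall>C N. \<exists>i\<ge>N. C < c i)"
proof -
  \<comment> \<open>A factor of at most \<open>(real (Suc k))\<^sup>2\<close> on a mass of at most
    \<open>e k\<close> still leaves a term of the geometric series. This covers both the weight
    \<open>real k\<close> and its square.\<close>
  define e where "e k = (1 / 2) ^ k / (real (Suc k))\<^sup>2" for k
  have ex: "\<exists>n. n > m \<and> p n \<le> e k" for m k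
  proof -
    have "\<forall>\<^sub>F n in sequentially. p n < e k"
      by (rule order_tendstoD(2)[OF p(2)]) (simp add: e_def)
    moreover have "\<forall>\<^sub>F n in sequentially. n > m" by (rule eventually_gt_at_top)
    ultimately have "\<forall>\<^sub>F n in sequentially. n > m \<and> p n \<le> e k" by eventually_elim auto
    then show ?thesis by (rule eventually_happens'[OF sequentially_bot])
  qed
  have "\<exists>r. \<forall>k. p (r k) \<le> e k \<and> r k < r (Suc k)"
  proof (rule dependent_nat_choice)
    show "\<exists>n. p n \<le> e 0" using ex[of 0 0] by (elim exE conjE) (rule exI)
    show "\<exists>n. p n \<le> e (Suc k) \<and> m < n" for m k
      using ex[of m "Suc k"] by (elim exE conjE) (intro exI conjI)
  qed
  then obtain r where "\<forall>k. p (r k) \<le> e k \<and> r k < r (Suc k)" ..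
  then have r: "strict_mono r" "\<And>k. p (r k) \<le> e k" by (auto simp: strict_mono_Suc_iff)
  have bound: "\<bar>g * p (r k)\<bar> \<le> (1 / 2) ^ k" if "0 \<le> g" "g \<le> (real (Suc k))\<^sup>2" for g :: real and k
  proof -
    have "g * p (r k) \<le> (real (Suc k))\<^sup>2 * e k" using that r(2)[of k] p(1) by (intro mult_mono) auto
    also have "\<dots> = (1 / 2) ^ k" by (simp add: e_def)
    finally show ?thesis using that p(1) by simp
  qed
  define c where "c i = (if i \<in> range r then real (inv r i) else 0)" for i
  have k_le: "real k \<le> (real (Suc k))\<^sup>2" "(real k)\<^sup>2 \<le> (real (Suc k))\<^sup>2" for k
    by (auto simp: power2_eq_square algebra_simps)
  have "summable (\<lambda>i. c i * p i)"
    unfolding c_def using k_le(1) by (intro summable_sparse[OF r(1)] bound) auto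
  moreover have "summable (\<lambda>i. (if i \<in> range r then (real (inv r i))\<^sup>2 else 0) * p i)"
    using k_le(2) by (intro summable_sparse[OF r(1)] bound) auto
  then have "summable (\<lambda>i. (c i)\<^sup>2 * p i)" by (rule back_subst[of summable]) (auto simp: c_def)
  moreover have "\<exists>i\<ge>N. C < c i" for C N
  proof -
    obtain k :: nat where k: "max C (real N) < k" using reals_Archimedean2 by blast
    have "c (r k) = k" using strict_mono_imp_inj_on[OF r(1)] by (simp add: c_def inv_f_f)
    moreover have "N \<le> r k" using seq_suble[OF r(1), of k] k by simp
    ultimately show ?thesis using k by (intro exI[of _ "r k"]) auto
  qed
  moreover have "\<forall>i. 0 \<le> c i" by (simp add: c_def)
  ultimately show ?thesis by blast
qed

lemma suminf_ennreal_finite: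
  assumes "\<And>i. 0 \<le> g i" "summable g"
  shows "(\<Sum>i. ennreal (g i)) < \<infinity>"
  using suminf_ennreal2[OF assms] by simp

lemma null_sets_times_space:
  assumes "sigma_finite_measure R" and N: "N \<in> null_sets M"
  shows "N \<times> space R \<in> null_sets (M \<Otimes>\<^sub>M R)"
proof -
  interpret sigma_finite_measure R by (rule assms(1))
  have "emeasure (M \<Otimes>\<^sub>M R) (N \<times> space R) = emeasure M N * emeasure R (space R)"
    by (rule emeasure_pair_measure_Times[OF null_setsD2[OF N] sets.top])
  then have "emeasure (M \<Otimes>\<^sub>M R) (N \<times> space R) = 0" using null_setsD1[OF N] by simp
  then show ?thesis using null_setsD2[OF N] by (intro null_setsI pair_measureI sets.top)
qed

context discrete_levy_noise
begin

text \<open>The masses of the disjoint atoms of a finite measure are summable and hence tend to 0,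
  as \<open>unbounded_square_summable_weights\<close> requires.\<close>

lemma weights_exist:
  obtains c where "weighted_jumps M Tst Z a b W \<nu> x c" "\<And>C N. \<exists>i\<ge>N. C < c i"
proof -
  interpret nu: finite_measure \<nu> by (rule finite_nu)
  define p where "p i = measure \<nu> {x i}" for i
  have "disjoint_family (\<lambda>i. {x i})" using inj_x by (auto simp: disjoint_family_on_def inj_on_def)
  then have "(\<lambda>i. measure \<nu> {x i}) sums measure \<nu> (\<Union>i. {x i})"
    by (intro nu.finite_measure_UNION) (auto simp: sets_nu)
  then have "p \<longlonglongrightarrow> 0" unfolding p_def by (rule summable_LIMSEQ_zero[OF sums_summable])
  moreover have "0 \<le> p i" for i by (simp add: p_def)
  ultimately obtain c where c: "\<forall>i. 0 \<le> c i" "summable (\<lambda>i. c i * p i)" "summable (\<lambda>i. (c i)\<^sup>2 * p i)"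
    "\<forall>C N. \<exists>i\<ge>N. C < c i" using unbounded_square_summable_weights[of p] by blast
  have "(\<Sum>i. ennreal (c i) * emeasure \<nu> {x i}) = (\<Sum>i. ennreal (c i * p i))"
    using c(1) by (simp add: emeasure_nu p_def ennreal_mult)
  also have "\<dots> < \<infinity>" using c(1,2) by (intro suminf_ennreal_finite) (simp_all add: p_def)
  finally have "(\<Sum>i. ennreal (c i) * emeasure \<nu> {x i}) < \<infinity>" .
  moreover have "(\<Sum>i. ennreal ((c i)\<^sup>2) * emeasure \<nu> {x i}) = (\<Sum>i. ennreal ((c i)\<^sup>2 * p i))"
    by (simp add: emeasure_nu p_def ennreal_mult)
  moreover have "\<dots> < \<infinity>" using c(3) by (intro suminf_ennreal_finite) (simp_all add: p_def)
  ultimately have "weighted_jumps M Tst Z a b W \<nu> x c"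
    using c(1) by unfold_locales auto
  then show ?thesis using c(4) by (intro that) blast+
qed

text \<open>The compensator formula uses Lebesgue measure on the whole line, the claim its
  restriction to the horizon. The sections of a predictable set lie in the horizon, where the two
  measures agree.\<close>

lemma null_sets_pred_restrict:
  assumes D: "D \<in> sets pred_alg" and null: "D \<in> null_sets (M \<Otimes>\<^sub>M lborel)"
  shows "D \<in> null_sets (M \<Otimes>\<^sub>M restrict_space lborel {0..Tst})"
proof -
  define R where "R = restrict_space lborel {0..Tst}"
  have R_sets: "S \<in> sets R" if "S \<in> sets borel" "S \<subseteq> {0..Tst}" for S
    using that unfolding R_def by (simp add: sets_restrict_space_iff)
  have "finite_measure R"
    unfolding R_def using horizon_pos by (intro finite_measureI) (simp add: space_restrict_space emeasure_restrict_space)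
  then interpret R: finite_measure R .
  have "pred_generator \<subseteq> sets (M \<Otimes>\<^sub>M R)"
    unfolding pred_generator_def using sets_F_sub horizon_pos by (auto intro!: pair_measureI R_sets)
  moreover have "space M \<times> {0..Tst} \<in> sets (M \<Otimes>\<^sub>M R)" by (intro pair_measureI R_sets) auto
  ultimately have "sets pred_alg \<subseteq> sets (M \<Otimes>\<^sub>M R)"
    unfolding sets_pred by (intro sets.sigma_sets_subset') auto
  then have DR: "D \<in> sets (M \<Otimes>\<^sub>M R)" using D by blast
  have D': "D \<in> sets (M \<Otimes>\<^sub>M lborel)" using D sets_pred_sub by blast
  have sub: "D \<subseteq> space M \<times> {0..Tst}" using sets.sets_into_space[OF D] by simp
  have "emeasure (M \<Otimes>\<^sub>M R) D = (\<integral>\<^sup>+ \<omega>. emeasure R (Pair \<omega> -` D) \<partial>M)"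
    by (rule R.emeasure_pair_measure_alt[OF DR])
  also have "\<dots> = (\<integral>\<^sup>+ \<omega>. emeasure lborel (Pair \<omega> -` D) \<partial>M)"
    unfolding R_def using sub by (intro nn_integral_cong emeasure_restrict_space) auto
  also have "\<dots> = emeasure (M \<Otimes>\<^sub>M lborel) D"
    by (rule lborel.emeasure_pair_measure_alt[OF D', symmetric])
  also have "\<dots> = 0" using null by auto
  finally show ?thesis using DR unfolding R_def by (auto simp: null_sets_def)
qed

end

context weighted_jumps
begin

text \<open>For each atom, the set where the predictable version of the integrand differs from the
  weight is predictable and almost surely contains no jump of that size, hence is null. As there are
  countably many atoms, one exceptional set serves all of them.\<close>

lemma integrand_eq_weights:
  assumes X: "AE \<omega> in M. continuous_on {0..Tst} (\<lambda>t. X t \<omega>)"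
    and \<psi>: "\<psi> \<in> Psi12_class M Tst F \<nu>" and Y: "is_compensated_integral M Tst F Z \<nu> \<psi> Y"
    and V: "martingale_on M Tst F (\<lambda>t \<omega>. X t \<omega> + Y t \<omega>)"
    and terminal: "AE \<omega> in M. X Tst \<omega> + Y Tst \<omega> = jump_martingale Tst \<omega> - x0"
  shows "AE p in M \<Otimes>\<^sub>M restrict_space lborel {0..Tst}. \<forall>i. \<psi> (snd p) (x i) (fst p) = c i"
proof -
  let ?R = "M \<Otimes>\<^sub>M restrict_space lborel {0..Tst}"
  obtain \<psi>' where \<psi>': "(\<lambda>((\<omega>, s), x). \<psi>' s x \<omega>) \<in> borel_measurable (pred_alg \<Otimes>\<^sub>M borel)"
    "AE \<omega> in M. \<forall>s\<in>{0..Tst}. \<forall>x. \<psi> s x \<omega> = \<psi>' s x \<omega>"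
    using \<psi> unfolding Psi12_class_def by (elim CollectE conjE exE) (rule that)
  \<comment> \<open>The predictable version is used here because \<psi> agrees with it only outside
    an event of probability zero, so that the same set formed with \<psi> may fail to be
    predictable.\<close>
  define D where "D i = {p \<in> space pred_alg. \<psi>' (snd p) (x i) (fst p) \<noteq> c i}" for i
  have D: "D i \<in> sets pred_alg" for i
  proof -
    have "(\<lambda>p. (p, x i)) \<in> measurable pred_alg (pred_alg \<Otimes>\<^sub>M borel)" by measurable
    from measurable_compose[OF this \<psi>'(1)]
    have [measurable]: "(\<lambda>p. \<psi>' (snd p) (x i) (fst p)) \<in> borel_measurable pred_alg" by (simp add: split_beta)
    show ?thesis unfolding D_def by measurable
  qed
  have D_null: "D i \<in> null_sets ?R" for i
  proof (rule null_sets_pred_restrict[OF D null_if_no_hits[OF D]])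
    show "AE \<omega> in M. \<forall>s\<in>jumps_at i \<omega>. (\<omega>, s) \<notin> D i"
      using integrand_eq_weight_at_jumps[OF assms] \<psi>'(2)
    proof eventually_elim
      case (elim \<omega>)
      show ?case
      proof
        fix s assume s: "s \<in> jumps_at i \<omega>"
        then have "s \<in> jump_set \<omega>" "jump Z s \<omega> = x i" "s \<in> {0..Tst}"
          using x_nonzero[of i] by (auto simp: jumps_at_def jump_set_def split: if_splits)
        then show "(\<omega>, s) \<notin> D i" using elim unfolding D_def by auto
      qed
    qed
  qed
  obtain N where N: "N \<in> null_sets M" "{\<omega> \<in> space M. \<not> (\<forall>s\<in>{0..Tst}. \<forall>x. \<psi> s x \<omega> = \<psi>' s x \<omega>)} \<subseteq> N"
    using \<psi>'(2) by (auto elim!: AE_E simp: null_sets_def)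
  have "finite_measure (restrict_space lborel {0..Tst})"
    using horizon_pos by (intro finite_measureI) (simp add: space_restrict_space emeasure_restrict_space)
  then interpret R: finite_measure "restrict_space lborel {0..Tst}" .
  have "N \<times> space (restrict_space lborel {0..Tst}) \<in> null_sets ?R"
    by (rule null_sets_times_space[OF R.sigma_finite_measure_axioms N(1)])
  then have "(\<Union>i. D i) \<union> N \<times> space (restrict_space lborel {0..Tst}) \<in> null_sets ?R"
    using D_null by (intro null_sets.Un null_sets_UN) auto
  then show ?thesis
  proof (rule AE_I')
    show "{p \<in> space ?R. \<not> (\<forall>i. \<psi> (snd p) (x i) (fst p) = c i)} \<subseteq> (\<Union>i. D i) \<union> N \<times> space (restrict_space lborel {0..Tst})"
    proof
      fix p assume p: "p \<in> {p \<in> space ?R. \<not> (\<forall>i. \<psi> (snd p) (x i) (fst p) = c i)}"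
      obtain \<omega> t where pt: "p = (\<omega>, t)" by (cases p)
      then have \<omega>: "\<omega> \<in> space M" "t \<in> {0..Tst}" using p by (auto simp: space_pair_measure space_restrict_space)
      obtain i where i: "\<psi> t (x i) \<omega> \<noteq> c i" using p pt by auto
      show "p \<in> (\<Union>i. D i) \<union> N \<times> space (restrict_space lborel {0..Tst})"
      proof (cases "\<omega> \<in> N")
        case True
        then show ?thesis using \<omega> by (simp add: pt space_restrict_space)
      next
        case False
        then have "\<psi> t (x i) \<omega> = \<psi>' t (x i) \<omega>" using N(2) \<omega> by blast
        then have "p \<in> D i" using \<omega> i unfolding D_def pt by simp
        then show ?thesis by blast
      qed
    qed
  qed
qed

end

section \<open>Boundedness of the integrands of strategies, and the contradiction\<close>

context bond_market
begin

text \<open>The eventual bound is the product of the \<open>l1\<close> norm of the position, the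
  supremum of the prices, and a bound on \<open>exp (G j) - 1\<close> that is uniform in the
  maturities and holds for all large indices.\<close>

lemma N_integrand_bounded:
  assumes \<phi>: "trading_strategy \<phi>" and \<omega>: "\<omega> \<in> space M" "t \<in> {0..Tst}"
    and price: "norm_B (\<lambda>i. disc_bond_price_left f B t (Tm i) \<omega>) < \<infinity>"
    and lim: "(\<lambda>i. norm_B (\<lambda>j. G_coeff \<gamma> t (y i) (Tm j) \<omega>)) \<longlonglongrightarrow> ennreal \<alpha>0" and \<alpha>0: "0 < \<alpha>0"
  shows "\<exists>C. \<forall>\<^sub>F i in sequentially. \<bar>N_integrand \<phi> t (y i) \<omega>\<bar> \<le> C"
proof -
  define P where "P j = disc_bond_price_left f B t (Tm j) \<omega>" for j
  have sum: "summable (\<lambda>j. \<bar>\<phi> t \<omega> j\<bar>)" using \<phi> \<omega> unfolding trading_strategy_def by blast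
  define K where "K = enn2real (norm_B P)"
  have P: "\<bar>P j\<bar> \<le> K" for j
  proof -
    have "norm_B P < \<infinity>" using price unfolding P_def .
    then have "norm_B P = ennreal K" unfolding K_def by simp
    moreover have "ennreal \<bar>P j\<bar> \<le> norm_B P" unfolding norm_B_def by (rule SUP_upper) simp
    ultimately have "ennreal \<bar>P j\<bar> \<le> ennreal K" by simp
    moreover have "0 \<le> K" by (simp add: K_def)
    ultimately show ?thesis by (simp only: ennreal_le_iff)
  qed
  \<comment> \<open>A finite limit bounds the norms eventually; every number above \<alpha>0 would
    serve as such a bound.\<close>
  have "\<forall>\<^sub>F i in sequentially. norm_B (\<lambda>j. G_coeff \<gamma> t (y i) (Tm j) \<omega>) < ennreal (\<alpha>0 + 1)"
    using \<alpha>0 by (intro order_tendstoD(2)[OF lim]) (simp add: ennreal_less_iff)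
  then have "\<forall>\<^sub>F i in sequentially. \<bar>N_integrand \<phi> t (y i) \<omega>\<bar> \<le> (\<Sum>j. \<bar>\<phi> t \<omega> j\<bar> * (K * exp (\<alpha>0 + 1)))"
  proof eventually_elim
    case (elim i)
    define G where "G j = G_coeff \<gamma> t (y i) (Tm j) \<omega>" for j
    \<comment> \<open>Below 1, the exponential differs from 1 by less than 1; above 1, by less than
      its own value.\<close>
    have G: "\<bar>exp (G j) - 1\<bar> \<le> exp (\<alpha>0 + 1)" for j
    proof -
      have "ennreal \<bar>G j\<bar> \<le> norm_B G" unfolding norm_B_def by (rule SUP_upper) simp
      also have "\<dots> < ennreal (\<alpha>0 + 1)" using elim unfolding G_def .
      finally have "\<bar>G j\<bar> < \<alpha>0 + 1" by (simp add: ennreal_less_iff)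
      then have "exp (G j) \<le> exp (\<alpha>0 + 1)" by simp
      moreover have "1 \<le> exp (\<alpha>0 + 1)" using \<alpha>0 by simp
      moreover have "0 < exp (G j)" by simp
      ultimately show ?thesis by linarith
    qed
    have term_le: "norm (\<phi> t \<omega> j * (P j * (exp (G j) - 1))) \<le> \<bar>\<phi> t \<omega> j\<bar> * (K * exp (\<alpha>0 + 1))" for j
    proof -
      have "\<bar>P j\<bar> * \<bar>exp (G j) - 1\<bar> \<le> K * exp (\<alpha>0 + 1)"
        using P[of j] G[of j] by (intro mult_mono) (auto intro: order_trans[OF abs_ge_zero])
      then show ?thesis by (simp add: abs_mult mult_left_mono)
    qed
    have sum': "summable (\<lambda>j. \<bar>\<phi> t \<omega> j\<bar> * (K * exp (\<alpha>0 + 1)))" by (rule summable_mult2[OF sum])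
    have "norm (\<Sum>j. \<phi> t \<omega> j * (P j * (exp (G j) - 1))) \<le> (\<Sum>j. \<bar>\<phi> t \<omega> j\<bar> * (K * exp (\<alpha>0 + 1)))"
      by (rule norm_suminf_le[OF term_le sum'])
    then show ?case unfolding N_integrand_def pairing_def P_def G_def by simp
  qed
  then show ?thesis by blast
qed

end

theorem theorem4p16:
  fixes M :: "'w measure" and Tst :: real and Z :: "real \<Rightarrow> 'w \<Rightarrow> real" and a b :: real
    and W :: "real \<Rightarrow> 'w \<Rightarrow> real" and \<nu> :: "real measure"
    and f \<alpha> \<sigma> :: "real \<Rightarrow> real \<Rightarrow> 'w \<Rightarrow> real"
    and \<gamma> :: "real \<Rightarrow> real \<Rightarrow> real \<Rightarrow> 'w \<Rightarrow> real"
    and B :: "real \<Rightarrow> 'w \<Rightarrow> real" and Tm :: "nat \<Rightarrow> real"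
    and x :: "nat \<Rightarrow> real"
  assumes "bond_market M Tst Z a b W \<nu> f \<alpha> \<sigma> \<gamma> B Tm"
    and "inj x"
    and "measure_support \<nu> = range x"
    and "filterlim (\<lambda>i. \<bar>x i\<bar>) at_top sequentially"
    and "emeasure (M \<Otimes>\<^sub>M restrict_space lborel {0..Tst})
           {(\<omega>, t). \<omega> \<in> space M \<and> t \<in> {0..Tst} \<and>
              (\<exists>\<alpha>0::real. 0 < \<alpha>0 \<and>
                 (\<lambda>i. norm_B (\<lambda>j. G_coeff \<gamma> t (x i) (Tm j) \<omega>)) \<longlonglongrightarrow> ennreal \<alpha>0)} > 0"
  shows "\<not> bond_market.L2_complete M Tst Z W \<nu> f \<sigma> \<gamma> B Tm"
proof
  interpret bond_market M Tst Z a b W \<nu> f \<alpha> \<sigma> \<gamma> B Tm by (rule assms(1))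
  assume complete: "L2_complete"
  interpret discrete_levy_noise M Tst Z a b W \<nu> x
    using assms(2-4) by unfold_locales
  obtain c where c: "weighted_jumps M Tst Z a b W \<nu> x c" "\<And>C N. \<exists>i\<ge>N. C < c i"
    by (fact weights_exist)
  interpret weighted_jumps M Tst Z a b W \<nu> x c by (rule c(1))
  have T: "0 \<le> Tst" "Tst \<in> {0..Tst}" using horizon_pos by auto
  let ?R = "M \<Otimes>\<^sub>M restrict_space lborel {0..Tst}"
  have "replicable (jump_martingale Tst)"
    using complete jump_martingale_measurable_F[OF T(1) order_refl] jump_martingale_square_integrable
    unfolding L2_complete_def by blast
  then obtain x0 \<phi> V where V: "admissible \<phi>" "is_price_integral \<phi> V" "AE \<omega> in M. jump_martingale Tst \<omega> = x0 + V Tst \<omega>"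
    unfolding replicable_def by (elim exE conjE)
  obtain V' where V': "price_integrable \<phi>" "is_price_integral \<phi> V'" "martingale_on M Tst F V'"
    using V(1) unfolding admissible_def by (elim exE conjE)
  have \<phi>: "trading_strategy \<phi>" "W_integrand \<phi> \<in> Phi_class M Tst F" "N_integrand \<phi> \<in> Psi12_class M Tst F \<nu>"
    using V'(1) unfolding price_integrable_def by auto
  obtain X Y where XY: "is_ito_integral M Tst F W (W_integrand \<phi>) X"
    "is_compensated_integral M Tst F Z \<nu> (N_integrand \<phi>) Y" "V = (\<lambda>t \<omega>. X t \<omega> + Y t \<omega>)"
    using V(2) unfolding is_price_integral_def by (elim exE conjE)
  obtain X' Y' where XY': "is_ito_integral M Tst F W (W_integrand \<phi>) X'"
    "is_compensated_integral M Tst F Z \<nu> (N_integrand \<phi>) Y'" "V' = (\<lambda>t \<omega>. X' t \<omega> + Y' t \<omega>)"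
    using V'(2) unfolding is_price_integral_def by (elim exE conjE)
  \<comment> \<open>\<open>V\<close> and \<open>V'\<close> may be different versions of the price integral; only \<open>V'\<close> is known to be a
    martingale, and only \<open>V\<close> is known to replicate.\<close>
  have terminal: "AE \<omega> in M. X' Tst \<omega> + Y' Tst \<omega> = jump_martingale Tst \<omega> - x0"
    using V(3) ito_integral_unique[OF \<phi>(2) XY(1) XY'(1)] compensated_integral_unique[OF XY(2) XY'(2)]
    by eventually_elim (simp add: XY(3))
  have "AE \<omega> in M. continuous_on {0..Tst} (\<lambda>t. X' t \<omega>)" using XY'(1) unfolding is_ito_integral_def by blast
  from integrand_eq_weights[OF this \<phi>(3) XY'(2) V'(3)[unfolded XY'(3)] terminal]
  have "AE p in ?R. \<forall>i. N_integrand \<phi> (snd p) (x i) (fst p) = c i" .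
  then obtain D where D: "D \<in> null_sets ?R" "{p \<in> space ?R. \<not> (\<forall>i. N_integrand \<phi> (snd p) (x i) (fst p) = c i)} \<subseteq> D"
    by (auto elim!: AE_E simp: null_sets_def)
  obtain N where N: "N \<in> null_sets M"
    "{\<omega> \<in> space M. \<not> (\<forall>t\<in>{0..Tst}. norm_B (\<lambda>i. disc_bond_price_left f B t (Tm i) \<omega>) < \<infinity>)} \<subseteq> N"
    using prices_in_B by (auto elim!: AE_E simp: null_sets_def)
  have "finite_measure (restrict_space lborel {0..Tst})"
    using horizon_pos by (intro finite_measureI) (simp add: space_restrict_space emeasure_restrict_space)
  then interpret R: finite_measure "restrict_space lborel {0..Tst}" .
  \<comment> \<open>\<open>D\<close> collects the points where the replicating integrand misses some
    weight, the product set the outcomes with an unbounded price sequence.\<close>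
  let ?E = "D \<union> N \<times> space (restrict_space lborel {0..Tst})"
  have "N \<times> space (restrict_space lborel {0..Tst}) \<in> null_sets ?R"
    by (rule null_sets_times_space[OF R.sigma_finite_measure_axioms N(1)])
  then have E: "?E \<in> null_sets ?R" using D(1) by (rule null_sets.Un[rotated])
  have "{(\<omega>, t). \<omega> \<in> space M \<and> t \<in> {0..Tst} \<and>
              (\<exists>\<alpha>0::real. 0 < \<alpha>0 \<and>
                 (\<lambda>i. norm_B (\<lambda>j. G_coeff \<gamma> t (x i) (Tm j) \<omega>)) \<longlonglongrightarrow> ennreal \<alpha>0)} \<subseteq> ?E" (is "?A \<subseteq> _")
  proof
    fix p assume "p \<in> ?A"
    then obtain \<omega> t \<alpha>0 where p: "p = (\<omega>, t)" "\<omega> \<in> space M" "t \<in> {0..Tst}" "0 < \<alpha>0"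
      "(\<lambda>i. norm_B (\<lambda>j. G_coeff \<gamma> t (x i) (Tm j) \<omega>)) \<longlonglongrightarrow> ennreal \<alpha>0" by auto
    show "p \<in> ?E"
    proof (rule ccontr)
      assume no: "p \<notin> ?E"
      have "norm_B (\<lambda>i. disc_bond_price_left f B t (Tm i) \<omega>) < \<infinity>"
      proof -
        have "\<omega> \<notin> N" using no p by (auto simp: space_restrict_space)
        then show ?thesis using N(2) p(2,3) by blast
      qed
      from N_integrand_bounded[OF \<phi>(1) p(2,3) this p(5,4)]
      obtain C where "\<forall>\<^sub>F i in sequentially. \<bar>N_integrand \<phi> t (x i) \<omega>\<bar> \<le> C" by blast
      moreover have "N_integrand \<phi> t (x i) \<omega> = c i" for i
      proof -
        have "p \<in> space ?R" using p by (simp add: space_pair_measure space_restrict_space)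
        moreover have "p \<notin> D" using no by simp
        ultimately have "\<forall>i. N_integrand \<phi> (snd p) (x i) (fst p) = c i" using D(2) by blast
        then show ?thesis by (simp add: p(1))
      qed
      ultimately have "\<forall>\<^sub>F i in sequentially. \<bar>c i\<bar> \<le> C" by simp
      then obtain n where n: "\<And>i. i \<ge> n \<Longrightarrow> \<bar>c i\<bar> \<le> C" unfolding eventually_sequentially by blast
      obtain i where "i \<ge> n" "C < c i" using c(2)[of n C] by blast
      then show False using n[of i] by simp
    qed
  qed
  \<comment> \<open>Monotonicity asks for measurability of the larger set \<open>?E\<close>, which
    holds because it is a null set.\<close>
  then have "emeasure ?R ?A \<le> emeasure ?R ?E" using E by (intro emeasure_mono) auto
  also have "\<dots> = 0" using E by auto
  finally show False using assms(5) by simp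
qed

end
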